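(* Let $Q_8=\{\pm 1,\pm i,\pm j,\pm k\}\subset\mathbb{H}$ act on the unit sphere $S^7\subset\mathbb{H}\oplus\mathbb{H}$ by left quaternion multiplication, and let $\eta$ be the complex 2-plane bundle on $S^7/Q_8$ associated to the 2-dimensional complex representation $y$ of $Q_8$ arising from the inclusion $Q_8\subset S^3=\operatorname{SU}(2)$. Then the stable normal bundle of $S^7/Q_8$ is $6\,\eta_{\mathbb{R}}$, which has the form $2k\,\eta_{\mathbb{R}}$ with $k=3$ odd. Consequently the identity map of $S^7/Q_8$ (which has degree $1$) is a counterexample to the following assertion, which is therefore false: "Let $f:K^7\to S^7/Q_8$ be a continuous map of a smooth closed oriented 7-manifold $K^7$ to $S^7/Q_8$, and assume that the stable normal bundle to $K^7$ has the form $f^*(2k\,\eta_{\mathbb{R}})$ with $k$ odd. Then the degree of $f$ is even."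
   Context: $\mathbb{H}$ denotes the quaternions. $Q_8$ acts freely on the unit sphere $S^7$ of $\mathbb{H}\oplus\mathbb{H}$ (identified with $\mathbb{C}^2\oplus\mathbb{C}^2$) by left quaternion multiplication on each summand, so $S^7/Q_8$ is a smooth closed orientable 7-manifold; fix an orientation on it. The representation $y$ is the 2-dimensional complex representation of $Q_8$ obtained from the inclusion of $Q_8$ in the unit quaternions $S^3=\operatorname{SU}(2)$, i.e. left multiplication on $\mathbb{H}\cong\mathbb{C}^2$; its character is $2$ at $1$, $-2$ at $-1$, and $0$ at $\pm i,\pm j,\pm k$. To a complex representation $V$ of $Q_8$ one associates the complex vector bundle on $S^7/Q_8$ with total space the orbit space $(S^7\times V)/Q_8$ (diagonal action); $\eta$ is the bundle associated to $y$. For a complex vector bundle $\zeta$, $\zeta_{\mathbb{R}}$ denotes its underlying oriented real vector bundle, and $m\,\zeta_{\mathbb{R}}$ is the $m$-fold direct sum. The stable normal bundle of a closed manifold $M$ is the stable equivalence class (isomorphism after adding trivial real bundles) of a real vector bundle $\nu$ such that $TM\oplus\nu$ is stably trivial; saying that it "is" or "has the form of" a given bundle means equality of stable classes. *)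

theory Defs
  imports "HOL-Analysis.Analysis" "HOL-Homology.Homology"
begin

section \<open>Quotient topologies\<close>

definition quotient_topology :: "'a topology \<Rightarrow> ('a \<Rightarrow> 'b) \<Rightarrow> 'b topology" where
  "quotient_topology X q =
     topology (\<lambda>U. U \<subseteq> q ` topspace X \<and> openin X {x \<in> topspace X. q x \<in> U})"

lemma openin_quotient_topology:
  "openin (quotient_topology X q) U \<longleftrightarrow>
     U \<subseteq> q ` topspace X \<and> openin X {x \<in> topspace X. q x \<in> U}"
proof -
  have "istopology (\<lambda>U. U \<subseteq> q ` topspace X \<and> openin X {x \<in> topspace X. q x \<in> U})"
    unfolding istopology_def
  proof (intro conjI allI impI)
    fix S T assume S: "S \<subseteq> q ` topspace X \<and> openin X {x \<in> topspace X. q x \<in> S}"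
      and T: "T \<subseteq> q ` topspace X \<and> openin X {x \<in> topspace X. q x \<in> T}"
    have "{x \<in> topspace X. q x \<in> S \<inter> T} =
        {x \<in> topspace X. q x \<in> S} \<inter> {x \<in> topspace X. q x \<in> T}" by blast
    with S T show "openin X {x \<in> topspace X. q x \<in> S \<inter> T}" by auto
    show "S \<inter> T \<subseteq> q ` topspace X" using S by blast
  next
    fix \<K> assume K: "\<forall>S\<in>\<K>. S \<subseteq> q ` topspace X \<and> openin X {x \<in> topspace X. q x \<in> S}"
    have "{x \<in> topspace X. q x \<in> \<Union>\<K>} = (\<Union>S\<in>\<K>. {x \<in> topspace X. q x \<in> S})" by blast
    moreover have "openin X (\<Union>S\<in>\<K>. {x \<in> topspace X. q x \<in> S})" using K by blast
    ultimately show "openin X {x \<in> topspace X. q x \<in> \<Union>\<K>}" by simp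
    show "\<Union>\<K> \<subseteq> q ` topspace X" using K by blast
  qed
  then show ?thesis by (simp add: quotient_topology_def)
qed


section \<open>Vector bundles\<close>

text \<open>A bundle is given by its base and total spaces, its projection and its fibrewise
  operations; the operations are only meaningful on points of the total space, and
  addition only on points of a common fibre.  The type of scalars \<open>'s\<close> is real or complex.\<close>

record ('s, 'b, 'e) vbundle =
  bun_base :: "'b topology"
  bun_total :: "'e topology"
  bun_proj :: "'e \<Rightarrow> 'b"
  bun_add :: "'e \<Rightarrow> 'e \<Rightarrow> 'e"
  bun_scale :: "'s \<Rightarrow> 'e \<Rightarrow> 'e"

definition coord_space :: "nat \<Rightarrow> (nat \<Rightarrow> 's::topological_space) topology" where
  "coord_space n = product_topology (\<lambda>_. euclidean) {..<n}"

definition vector_bundle :: "('s::real_normed_field, 'b, 'e) vbundle \<Rightarrow> bool" where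
  "vector_bundle E \<longleftrightarrow>
     continuous_map (bun_total E) (bun_base E) (bun_proj E) \<and>
     (\<forall>b\<in>topspace (bun_base E). \<exists>U n \<phi>. openin (bun_base E) U \<and> b \<in> U \<and>
        (let EU = {e \<in> topspace (bun_total E). bun_proj E e \<in> U} in
          homeomorphic_map (subtopology (bun_total E) EU)
            (prod_topology (subtopology (bun_base E) U) (coord_space n)) \<phi> \<and>
          (\<forall>e\<in>EU. fst (\<phi> e) = bun_proj E e) \<and>
          (\<forall>e\<in>EU. \<forall>e'\<in>EU. bun_proj E e = bun_proj E e' \<longrightarrow>
             bun_add E e e' \<in> EU \<and> bun_proj E (bun_add E e e') = bun_proj E e \<and>
             (\<forall>i<n. snd (\<phi> (bun_add E e e')) i = snd (\<phi> e) i + snd (\<phi> e') i)) \<and>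
          (\<forall>c. \<forall>e\<in>EU.
             bun_scale E c e \<in> EU \<and> bun_proj E (bun_scale E c e) = bun_proj E e \<and>
             (\<forall>i<n. snd (\<phi> (bun_scale E c e)) i = c * snd (\<phi> e) i))))"

definition bundle_iso :: "('s, 'b, 'e) vbundle \<Rightarrow> ('s, 'b, 'f) vbundle \<Rightarrow> bool"
    (infix "\<cong>\<^sub>b" 50) where
  "E \<cong>\<^sub>b F \<longleftrightarrow>
     bun_base E = bun_base F \<and>
     (\<exists>h. homeomorphic_map (bun_total E) (bun_total F) h \<and>
        (\<forall>e\<in>topspace (bun_total E). bun_proj F (h e) = bun_proj E e) \<and>
        (\<forall>e\<in>topspace (bun_total E). \<forall>e'\<in>topspace (bun_total E).
           bun_proj E e = bun_proj E e' \<longrightarrow> h (bun_add E e e') = bun_add F (h e) (h e')) \<and>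
        (\<forall>c. \<forall>e\<in>topspace (bun_total E). h (bun_scale E c e) = bun_scale F c (h e)))"

definition trivial_bundle ::
    "'b topology \<Rightarrow> nat \<Rightarrow> ('s::real_normed_field, 'b, 'b \<times> (nat \<Rightarrow> 's)) vbundle" where
  "trivial_bundle X n = \<lparr>
     bun_base = X,
     bun_total = prod_topology X (coord_space n),
     bun_proj = fst,
     bun_add = (\<lambda>(x, v) (_, w). (x, \<lambda>i\<in>{..<n}. v i + w i)),
     bun_scale = (\<lambda>c (x, v). (x, \<lambda>i\<in>{..<n}. c * v i))\<rparr>"

definition whitney_sum ::
    "('s, 'b, 'e) vbundle \<Rightarrow> ('s, 'b, 'f) vbundle \<Rightarrow> ('s, 'b, 'e \<times> 'f) vbundle"
    (infixr "\<oplus>\<^sub>b" 65) where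
  "E \<oplus>\<^sub>b F = \<lparr>
     bun_base = bun_base E,
     bun_total = subtopology (prod_topology (bun_total E) (bun_total F))
                   {(e, f). bun_proj E e = bun_proj F f},
     bun_proj = (\<lambda>(e, _). bun_proj E e),
     bun_add = (\<lambda>(e, f) (e', f'). (bun_add E e e', bun_add F f f')),
     bun_scale = (\<lambda>c (e, f). (bun_scale E c e, bun_scale F c f))\<rparr>"

text \<open>The base point is kept as a component, so that the 0-fold sum is the zero bundle
  over the same base.\<close>

definition multiple_bundle ::
    "nat \<Rightarrow> ('s, 'b, 'e) vbundle \<Rightarrow> ('s, 'b, 'b \<times> (nat \<Rightarrow> 'e)) vbundle" where
  "multiple_bundle m E = \<lparr>
     bun_base = bun_base E,
     bun_total = subtopology
                   (prod_topology (bun_base E) (product_topology (\<lambda>_. bun_total E) {..<m}))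
                   {(x, v). \<forall>i<m. bun_proj E (v i) = x},
     bun_proj = fst,
     bun_add = (\<lambda>(x, v) (_, w). (x, \<lambda>i\<in>{..<m}. bun_add E (v i) (w i))),
     bun_scale = (\<lambda>c (x, v). (x, \<lambda>i\<in>{..<m}. bun_scale E c (v i)))\<rparr>"

definition pullback_bundle ::
    "'a topology \<Rightarrow> ('a \<Rightarrow> 'b) \<Rightarrow> ('s, 'b, 'e) vbundle \<Rightarrow> ('s, 'a, 'a \<times> 'e) vbundle" where
  "pullback_bundle X f E = \<lparr>
     bun_base = X,
     bun_total = subtopology (prod_topology X (bun_total E)) {(x, e). f x = bun_proj E e},
     bun_proj = fst,
     bun_add = (\<lambda>(x, e) (_, e'). (x, bun_add E e e')),
     bun_scale = (\<lambda>c (x, e). (x, bun_scale E c e))\<rparr>"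

definition underlying_real :: "(complex, 'b, 'e) vbundle \<Rightarrow> (real, 'b, 'e) vbundle" where
  "underlying_real E = \<lparr>
     bun_base = bun_base E,
     bun_total = bun_total E,
     bun_proj = bun_proj E,
     bun_add = bun_add E,
     bun_scale = (\<lambda>r. bun_scale E (complex_of_real r))\<rparr>"

definition stably_trivial :: "(real, 'b, 'e) vbundle \<Rightarrow> bool" where
  "stably_trivial E \<longleftrightarrow>
     (\<exists>a b. E \<oplus>\<^sub>b trivial_bundle (bun_base E) a \<cong>\<^sub>b trivial_bundle (bun_base E) b)"


section \<open>Smooth manifolds\<close>

text \<open>\<open>f\<close> is \<open>k\<close> times continuously differentiable on the open set \<open>S\<close> (in finite
  dimension this is the usual condition on iterated directional derivatives).\<close>

primrec Ck_on ::
    "nat \<Rightarrow> ('a::euclidean_space \<Rightarrow> 'b::euclidean_space) \<Rightarrow> 'a set \<Rightarrow> bool" where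
  "Ck_on 0 f S = continuous_on S f"
| "Ck_on (Suc k) f S = ((\<forall>x\<in>S. f differentiable (at x)) \<and>
     (\<forall>v. Ck_on k (\<lambda>x. frechet_derivative f (at x) v) S))"

definition smooth_on :: "('a::euclidean_space \<Rightarrow> 'b::euclidean_space) \<Rightarrow> 'a set \<Rightarrow> bool" where
  "smooth_on f S \<longleftrightarrow> (\<forall>k. Ck_on k f S)"

text \<open>A chart is a pair of its domain and its coordinate map; the values of the
  coordinate map off the domain are irrelevant.\<close>

type_synonym ('a, 'e) chart = "'a set \<times> ('a \<Rightarrow> 'e)"

definition transition :: "('a, 'e) chart \<Rightarrow> ('a, 'e) chart \<Rightarrow> 'e \<Rightarrow> 'e" where
  "transition c c' = snd c' \<circ> inv_into (fst c) (snd c)"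

text \<open>Compact smooth manifold without boundary, of dimension \<open>DIM('e)\<close>.  Second
  countability is automatic.\<close>

definition closed_smooth_manifold ::
    "'a topology \<Rightarrow> ('a, 'e::euclidean_space) chart set \<Rightarrow> bool" where
  "closed_smooth_manifold X A \<longleftrightarrow>
     compact_space X \<and> Hausdorff_space X \<and>
     (\<forall>(U, \<phi>)\<in>A. openin X U \<and> open (\<phi> ` U) \<and>
        homeomorphic_map (subtopology X U) (top_of_set (\<phi> ` U)) \<phi>) \<and>
     (\<Union>c\<in>A. fst c) = topspace X \<and>
     (\<forall>c\<in>A. \<forall>c'\<in>A. smooth_on (transition c c') (snd c ` (fst c \<inter> fst c')))"

text \<open>A tangent vector at \<open>x\<close> is the family of its coordinate vectors in all the charts
  around \<open>x\<close>, related by the derivatives of the transition maps; it is extended by 0 to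
  everything that is not a chart around \<open>x\<close>.\<close>

definition tangent_vectors ::
    "'a topology \<Rightarrow> ('a, 'e::euclidean_space) chart set \<Rightarrow> ('a \<times> (('a, 'e) chart \<Rightarrow> 'e)) set" where
  "tangent_vectors X A = {(x, v). x \<in> topspace X \<and>
     (\<forall>c. c \<notin> A \<or> x \<notin> fst c \<longrightarrow> v c = 0) \<and>
     (\<forall>c\<in>A. \<forall>c'\<in>A. x \<in> fst c \<inter> fst c' \<longrightarrow>
        v c' = frechet_derivative (transition c c') (at (snd c x)) (v c))}"

definition tangent_bundle ::
    "'a topology \<Rightarrow> ('a, 'e::euclidean_space) chart set \<Rightarrow>
     (real, 'a, 'a \<times> (('a, 'e) chart \<Rightarrow> 'e)) vbundle" where
  "tangent_bundle X A = \<lparr>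
     bun_base = X,
     bun_total = topology_generated_by
       {{(x, v). (x, v) \<in> tangent_vectors X A \<and> x \<in> fst c \<and> (snd c x, v c) \<in> W} | c W.
          c \<in> A \<and> open W},
     bun_proj = fst,
     bun_add = (\<lambda>(x, v) (_, w). (x, \<lambda>c. v c + w c)),
     bun_scale = (\<lambda>r (x, v). (x, \<lambda>c. r *\<^sub>R v c))\<rparr>"

text \<open>\<open>\<nu>\<close> represents the stable normal bundle, i.e. the stable class of the vector bundles
  whose sum with the tangent bundle is stably trivial.\<close>

definition is_stable_normal_bundle ::
    "'a topology \<Rightarrow> ('a, 'e::euclidean_space) chart set \<Rightarrow> (real, 'a, 'f) vbundle \<Rightarrow> bool" where
  "is_stable_normal_bundle X A \<nu> \<longleftrightarrow>
     vector_bundle \<nu> \<and> bun_base \<nu> = X \<and> stably_trivial (tangent_bundle X A \<oplus>\<^sub>b \<nu>)"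


section \<open>Orientations and degree\<close>

text \<open>An orientation of a closed \<open>n\<close>-manifold is given by its fundamental class: an
  integral homology class that restricts to a generator of the local homology group at
  every point.\<close>

definition fundamental_class :: "nat \<Rightarrow> 'a topology \<Rightarrow> 'a chain set \<Rightarrow> bool" where
  "fundamental_class n X \<mu> \<longleftrightarrow>
     \<mu> \<in> carrier (homology_group (int n) X) \<and>
     (\<forall>x\<in>topspace X.
        generate (relative_homology_group (int n) X (topspace X - {x}))
          {hom_induced (int n) X {} X (topspace X - {x}) id \<mu>} =
        carrier (relative_homology_group (int n) X (topspace X - {x})))"

text \<open>The degree of \<open>f : X \<rightarrow> Y\<close> with respect to the fundamental classes \<open>\<kappa>\<close> of \<open>X\<close> and
  \<open>\<mu>\<close> of the connected manifold \<open>Y\<close>.  Homology groups are written multiplicatively.\<close>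

definition mapping_degree ::
    "nat \<Rightarrow> 'a topology \<Rightarrow> 'a chain set \<Rightarrow> 'b topology \<Rightarrow> 'b chain set \<Rightarrow> ('a \<Rightarrow> 'b) \<Rightarrow> int" where
  "mapping_degree n X \<kappa> Y \<mu> f =
     (THE d::int. hom_induced (int n) X {} Y {} f \<kappa> = \<mu> [^]\<^bsub>homology_group (int n) Y\<^esub> d)"


section \<open>The quaternion group and its action on the 7-sphere\<close>

text \<open>The pair \<open>(u, v)\<close> is the quaternion \<open>u + j v\<close>, so that complex scalars act on the
  right and left quaternion multiplication is complex linear.\<close>

type_synonym quat = "complex \<times> complex"

definition qmult :: "quat \<Rightarrow> quat \<Rightarrow> quat" where
  "qmult = (\<lambda>(a, b) (u, v). (a * u - cnj b * v, b * u + cnj a * v))"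

definition q1 :: quat where "q1 = (1, 0)"
definition qi :: quat where "qi = (\<i>, 0)"
definition qj :: quat where "qj = (0, 1)"
definition qk :: quat where "qk = qmult qi qj"

lemma quaternion_relations:
  "qmult qi qi = - q1" "qmult qj qj = - q1" "qmult qk qk = - q1"
  "qmult (qmult qi qj) qk = - q1"
  "qmult q1 x = x" "qmult x q1 = x" "qmult (qmult x y) z = qmult x (qmult y z)"
  by (auto simp: qmult_def q1_def qi_def qj_def qk_def algebra_simps split: prod.split)

definition Q8 :: "quat set" where
  "Q8 = {q1, - q1, qi, - qi, qj, - qj, qk, - qk}"

definition act :: "quat \<Rightarrow> quat \<times> quat \<Rightarrow> quat \<times> quat" where
  "act g = (\<lambda>(p, q). (qmult g p, qmult g q))"

definition orbit :: "quat \<times> quat \<Rightarrow> (quat \<times> quat) set" where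
  "orbit x = (\<lambda>g. act g x) ` Q8"

definition S7 :: "(quat \<times> quat) set" where
  "S7 = sphere 0 1"

definition S7Q8 :: "(quat \<times> quat) set topology" where
  "S7Q8 = quotient_topology (top_of_set S7) orbit"

text \<open>The smooth structure for which the orbit map is a local diffeomorphism.  If
  \<open>x \<mapsto> (L x, u \<bullet> x)\<close> is a linear isomorphism, then \<open>x \<mapsto> L x / (u \<bullet> x)\<close> (central projection
  to an affine hyperplane) is a diffeomorphism from the open hemisphere \<open>u \<bullet> x > 0\<close> onto
  \<^typ>\<open>real ^ 7\<close>.\<close>

definition S7Q8_atlas :: "((quat \<times> quat) set, real ^ 7) chart set" where
  "S7Q8_atlas =
     {(orbit ` W, \<lambda>p. let x = inv_into W orbit p in L x /\<^sub>R (u \<bullet> x)) | W L u.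
        openin (top_of_set S7) W \<and> inj_on orbit W \<and> (\<forall>x\<in>W. u \<bullet> x > 0) \<and>
        linear L \<and> inj (\<lambda>x. (L x, u \<bullet> x))}"


section \<open>Bundles associated to representations\<close>

definition assoc_orbit ::
    "(quat \<Rightarrow> complex ^ 'n ^ 'n) \<Rightarrow> (quat \<times> quat) \<times> (complex ^ 'n) \<Rightarrow>
     ((quat \<times> quat) \<times> (complex ^ 'n)) set" where
  "assoc_orbit \<rho> = (\<lambda>(x, v). (\<lambda>g. (act g x, \<rho> g *v v)) ` Q8)"

text \<open>The points of the total space are orbits.  The first components of the elements of
  an orbit form the orbit in the sphere over which it lies.  As the action on the sphere is
  free, every element of a fibre has exactly one representative \<open>(x, v)\<close> for each \<open>x\<close> in
  the orbit below.\<close>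

definition associated_bundle ::
    "(quat \<Rightarrow> complex ^ 'n ^ 'n) \<Rightarrow>
     (complex, (quat \<times> quat) set, ((quat \<times> quat) \<times> (complex ^ 'n)) set) vbundle" where
  "associated_bundle \<rho> = \<lparr>
     bun_base = S7Q8,
     bun_total = quotient_topology (prod_topology (top_of_set S7) euclidean) (assoc_orbit \<rho>),
     bun_proj = (\<lambda>P. fst ` P),
     bun_add = (\<lambda>P P'. {(x, v + w) | x v w. (x, v) \<in> P \<and> (x, w) \<in> P'}),
     bun_scale = (\<lambda>c P. {(x, c *s v) | x v. (x, v) \<in> P})\<rparr>"

definition rep_y :: "quat \<Rightarrow> complex ^ 2 ^ 2" where
  "rep_y = (\<lambda>(a, b). vector [vector [a, - cnj b], vector [b, cnj a]])"

lemma rep_y_left_mult: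
  "rep_y g *v vector [u, v] = vector [fst (qmult g (u, v)), snd (qmult g (u, v))]"
  by (cases g) (simp add: rep_y_def qmult_def vec_eq_iff matrix_vector_mult_def forall_2 sum_2)

lemma character_rep_y:
  "trace (rep_y q1) = 2" "trace (rep_y (- q1)) = - 2"
  "g \<in> {qi, - qi, qj, - qj, qk, - qk} \<Longrightarrow> trace (rep_y g) = 0"
  by (auto simp: rep_y_def q1_def qi_def qj_def qk_def qmult_def trace_def sum_2)

definition eta :: "(complex, (quat \<times> quat) set, ((quat \<times> quat) \<times> (complex ^ 2)) set) vbundle" where
  "eta = associated_bundle rep_y"

abbreviation eta_R :: "(real, (quat \<times> quat) set, ((quat \<times> quat) \<times> (complex ^ 2)) set) vbundle" where
  "eta_R \<equiv> underlying_real eta"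

end

(*
  The 7-sphere is the unit sphere of 2y, so adding the radial direction turns the tangent bundle of
  S7/Q8 into 2 eta_R, and the theorem amounts to the stable triviality of 8 eta_R.  Let T be the
  trivial 4-dimensional representation and K the quaternions with the conjugation action, the sum of
  the four real characters of Q8.  Clifford multiplication by the points of the sphere gives an
  isomorphism 2y = T + K of bundles over S7/Q8.  Twisting it by a real character c changes neither
  2y nor K, so T + K = cT + K; as K embeds into a trivial bundle, cT is stably trivial.  Hence
  8y = 4T + 4K is stably trivial, because 4K is the sum of the four bundles cT.

  The degree of the identity is well defined because the fundamental class restricts to a generator
  of an infinite cyclic local homology group, hence has infinite order.
*)

theory Submission
  imports Defs
begin

section \<open>Quaternions and the group \<open>Q\<^sub>8\<close>\<close>

text \<open>The element -1 acts as -1 on 2y and trivially on T + K, so no linear map independent of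
  the point of the sphere can identify them; Clifford multiplication by x is invertible because x is
  nonzero. A twist by c is invisible on 2y and K because some u among 1, i, j, k satisfies ug = c(g)
  gu for all g, and left multiplication by u is then an isomorphism onto the twist. Cancelling K
  yields four copies of the line bundle of c at a time, not one; this is why four copies of K, hence
  8y, are needed. The bundles themselves are spaces of orbits, tuples or families of coordinate
  vectors, on unrelated types and with different topologies. Each is presented as the quotient by Q8
  of a family of vector spaces over the sphere, and bundle isomorphisms are obtained from continuous
  equivariant families of linear maps, where only quaternion algebra remains.\<close>

definition qconj :: "quat \<Rightarrow> quat" where
  "qconj = (\<lambda>(a, b). (cnj a, - b))"

lemma qmult_assoc: "qmult (qmult x y) z = qmult x (qmult y z)"
  by (rule quaternion_relations)

lemma qmult_q1 [simp]: "qmult q1 x = x" "qmult x q1 = x"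
  by (rule quaternion_relations)+

lemma norm_quat: "(norm (a, b))\<^sup>2 = (norm a)\<^sup>2 + (norm b)\<^sup>2"
  by (simp add: norm_Pair)

lemma norm_q1 [simp]: "norm q1 = 1"
  by (simp add: q1_def norm_Pair)

lemma bilinear_qmult: "bilinear qmult"
  by (auto simp: bilinear_def linear_iff qmult_def algebra_simps scaleR_conv_of_real split: prod.splits)

interpretation qmult: bounded_bilinear qmult
  using bilinear_qmult by (simp add: bilinear_conv_bounded_bilinear)

lemma linear_qconj: "linear qconj"
  by (auto simp: linear_iff qconj_def split: prod.splits)

lemma qconj_linear_simps [simp]:
  "qconj (x + y) = qconj x + qconj y" "qconj (x - y) = qconj x - qconj y"
  "qconj (- x) = - qconj x" "qconj (r *\<^sub>R x) = r *\<^sub>R qconj x"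
  by (simp_all add: linear_add linear_diff linear_neg linear_cmul linear_qconj)

lemma continuous_on_qconj [continuous_intros]:
  "continuous_on S f \<Longrightarrow> continuous_on S (\<lambda>x. qconj (f x))"
  using bounded_linear.continuous_on[of qconj S f] linear_qconj
  by (simp add: linear_conv_bounded_linear)

lemma qconj_qconj [simp]: "qconj (qconj x) = x"
  by (auto simp: qconj_def split: prod.splits)

lemma qconj_qmult [simp]: "qconj (qmult x y) = qmult (qconj y) (qconj x)"
  by (cases x; cases y) (simp add: qconj_def qmult_def mult.commute)

lemma norm_qconj [simp]: "norm (qconj x) = norm x"
  by (cases x) (simp add: qconj_def norm_Pair)

lemma qmult_qconj:
  "qmult (qconj x) x = (norm x)\<^sup>2 *\<^sub>R q1" "qmult x (qconj x) = (norm x)\<^sup>2 *\<^sub>R q1"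
proof -
  obtain a b where x: "x = (a, b)"
    by (cases x)
  have *: "cnj z * z = of_real ((norm z)\<^sup>2)" "z * cnj z = of_real ((norm z)\<^sup>2)" for z
    by (simp_all only: complex_norm_square mult.commute)
  show "qmult (qconj x) x = (norm x)\<^sup>2 *\<^sub>R q1" "qmult x (qconj x) = (norm x)\<^sup>2 *\<^sub>R q1"
    unfolding x norm_quat qconj_def qmult_def q1_def
    by (simp_all add: * scaleR_conv_of_real mult.commute)
qed

lemma qmult_qconj_left:
  "qmult (qconj x) (qmult x y) = (norm x)\<^sup>2 *\<^sub>R y" "qmult x (qmult (qconj x) y) = (norm x)\<^sup>2 *\<^sub>R y"
  by (simp_all flip: qmult_assoc add: qmult_qconj qmult.scaleR_left)

text \<open>The product conj(xy) (xy) = conj(y) conj(x) x y is evaluated in two ways as a real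
  multiple of 1.\<close>

lemma norm_qmult [simp]: "norm (qmult x y) = norm x * norm y"
proof -
  have "(norm (qmult x y))\<^sup>2 *\<^sub>R q1 = (norm x * norm y)\<^sup>2 *\<^sub>R q1"
    using qmult_qconj(1)[of "qmult x y", symmetric]
    by (simp add: qmult_assoc qmult_qconj_left qmult.scaleR_right qmult_qconj power_mult_distrib mult.commute)
  then have "(norm (qmult x y))\<^sup>2 = (norm x * norm y)\<^sup>2"
    using norm_q1 by (metis norm_zero scaleR_right_imp_eq zero_neq_one)
  then show ?thesis
    by (simp add: power2_eq_iff_nonneg)
qed

lemma Q8_explicit:
  "Q8 = {(1, 0), (- 1, 0), (\<i>, 0), (- \<i>, 0), (0, 1), (0, - 1), (0, - \<i>), (0, \<i>)}"
  by (simp add: Q8_def q1_def qi_def qj_def qk_def qmult_def)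

lemma q1_in_Q8 [simp]: "q1 \<in> Q8"
  by (simp add: Q8_def)

lemma finite_Q8 [simp]: "finite Q8"
  by (simp add: Q8_def)

lemma qmult_in_Q8 [simp]: "g \<in> Q8 \<Longrightarrow> h \<in> Q8 \<Longrightarrow> qmult g h \<in> Q8"
  unfolding Q8_explicit by (elim insertE emptyE; simp add: qmult_def)

lemma qconj_in_Q8 [simp]: "g \<in> Q8 \<Longrightarrow> qconj g \<in> Q8"
  unfolding Q8_explicit by (elim insertE emptyE; simp add: qconj_def)

lemma norm_Q8 [simp]: "g \<in> Q8 \<Longrightarrow> norm g = 1"
  unfolding Q8_explicit by (elim insertE emptyE; simp add: norm_Pair)

lemma qconj_inverse_Q8 [simp]: "g \<in> Q8 \<Longrightarrow> qmult (qconj g) g = q1" "g \<in> Q8 \<Longrightarrow> qmult g (qconj g) = q1"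
  by (simp_all add: qmult_qconj)

text \<open>The distance is 2 for -1 and sqrt 2 for the other six elements; the round bound 1 fixes
  the radius 1/2 of the evenly covered balls below.\<close>

lemma Q8_far_from_q1: "g \<in> Q8 \<Longrightarrow> g \<noteq> q1 \<Longrightarrow> norm (g - q1) \<ge> 1"
  unfolding Q8_explicit
  by (elim insertE emptyE; simp add: q1_def norm_Pair real_le_rsqrt cmod_def)

lemma act_q1 [simp]: "act q1 x = x"
  by (simp add: act_def split: prod.split)

lemma act_act: "act g (act h x) = act (qmult g h) x"
  by (simp add: act_def qmult_assoc split: prod.split)

lemma norm_act [simp]: "norm (act g x) = norm g * norm x"
  by (cases x) (simp add: act_def norm_Pair power_mult_distrib flip: distrib_left, simp add: real_sqrt_mult)

lemma bilinear_act: "bilinear act"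
  by (auto simp: bilinear_def linear_iff act_def qmult.add_left qmult.add_right qmult.scaleR_left
      qmult.scaleR_right split: prod.splits)

interpretation act: bounded_bilinear act
  using bilinear_act by (simp add: bilinear_conv_bounded_bilinear)

lemma act_inverse [simp]:
  "g \<in> Q8 \<Longrightarrow> act (qconj g) (act g x) = x" "g \<in> Q8 \<Longrightarrow> act g (act (qconj g) x) = x"
  by (simp_all add: act_act)

lemma inner_act_act:
  assumes "g \<in> Q8"
  shows "act g x \<bullet> act g y = x \<bullet> y"
proof -
  have "norm (act g x + act g y) = norm (x + y)"
    using assms by (simp flip: act.add_right)
  then show ?thesis
    using assms by (simp add: dot_norm)
qed

lemma act_in_S7 [simp]: "g \<in> Q8 \<Longrightarrow> x \<in> S7 \<Longrightarrow> act g x \<in> S7"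
  by (simp add: S7_def)

text \<open>The action is linear in the quaternion as well, so \<open>act g x - x\<close> is
  \<open>act (g - q1) x\<close>, of norm |g - 1|. Freeness thus holds uniformly, and a set whose
  points are less than 1 apart contains at most one point of each orbit.\<close>

lemma act_free:
  assumes "g \<in> Q8" "x \<in> S7" "norm (act g x - x) < 1"
  shows "g = q1"
proof (rule ccontr)
  assume "g \<noteq> q1"
  have "act g x - x = act (g - q1) x"
    by (simp add: act.diff_left)
  then have "norm (act g x - x) = norm (g - q1)"
    using assms by (simp add: S7_def)
  then show False
    using Q8_far_from_q1[OF assms(1) \<open>g \<noteq> q1\<close>] assms(3) by simp
qed

lemma orbit_eq_iff: "orbit x = orbit y \<longleftrightarrow> (\<exists>g\<in>Q8. y = act g x)"
proof
  assume "orbit x = orbit y"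
  then have "act q1 y \<in> orbit x"
    unfolding orbit_def using q1_in_Q8 by blast
  then show "\<exists>g\<in>Q8. y = act g x"
    by (auto simp: orbit_def)
next
  have *: "orbit (act g x) \<subseteq> orbit x" if "g \<in> Q8" for g x
    using that by (auto simp: orbit_def act_act)
  assume "\<exists>g\<in>Q8. y = act g x"
  then obtain g where g: "g \<in> Q8" "y = act g x" "x = act (qconj g) y"
    by auto
  show "orbit x = orbit y"
    using *[OF g(1), of x, folded g(2)] *[OF qconj_in_Q8[OF g(1)], of y, folded g(3)] by simp
qed

lemma orbit_act [simp]: "g \<in> Q8 \<Longrightarrow> orbit (act g x) = orbit x"
  using orbit_eq_iff[of x "act g x"] by blast

lemma inj_on_orbit_ball:
  assumes "W \<subseteq> S7" "\<And>x y. x \<in> W \<Longrightarrow> y \<in> W \<Longrightarrow> dist x y < 1"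
  shows "inj_on orbit W"
proof (rule inj_onI)
  fix x y assume xy: "x \<in> W" "y \<in> W" "orbit x = orbit y"
  then obtain g where g: "g \<in> Q8" "y = act g x"
    by (auto simp: orbit_eq_iff)
  have "norm (act g x - x) < 1"
    using assms(2)[OF xy(2) xy(1)] g by (simp add: dist_norm)
  then have "g = q1"
    using act_free[OF g(1)] xy(1) assms(1) by blast
  then show "x = y"
    using g by simp
qed

section \<open>The quotient space\<close>

lemma topspace_quotient_topology: "topspace (quotient_topology X q) = q ` topspace X"
proof -
  have "openin (quotient_topology X q) (q ` topspace X)"
    unfolding openin_quotient_topology
    by (simp add: openin_subset cong: conj_cong)
  then show ?thesis
    by (meson openin_quotient_topology openin_subset openin_topspace subset_antisym)
qed

lemma continuous_map_quotient_topology: "continuous_map X (quotient_topology X q) q"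
  by (auto simp: continuous_map_def topspace_quotient_topology openin_quotient_topology)

lemma topspace_S7Q8: "topspace S7Q8 = orbit ` S7"
  by (simp add: S7Q8_def topspace_quotient_topology)

lemma continuous_map_orbit: "continuous_map (top_of_set S7) S7Q8 orbit"
  by (simp add: S7Q8_def continuous_map_quotient_topology)

lemma continuous_on_act: "continuous_on S (act g)"
  by (rule continuous_on_subset[OF linear_continuous_on]) (auto simp: act.bounded_linear_right)

lemma openin_act_image:
  assumes g: "g \<in> Q8" and W: "openin (top_of_set S7) W"
  shows "openin (top_of_set S7) (act g ` W)"
proof -
  have "act g ` W = S7 \<inter> act (qconj g) -` W"
  proof (intro equalityI subsetI)
    fix x assume "x \<in> S7 \<inter> act (qconj g) -` W"
    then have "act (qconj g) x \<in> W"
      by simp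
    then have "act g (act (qconj g) x) \<in> act g ` W"
      by (rule imageI)
    then show "x \<in> act g ` W"
      using g by simp
  qed (use g openin_imp_subset[OF W] in auto)
  moreover have "continuous_map (top_of_set S7) (top_of_set S7) (act (qconj g))"
    using g by (auto intro: continuous_on_act)
  ultimately show ?thesis
    using openin_continuous_map_preimage[of "top_of_set S7" "top_of_set S7" "act (qconj g)" W] W
    by (simp add: vimage_def Collect_conj_eq)
qed

text \<open>The saturation of W is the union of its finitely many translates, each of which is
  open.\<close>

lemma open_map_orbit: "open_map (top_of_set S7) S7Q8 orbit"
  unfolding open_map_def
proof (intro allI impI)
  fix W assume W: "openin (top_of_set S7) W"
  have "{x \<in> S7. orbit x \<in> orbit ` W} = (\<Union>g\<in>Q8. act g ` W)"
  proof (intro equalityI subsetI)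
    fix x assume "x \<in> {x \<in> S7. orbit x \<in> orbit ` W}"
    then obtain w where "w \<in> W" "orbit w = orbit x"
      by auto
    then show "x \<in> (\<Union>g\<in>Q8. act g ` W)"
      using orbit_eq_iff[of w x] by blast
  next
    fix x assume "x \<in> (\<Union>g\<in>Q8. act g ` W)"
    then obtain g w where "g \<in> Q8" "w \<in> W" "x = act g w"
      by blast
    then show "x \<in> {x \<in> S7. orbit x \<in> orbit ` W}"
      using openin_imp_subset[OF W] by auto
  qed
  then show "openin S7Q8 (orbit ` W)"
    using openin_act_image[OF _ W] openin_imp_subset[OF W]
    by (auto simp: S7Q8_def openin_quotient_topology)
qed

lemma compact_space_S7Q8: "compact_space S7Q8"
proof -
  have "compactin S7Q8 (orbit ` S7)"
    by (rule image_compactin[OF _ continuous_map_orbit])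
      (auto simp: compactin_subtopology S7_def)
  then show ?thesis
    by (simp add: compact_space_def topspace_S7Q8)
qed

text \<open>Distinct orbits are finite, hence at positive distance from each other.\<close>

lemma Hausdorff_space_S7Q8: "Hausdorff_space S7Q8"
  unfolding Hausdorff_space_def
proof (intro allI impI, elim conjE)
  fix p p' assume "p \<in> topspace S7Q8" "p' \<in> topspace S7Q8" "p \<noteq> p'"
  then obtain x y where xy: "x \<in> S7" "y \<in> S7" "p = orbit x" "p' = orbit y" "orbit x \<noteq> orbit y"
    unfolding topspace_S7Q8 by blast
  have "finite (orbit y)"
    by (simp add: orbit_def)
  have "x \<notin> orbit y"
  proof
    assume "x \<in> orbit y"
    then obtain g where "g \<in> Q8" "x = act g y"
      unfolding orbit_def by blast
    then show False
      using xy(5) orbit_eq_iff[of y x] by blast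
  qed
  obtain e where "e > 0" and far: "\<forall>z\<in>orbit y. z \<noteq> x \<longrightarrow> e \<le> dist x z"
    using finite_set_avoid[OF \<open>finite (orbit y)\<close>, of x] by (elim exE conjE)
  have e: "e \<le> dist x z" if "z \<in> orbit y" for z
    using far \<open>x \<notin> orbit y\<close> that by metis
  define U V where "U = S7 \<inter> ball x (e/2)" and "V = S7 \<inter> ball y (e/2)"
  have op: "openin S7Q8 (orbit ` U)" "openin S7Q8 (orbit ` V)"
    using open_map_orbit by (auto simp: open_map_def U_def V_def)
  have "disjnt (orbit ` U) (orbit ` V)"
  proof (rule ccontr)
    assume "\<not> disjnt (orbit ` U) (orbit ` V)"
    then obtain z where "z \<in> orbit ` U" "z \<in> orbit ` V"
      unfolding disjnt_def by blast
    then obtain a b where ab: "a \<in> U" "b \<in> V" "orbit b = orbit a"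
      by (elim imageE) simp
    from ab(3) obtain g where g: "g \<in> Q8" "a = act g b"
      unfolding orbit_eq_iff by (elim bexE)
    \<comment> \<open>The isometry g carries y along with b, which puts a point of the orbit of y
      closer to x than e.\<close>
    have "dist (act g b) (act g y) = dist b y"
      using g(1) by (simp add: dist_norm flip: act.diff_right)
    then have "dist x (act g y) < e"
      using ab g dist_triangle[of x "act g y" a] by (auto simp: U_def V_def dist_commute)
    then show False
      using e[of "act g y"] g(1) unfolding orbit_def by fastforce
  qed
  then show "\<exists>U V. openin S7Q8 U \<and> openin S7Q8 V \<and> p \<in> U \<and> p' \<in> V \<and> disjnt U V"
    using op xy(1-4) \<open>e > 0\<close> by (intro exI[of _ "orbit ` U"] exI[of _ "orbit ` V"]) (simp add: U_def V_def)
qed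

text \<open>The radius 1/2 serves twice: points of the ball are less than 1 apart, which makes
  \<open>orbit\<close> injective, and x . z = 1 - |x - z|^2 / 2 is positive, so that x itself can be
  the vector u of a chart.\<close>

lemma small_neighbourhood:
  assumes "x \<in> S7" "openin (top_of_set S7) N" "x \<in> N"
  obtains W where "openin (top_of_set S7) W" "x \<in> W" "W \<subseteq> N" "inj_on orbit W"
    "\<And>z. z \<in> W \<Longrightarrow> x \<bullet> z > 0"
proof
  define W where "W = N \<inter> ball x (1/2)"
  show "openin (top_of_set S7) W" "x \<in> W" "W \<subseteq> N"
    using assms by (auto simp: W_def openin_Int_open)
  have "W \<subseteq> S7"
    using assms(2) openin_imp_subset by (auto simp: W_def)
  then show "inj_on orbit W"
  proof (rule inj_on_orbit_ball)
    fix a b assume "a \<in> W" "b \<in> W"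
    then show "dist a b < 1"
      using dist_triangle_half_r[of x a 1 b] by (auto simp: W_def)
  qed
  fix z assume z: "z \<in> W"
  then have n: "norm x = 1" "norm z = 1" "norm (x - z) < 1/2"
    using assms(1) \<open>W \<subseteq> S7\<close> by (auto simp: S7_def W_def dist_norm)
  have "(norm (x - z))\<^sup>2 < 1\<^sup>2"
    using n by (intro power_strict_mono) auto
  then show "x \<bullet> z > 0"
    using n by (simp add: dot_norm_neg)
qed

section \<open>Equivariant isomorphisms of representations over the sphere\<close>

text \<open>An isomorphism between the bundles over \<open>S\<^sup>7 / Q\<^sub>8\<close> associated to two real representations is
  a family of linear isomorphisms indexed by \<open>S\<^sup>7\<close> that commutes with the action.\<close>

definition equivariant_family ::
    "(quat \<Rightarrow> 'a::euclidean_space \<Rightarrow> 'a) \<Rightarrow> (quat \<Rightarrow> 'b::euclidean_space \<Rightarrow> 'b) \<Rightarrow>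
     (quat \<times> quat \<Rightarrow> 'a \<Rightarrow> 'b) \<Rightarrow> (quat \<times> quat \<Rightarrow> 'b \<Rightarrow> 'a) \<Rightarrow> bool" where
  "equivariant_family \<rho> \<sigma> M N \<longleftrightarrow>
     continuous_on (S7 \<times> UNIV) (\<lambda>p. M (fst p) (snd p)) \<and>
     continuous_on (S7 \<times> UNIV) (\<lambda>p. N (fst p) (snd p)) \<and>
     (\<forall>x\<in>S7. linear (M x) \<and> (\<forall>v. N x (M x v) = v) \<and> (\<forall>w. M x (N x w) = w) \<and>
        (\<forall>g\<in>Q8. \<forall>v. M (act g x) (\<rho> g v) = \<sigma> g (M x v)))"

definition equivariant_iso ::
    "(quat \<Rightarrow> 'a::euclidean_space \<Rightarrow> 'a) \<Rightarrow> (quat \<Rightarrow> 'b::euclidean_space \<Rightarrow> 'b) \<Rightarrow> bool"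
    (infix "\<approx>\<^sub>Q" 50) where
  "\<rho> \<approx>\<^sub>Q \<sigma> \<longleftrightarrow> (\<exists>M N. equivariant_family \<rho> \<sigma> M N)"

definition trivial_rep :: "quat \<Rightarrow> 'a \<Rightarrow> 'a" where
  "trivial_rep g v = v"

definition rep_sum :: "(quat \<Rightarrow> 'a \<Rightarrow> 'a) \<Rightarrow> (quat \<Rightarrow> 'b \<Rightarrow> 'b) \<Rightarrow> quat \<Rightarrow> 'a \<times> 'b \<Rightarrow> 'a \<times> 'b"
    (infixr "\<boxplus>" 65) where
  "(\<rho> \<boxplus> \<sigma>) g = map_prod (\<rho> g) (\<sigma> g)"

definition twist :: "(quat \<Rightarrow> real) \<Rightarrow> (quat \<Rightarrow> 'a::real_vector \<Rightarrow> 'a) \<Rightarrow> quat \<Rightarrow> 'a \<Rightarrow> 'a" where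
  "twist c \<rho> g v = c g *\<^sub>R \<rho> g v"

lemma rep_sum_apply [simp]: "(\<rho> \<boxplus> \<sigma>) g (v, w) = (\<rho> g v, \<sigma> g w)"
  by (simp add: rep_sum_def)

lemma trivial_rep_sum: "trivial_rep \<boxplus> trivial_rep = trivial_rep"
  by (intro ext) (simp add: rep_sum_def trivial_rep_def map_prod_def)

lemma equivariant_isoI:
  assumes "continuous_on (S7 \<times> UNIV) (\<lambda>p. M (fst p) (snd p))"
    and "continuous_on (S7 \<times> UNIV) (\<lambda>p. N (fst p) (snd p))"
    and "\<And>x. x \<in> S7 \<Longrightarrow> linear (M x)"
    and "\<And>x v. x \<in> S7 \<Longrightarrow> N x (M x v) = v"
    and "\<And>x w. x \<in> S7 \<Longrightarrow> M x (N x w) = w"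
    and "\<And>x g v. x \<in> S7 \<Longrightarrow> g \<in> Q8 \<Longrightarrow> M (act g x) (\<rho> g v) = \<sigma> g (M x v)"
  shows "\<rho> \<approx>\<^sub>Q \<sigma>"
  unfolding equivariant_iso_def equivariant_family_def using assms
  by (intro exI[of _ M] exI[of _ N]) simp

lemma equivariant_familyD:
  assumes "equivariant_family \<rho> \<sigma> M N"
  shows "continuous_on (S7 \<times> UNIV) (\<lambda>p. M (fst p) (snd p))"
    "continuous_on (S7 \<times> UNIV) (\<lambda>p. N (fst p) (snd p))"
    "\<And>x. x \<in> S7 \<Longrightarrow> linear (M x)"
    "\<And>x v. x \<in> S7 \<Longrightarrow> N x (M x v) = v"
    "\<And>x w. x \<in> S7 \<Longrightarrow> M x (N x w) = w"
    "\<And>x g v. x \<in> S7 \<Longrightarrow> g \<in> Q8 \<Longrightarrow> M (act g x) (\<rho> g v) = \<sigma> g (M x v)"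
  using assms unfolding equivariant_family_def by simp_all

lemma equivariant_iso_const:
  fixes f :: "'a::euclidean_space \<Rightarrow> 'b::euclidean_space"
  assumes "linear f" "linear f'" "\<And>v. f' (f v) = v" "\<And>w. f (f' w) = w"
    and "\<And>g v. g \<in> Q8 \<Longrightarrow> f (\<rho> g v) = \<sigma> g (f v)"
  shows "\<rho> \<approx>\<^sub>Q \<sigma>"
proof -
  have "bounded_linear f" "bounded_linear f'"
    using assms(1,2) by (simp_all add: linear_conv_bounded_linear)
  then show ?thesis
    by (intro equivariant_isoI[where M = "\<lambda>x. f" and N = "\<lambda>x. f'"])
      (simp_all add: assms bounded_linear.continuous_on continuous_on_snd)
qed

lemma equivariant_iso_refl: "\<rho> \<approx>\<^sub>Q \<rho>"
  by (rule equivariant_iso_const[where f = "\<lambda>x. x" and f' = "\<lambda>x. x"]) (simp_all add: linear_iff)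

text \<open>Continuity of the inverse family is part of the data. Its linearity and equivariance are
  derived by writing the arguments as values of M and cancelling.\<close>

lemma equivariant_iso_sym:
  assumes "\<rho> \<approx>\<^sub>Q \<sigma>"
  shows "\<sigma> \<approx>\<^sub>Q \<rho>"
proof -
  obtain M N where famMN: "equivariant_family \<rho> \<sigma> M N"
    using assms unfolding equivariant_iso_def by blast
  note MN = equivariant_familyD(1,2)[OF famMN]
    and lin = equivariant_familyD(3)[OF famMN] and NM = equivariant_familyD(4)[OF famMN]
    and MN' = equivariant_familyD(5)[OF famMN] and eq = equivariant_familyD(6)[OF famMN]
  show ?thesis
  proof (rule equivariant_isoI[OF MN(2,1)])
    fix x assume x: "x \<in> S7"
    show "linear (N x)"
    proof (rule linearI)
      show "N x (a + b) = N x a + N x b" for a b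
        using NM[OF x, of "N x a + N x b"] linear_add[OF lin[OF x]] by (simp add: MN'[OF x])
      show "N x (r *\<^sub>R a) = r *\<^sub>R N x a" for r a
        using NM[OF x, of "r *\<^sub>R N x a"] linear_cmul[OF lin[OF x]] by (simp add: MN'[OF x])
    qed
    show "M x (N x v) = v" "N x (M x w) = w" for v w
      using NM MN' x by blast+
    fix g v assume g: "g \<in> Q8"
    have "N (act g x) (\<sigma> g (M x (N x v))) = \<rho> g (N x v)"
      using eq[OF x g, of "N x v"] NM[of "act g x" "\<rho> g (N x v)"] x g by simp
    then show "N (act g x) (\<sigma> g v) = \<rho> g (N x v)"
      by (simp add: MN'[OF x])
  qed
qed

lemma continuous_on_family_compose:
  assumes "continuous_on (S \<times> UNIV) (\<lambda>p. M (fst p) (snd p))" "continuous_on T f" "continuous_on T h"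
    and "\<And>t. t \<in> T \<Longrightarrow> f t \<in> S"
  shows "continuous_on T (\<lambda>t. M (f t) (h t))"
  using continuous_on_compose2[OF assms(1) continuous_on_Pair[OF assms(2,3)]] assms(4) by auto

lemma equivariant_iso_trans [trans]:
  assumes "\<rho> \<approx>\<^sub>Q \<sigma>" "\<sigma> \<approx>\<^sub>Q \<tau>"
  shows "\<rho> \<approx>\<^sub>Q \<tau>"
proof -
  obtain M N where fam1: "equivariant_family \<rho> \<sigma> M N"
    using assms(1) unfolding equivariant_iso_def by blast
  note 1 = equivariant_familyD[OF fam1]
  obtain M' N' where fam2: "equivariant_family \<sigma> \<tau> M' N'"
    using assms(2) unfolding equivariant_iso_def by blast
  note 2 = equivariant_familyD[OF fam2]
  show ?thesis
  proof (rule equivariant_isoI[where M = "\<lambda>x v. M' x (M x v)" and N = "\<lambda>x w. N x (N' x w)"])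
    show "linear (\<lambda>v. M' x (M x v))" if "x \<in> S7" for x
      using linear_compose[OF 1(3)[OF that] 2(3)[OF that]] by (simp add: o_def)
    show "continuous_on (S7 \<times> UNIV) (\<lambda>p. M' (fst p) (M (fst p) (snd p)))"
      by (rule continuous_on_family_compose[OF 2(1)]) (auto intro: 1(1) continuous_intros)
    show "continuous_on (S7 \<times> UNIV) (\<lambda>p. N (fst p) (N' (fst p) (snd p)))"
      by (rule continuous_on_family_compose[OF 1(2)]) (auto intro: 2(2) continuous_intros)
  qed (simp_all add: 1 2)
qed

lemma equivariant_iso_sum:
  assumes "\<rho> \<approx>\<^sub>Q \<rho>'" "\<sigma> \<approx>\<^sub>Q \<sigma>'"
  shows "\<rho> \<boxplus> \<sigma> \<approx>\<^sub>Q \<rho>' \<boxplus> \<sigma>'"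
proof -
  obtain M N where fam1: "equivariant_family \<rho> \<rho>' M N"
    using assms(1) unfolding equivariant_iso_def by blast
  note 1 = equivariant_familyD[OF fam1]
  obtain M' N' where fam2: "equivariant_family \<sigma> \<sigma>' M' N'"
    using assms(2) unfolding equivariant_iso_def by blast
  note 2 = equivariant_familyD[OF fam2]
  note cont = continuous_on_family_compose[OF 1(1)] continuous_on_family_compose[OF 1(2)]
    continuous_on_family_compose[OF 2(1)] continuous_on_family_compose[OF 2(2)]
  show ?thesis
  proof (rule equivariant_isoI[where M = "\<lambda>x. map_prod (M x) (M' x)" and N = "\<lambda>x. map_prod (N x) (N' x)"])
    show "linear (map_prod (M x) (M' x))" if "x \<in> S7" for x
      using 1(3)[OF that] 2(3)[OF that] by (auto simp: linear_iff map_prod_def split: prod.split)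
    show "map_prod (N x) (N' x) (map_prod (M x) (M' x) v) = v"
      "map_prod (M x) (M' x) (map_prod (N x) (N' x) w) = w" if "x \<in> S7" for x v w
      using that by (cases v; cases w; simp add: 1 2)+
    show "map_prod (M (act g x)) (M' (act g x)) ((\<rho> \<boxplus> \<sigma>) g v) = (\<rho>' \<boxplus> \<sigma>') g (map_prod (M x) (M' x) v)"
      if "x \<in> S7" "g \<in> Q8" for x g v
      using that by (cases v) (simp add: 1 2)
  qed (auto simp: map_prod_def case_prod_unfold intro!: continuous_intros cont)
qed

lemma equivariant_iso_twist:
  assumes "\<rho> \<approx>\<^sub>Q \<sigma>"
  shows "twist c \<rho> \<approx>\<^sub>Q twist c \<sigma>"
proof -
  obtain M N where fam1: "equivariant_family \<rho> \<sigma> M N"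
    using assms(1) unfolding equivariant_iso_def by blast
  note 1 = equivariant_familyD[OF fam1]
  show ?thesis
    by (rule equivariant_isoI[OF 1(1-5)]) (simp_all add: twist_def 1(6) linear_cmul[OF 1(3)])
qed

lemma twist_sum: "twist c (\<rho> \<boxplus> \<sigma>) = twist c \<rho> \<boxplus> twist c \<sigma>"
  by (intro ext) (simp add: rep_sum_def twist_def case_prod_unfold map_prod_def)

lemma equivariant_iso_sum_swap:
  "(\<rho> \<boxplus> \<sigma>) \<boxplus> (\<rho>' \<boxplus> \<sigma>') \<approx>\<^sub>Q (\<rho> \<boxplus> \<rho>') \<boxplus> (\<sigma> \<boxplus> \<sigma>')"
  by (rule equivariant_iso_const[where f = "\<lambda>((a, b), (c, d)). ((a, c), (b, d))"
        and f' = "\<lambda>((a, c), (b, d)). ((a, b), (c, d))"]) (auto simp: linear_iff)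

lemma equivariant_iso_sum_assoc: "(\<rho> \<boxplus> \<sigma>) \<boxplus> \<tau> \<approx>\<^sub>Q \<rho> \<boxplus> (\<sigma> \<boxplus> \<tau>)"
  by (rule equivariant_iso_const[where f = "\<lambda>((a, b), c). (a, (b, c))"
        and f' = "\<lambda>(a, (b, c)). ((a, b), c)"]) (auto simp: linear_iff)

section \<open>Stable triviality of eight copies of the tautological representation\<close>

text \<open>The K of the overview. Each of the lines spanned by 1, i, j, k is preserved, with Q8
  acting on it by signs.\<close>

definition conj_rep :: "quat \<Rightarrow> quat \<Rightarrow> quat" where
  "conj_rep g v = qmult g (qmult v (qconj g))"

lemmas qmult_simps = qmult_assoc qmult.add_left qmult.add_right qmult.diff_left qmult.diff_right
  qmult.minus_left qmult.minus_right qmult.scaleR_left qmult.scaleR_right qmult_qconj qmult_qconj_left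

lemma norm_S7: "(a, b) \<in> S7 \<Longrightarrow> (norm a)\<^sup>2 + (norm b)\<^sup>2 = 1"
  by (simp add: S7_def norm_Pair)

lemma qmult_Q8_left_cancel [simp]:
  "g \<in> Q8 \<Longrightarrow> qmult g (qmult (qconj g) x) = x" "g \<in> Q8 \<Longrightarrow> qmult (qconj g) (qmult g x) = x"
  by (simp_all flip: qmult_assoc)

text \<open>The two half spin representations of \<open>Spin(8)\<close> restricted to \<open>Q\<^sub>8\<close> are the left and the
  right side; the isomorphism over \<open>x\<close> is Clifford multiplication by \<open>x\<close>, written in
  quaternions.\<close>

lemma act_iso_trivial_plus_conj: "act \<approx>\<^sub>Q (trivial_rep :: _ \<Rightarrow> quat \<Rightarrow> _) \<boxplus> conj_rep"
proof -
  define M :: "quat \<times> quat \<Rightarrow> quat \<times> quat \<Rightarrow> quat \<times> quat" where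
    "M x v = (qmult (qconj (fst x)) (snd v) + qmult (qconj (fst v)) (snd x),
      qmult (fst v) (qconj (fst x)) - qmult (snd x) (qconj (snd v)))" for x v
  define N :: "quat \<times> quat \<Rightarrow> quat \<times> quat \<Rightarrow> quat \<times> quat" where
    "N x w = (qmult (snd w) (fst x) + qmult (snd x) (qconj (fst w)),
      qmult (fst x) (fst w) - qmult (qconj (snd w)) (snd x))" for x w
  show ?thesis
  proof (rule equivariant_isoI[where M = M and N = N])
  show "continuous_on (S7 \<times> UNIV) (\<lambda>p. M (fst p) (snd p))"
    "continuous_on (S7 \<times> UNIV) (\<lambda>p. N (fst p) (snd p))"
    unfolding M_def N_def by (intro continuous_intros qmult.continuous_on)+
  fix x assume x: "x \<in> S7"
  obtain a b where ab: "x = (a, b)"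
    by (cases x)
  have n: "(norm a)\<^sup>2 + (norm b)\<^sup>2 = 1"
    using x ab norm_S7 by simp
  \<comment> \<open>In both composites of M and N the mixed terms cancel, and each component keeps
    its |a|^2-fold and its |b|^2-fold.\<close>
  have n': "(norm a)\<^sup>2 *\<^sub>R z + (norm b)\<^sup>2 *\<^sub>R z = z" for z :: quat
    by (simp flip: scaleR_add_left add: n)
  show "linear (M x)"
    by (simp add: M_def linear_iff qmult_simps algebra_simps)
  show "N x (M x v) = v" for v
    using n'[of "fst v"] n'[of "snd v"] by (cases v) (simp add: M_def N_def ab qmult_simps algebra_simps)
  show "M x (N x w) = w" for w
    using n'[of "fst w"] n'[of "snd w"] by (cases w) (simp add: M_def N_def ab qmult_simps algebra_simps)
  show "M (act g x) (act g v) = (trivial_rep \<boxplus> conj_rep) g (M x v)" if "g \<in> Q8" for g v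
    using that
    by (cases v) (simp add: M_def N_def ab act_def qmult_simps trivial_rep_def conj_rep_def)
  qed
qed

section \<open>The conjugation bundle as a summand of a trivial bundle\<close>

text \<open>Conjugation by a coordinate a of the base point removes the action, since conj(ga) (g v
  conj(g)) (ga) = conj(a) v a. Both coordinates are used because either may vanish, but never
  both.\<close>

definition conj_embed :: "quat \<times> quat \<Rightarrow> quat \<Rightarrow> quat \<times> quat" where
  "conj_embed x v = (qmult (qconj (fst x)) (qmult v (fst x)), qmult (qconj (snd x)) (qmult v (snd x)))"

text \<open>A left inverse of \<open>conj_embed x\<close>. The fourth powers come from a conj(a) v a
  conj(a) = |a|^4 v, summed over the two coordinates.\<close>

definition conj_retract :: "quat \<times> quat \<Rightarrow> quat \<times> quat \<Rightarrow> quat" where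
  "conj_retract x w = (1 / ((norm (fst x))^4 + (norm (snd x))^4)) *\<^sub>R
     (qmult (fst x) (qmult (fst w) (qconj (fst x))) + qmult (snd x) (qmult (snd w) (qconj (snd x))))"

lemma conj_retract_denominator:
  assumes "x \<in> S7"
  shows "(norm (fst x))^4 + (norm (snd x))^4 > 0"
proof -
  have "fst x \<noteq> 0 \<or> snd x \<noteq> 0"
    using assms norm_S7[of "fst x" "snd x"] by auto
  then show ?thesis
    by (auto simp: add_pos_nonneg add_nonneg_pos)
qed

lemma conj_retract_embed: "x \<in> S7 \<Longrightarrow> conj_retract x (conj_embed x v) = v"
  using conj_retract_denominator[of x]
  by (simp add: conj_retract_def conj_embed_def qmult_simps flip: scaleR_add_left power_add)

lemma conj_embed_linear:
  "conj_embed x (v + v') = conj_embed x v + conj_embed x v'"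
  "conj_embed x (v - v') = conj_embed x v - conj_embed x v'"
  "conj_embed x (r *\<^sub>R v) = r *\<^sub>R conj_embed x v"
  by (simp_all add: conj_embed_def qmult_simps)

lemma conj_retract_linear:
  "conj_retract x (w + w') = conj_retract x w + conj_retract x w'"
  "conj_retract x (w - w') = conj_retract x w - conj_retract x w'"
  "conj_retract x (r *\<^sub>R w) = r *\<^sub>R conj_retract x w"
  by (simp_all add: conj_retract_def qmult_simps algebra_simps)

lemma conj_embed_act: "g \<in> Q8 \<Longrightarrow> conj_embed (act g x) (conj_rep g v) = conj_embed x v"
  by (simp add: conj_embed_def act_def conj_rep_def qmult_simps case_prod_unfold)

lemma conj_retract_act: "g \<in> Q8 \<Longrightarrow> conj_retract (act g x) w = conj_rep g (conj_retract x w)"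
  by (simp add: conj_retract_def act_def conj_rep_def qmult_simps case_prod_unfold)

lemma continuous_on_conj_embed:
  "continuous_on T f \<Longrightarrow> continuous_on T h \<Longrightarrow> continuous_on T (\<lambda>t. conj_embed (f t) (h t))"
  unfolding conj_embed_def by (intro continuous_intros qmult.continuous_on)

lemma continuous_on_conj_retract:
  assumes "continuous_on T f" "continuous_on T h" "\<And>t. t \<in> T \<Longrightarrow> f t \<in> S7"
  shows "continuous_on T (\<lambda>t. conj_retract (f t) (h t))"
  unfolding conj_retract_def using assms conj_retract_denominator
  by (intro continuous_intros qmult.continuous_on) (auto simp: less_imp_neq[THEN not_sym])

text \<open>The trivial fibre H^2 splits into the image of \<open>conj_embed x\<close>, which is a
  copy of K, and the kernel of \<open>conj_retract x\<close>. The map J is applied to u and the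
  image part, and the kernel part is left alone. Both subspaces of H^2 are the same at x and at
  \<open>act g x\<close>, which is why equivariance survives.\<close>

definition stabilize :: "(quat \<times> quat \<Rightarrow> 'a \<times> quat \<Rightarrow> 'b \<times> quat) \<Rightarrow>
    quat \<times> quat \<Rightarrow> 'a \<times> (quat \<times> quat) \<Rightarrow> 'b \<times> (quat \<times> quat)" where
  "stabilize J x = (\<lambda>(u, w). let (u', s) = J x (u, conj_retract x w)
     in (u', conj_embed x s + (w - conj_embed x (conj_retract x w))))"

text \<open>Retracting the new second component returns s, because the part that was left alone lies
  in the kernel of \<open>conj_retract x\<close>. Both inverse laws are instances, with J and K
  exchanged.\<close>

lemma stabilize_inverse:
  assumes "x \<in> S7" "\<And>v. K x (J x v) = v"
  shows "stabilize K x (stabilize J x v) = v"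
proof -
  obtain u w where v: "v = (u, w)"
    by (cases v)
  obtain u' s where J: "J x (u, conj_retract x w) = (u', s)"
    by (cases "J x (u, conj_retract x w)")
  have K: "K x (u', s) = (u, conj_retract x w)"
    using assms(2)[of "(u, conj_retract x w)"] J by simp
  show ?thesis
    using assms(1)
    by (simp add: v stabilize_def J K conj_retract_linear conj_embed_linear conj_retract_embed)
qed

lemma continuous_on_stabilize:
  assumes "continuous_on (S7 \<times> UNIV) (\<lambda>p. J (fst p) (snd p))"
  shows "continuous_on (S7 \<times> UNIV) (\<lambda>p. stabilize J (fst p) (snd p))"
proof -
  have "continuous_on (S7 \<times> UNIV) (\<lambda>p. J (fst p) (fst (snd p), conj_retract (fst p) (snd (snd p))))"
    by (intro continuous_on_family_compose[OF assms] continuous_intros continuous_on_conj_retract) auto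
  then show ?thesis
    unfolding stabilize_def Let_def case_prod_unfold
    by (intro continuous_intros continuous_on_conj_retract continuous_on_conj_embed) auto
qed

text \<open>Since \<open>conj_rep\<close> is a summand of a trivial bundle, it cancels stably.\<close>

lemma cancel_conj_rep:
  assumes "\<rho> \<boxplus> conj_rep \<approx>\<^sub>Q \<sigma> \<boxplus> conj_rep"
  shows "\<rho> \<boxplus> (trivial_rep :: _ \<Rightarrow> quat \<times> quat \<Rightarrow> _) \<approx>\<^sub>Q \<sigma> \<boxplus> (trivial_rep :: _ \<Rightarrow> quat \<times> quat \<Rightarrow> _)"
proof -
  obtain J K where famJ: "equivariant_family (\<rho> \<boxplus> conj_rep) (\<sigma> \<boxplus> conj_rep) J K"
    using assms unfolding equivariant_iso_def by blast
  note J = equivariant_familyD(1,2)[OF famJ]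
    and linJ = equivariant_familyD(3)[OF famJ] and KJ = equivariant_familyD(4)[OF famJ]
    and JK = equivariant_familyD(5)[OF famJ] and eqJ = equivariant_familyD(6)[OF famJ]
  show ?thesis
  proof (rule equivariant_isoI[OF continuous_on_stabilize[OF J(1)] continuous_on_stabilize[OF J(2)]])
    fix x assume x: "x \<in> S7"
    have add: "J x (u + u', r + r') = J x (u, r) + J x (u', r')" for u u' r r'
      using linear_add[OF linJ[OF x], of "(u, r)" "(u', r')"] by simp
    have scale: "J x (c *\<^sub>R u, c *\<^sub>R r) = c *\<^sub>R J x (u, r)" for u r c
      using linear_cmul[OF linJ[OF x], of c "(u, r)"] by simp
    show "linear (stabilize J x)"
      by (rule linearI) (simp_all add: stabilize_def case_prod_unfold Let_def add scale
          conj_retract_linear conj_embed_linear algebra_simps)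
    show "stabilize K x (stabilize J x v) = v" for v
      using stabilize_inverse[OF x, of K J, OF KJ[OF x]] .
    show "stabilize J x (stabilize K x w) = w" for w
      using stabilize_inverse[OF x, of J K, OF JK[OF x]] .
    fix g and v :: "'a \<times> (quat \<times> quat)" assume g: "g \<in> Q8"
    obtain u w where v: "v = (u, w)"
      by (cases v)
    obtain u' s where Jx: "J x (u, conj_retract x w) = (u', s)"
      by (cases "J x (u, conj_retract x w)")
    have "J (act g x) (\<rho> g u, conj_rep g (conj_retract x w)) = (\<sigma> g u', conj_rep g s)"
      using eqJ[OF x g, of "(u, conj_retract x w)"] by (simp add: Jx)
    then show "stabilize J (act g x) ((\<rho> \<boxplus> trivial_rep) g v) = (\<sigma> \<boxplus> trivial_rep) g (stabilize J x v)"
      using g by (simp add: v stabilize_def Jx trivial_rep_def conj_retract_act conj_embed_act)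
  qed
qed

section \<open>Real characters of Q8 and stable triviality of their fourfold sums\<close>

text \<open>For u among 1, i, j, k and g in Q8, the conjugate of u by g is u or -u, and its inner
  product with the unit vector u is the sign. The four choices of u give the four real characters of
  Q8.\<close>

definition comm_sign :: "quat \<Rightarrow> quat \<Rightarrow> real" where
  "comm_sign u g = qmult g (qmult u (qconj g)) \<bullet> u"

lemma comm_sign:
  assumes "g \<in> Q8" "u \<in> {q1, qi, qj, qk}"
  shows "qmult u g = comm_sign u g *\<^sub>R qmult g u"
  using assms unfolding Q8_explicit
  by (elim insertE emptyE; simp add: comm_sign_def q1_def qi_def qj_def qk_def qmult_def qconj_def
      inner_complex_def)

lemma unit_norm: "u \<in> {q1, qi, qj, qk} \<Longrightarrow> norm u = 1"
  by (auto simp: q1_def qi_def qj_def qk_def qmult_def norm_Pair)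

text \<open>Left multiplication by u fails to commute with the action exactly by the sign
  \<open>comm_sign u\<close>, so it intertwines \<open>act\<close> with its twist. It is applied in
  the fibre only; the base point does not move.\<close>

lemma act_twist:
  assumes "u \<in> {q1, qi, qj, qk}"
  shows "act \<approx>\<^sub>Q twist (comm_sign u) act"
proof (rule equivariant_iso_const[where f = "act u" and f' = "act (qconj u)"])
  show "act (qconj u) (act u v) = v" "act u (act (qconj u) v) = v" for v
    using assms by (simp_all add: act_act qmult_qconj unit_norm)
  show "act u (act g v) = twist (comm_sign u) act g (act u v)" if "g \<in> Q8" for g v
    using comm_sign[OF that assms] by (simp add: twist_def act_act act.scaleR_left)
qed (simp_all add: linear_iff act.add_right act.scaleR_right)

lemma conj_rep_twist:
  assumes "u \<in> {q1, qi, qj, qk}"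
  shows "conj_rep \<approx>\<^sub>Q twist (comm_sign u) conj_rep"
proof (rule equivariant_iso_const[where f = "qmult u" and f' = "qmult (qconj u)"])
  show "qmult (qconj u) (qmult u v) = v" "qmult u (qmult (qconj u) v) = v" for v
    using assms by (simp_all add: qmult_qconj_left unit_norm)
  show "qmult u (conj_rep g v) = twist (comm_sign u) conj_rep g (qmult u v)" if "g \<in> Q8" for g v
  proof -
    have "qmult u (conj_rep g v) = qmult (qmult u g) (qmult v (qconj g))"
      by (simp add: conj_rep_def qmult_assoc)
    then show ?thesis
      by (simp add: comm_sign[OF that assms] twist_def conj_rep_def qmult_simps)
  qed
qed (simp_all add: linear_iff qmult.add_right qmult.scaleR_right)

text \<open>The type argument records the trivial summand, so that the summands of several
  representations can be added up.\<close>

abbreviation stably_trivial_rep :: "(quat \<Rightarrow> 'a::euclidean_space \<Rightarrow> 'a) \<Rightarrow> 'b::euclidean_space itself \<Rightarrow> bool" where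
  "stably_trivial_rep \<rho> (T :: 'b itself) \<equiv>
     \<rho> \<boxplus> (trivial_rep :: quat \<Rightarrow> 'b \<Rightarrow> 'b) \<approx>\<^sub>Q (trivial_rep :: quat \<Rightarrow> 'a \<times> 'b \<Rightarrow> 'a \<times> 'b)"

lemma stably_trivial_rep_twist:
  assumes "u \<in> {q1, qi, qj, qk}"
  shows "stably_trivial_rep (twist (comm_sign u) (trivial_rep :: quat \<Rightarrow> quat \<Rightarrow> quat)) TYPE(quat \<times> quat)"
proof -
  let ?c = "comm_sign u"
  \<comment> \<open>With K replaced by its twist, c becomes a twist of the whole sum, hence of
    \<open>act\<close>, where it can be absorbed.\<close>
  have "twist ?c (trivial_rep :: _ \<Rightarrow> quat \<Rightarrow> _) \<boxplus> conj_rep \<approx>\<^sub>Q twist ?c (trivial_rep :: _ \<Rightarrow> quat \<Rightarrow> _) \<boxplus> twist ?c conj_rep"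
    by (intro equivariant_iso_sum equivariant_iso_refl conj_rep_twist assms)
  also have "\<dots> \<approx>\<^sub>Q twist ?c act"
    by (metis act_iso_trivial_plus_conj equivariant_iso_sym equivariant_iso_twist twist_sum)
  also have "\<dots> \<approx>\<^sub>Q act"
    by (intro equivariant_iso_sym[OF act_twist] assms)
  also have "\<dots> \<approx>\<^sub>Q (trivial_rep :: _ \<Rightarrow> quat \<Rightarrow> _) \<boxplus> conj_rep"
    by (rule act_iso_trivial_plus_conj)
  finally show ?thesis
    by (metis cancel_conj_rep trivial_rep_sum)
qed

lemma stably_trivial_rep_sum:
  fixes \<rho> :: "quat \<Rightarrow> 'a::euclidean_space \<Rightarrow> 'a" and \<sigma> :: "quat \<Rightarrow> 'b::euclidean_space \<Rightarrow> 'b"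
  assumes "stably_trivial_rep \<rho> TYPE('c::euclidean_space)" "stably_trivial_rep \<sigma> TYPE('d::euclidean_space)"
  shows "stably_trivial_rep (\<rho> \<boxplus> \<sigma>) TYPE('c \<times> 'd)"
proof -
  have "(\<rho> \<boxplus> \<sigma>) \<boxplus> (trivial_rep :: quat \<Rightarrow> 'c \<times> 'd \<Rightarrow> 'c \<times> 'd)
      \<approx>\<^sub>Q (\<rho> \<boxplus> (trivial_rep :: quat \<Rightarrow> 'c \<Rightarrow> 'c)) \<boxplus> (\<sigma> \<boxplus> (trivial_rep :: quat \<Rightarrow> 'd \<Rightarrow> 'd))"
    using equivariant_iso_sum_swap by (metis trivial_rep_sum)
  also have "\<dots> \<approx>\<^sub>Q (trivial_rep :: quat \<Rightarrow> 'a \<times> 'c \<Rightarrow> 'a \<times> 'c) \<boxplus> (trivial_rep :: quat \<Rightarrow> 'b \<times> 'd \<Rightarrow> 'b \<times> 'd)"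
    by (intro equivariant_iso_sum assms)
  also have "\<dots> \<approx>\<^sub>Q (trivial_rep :: quat \<Rightarrow> ('a \<times> 'b) \<times> ('c \<times> 'd) \<Rightarrow> ('a \<times> 'b) \<times> ('c \<times> 'd))"
    using equivariant_iso_sum_swap[of trivial_rep trivial_rep trivial_rep trivial_rep]
    by (simp only: trivial_rep_sum)
  finally show ?thesis .
qed

text \<open>Transposition of the real 4 x 4 matrix whose rows are four quaternions. It collects
  equal coordinates of four copies of K in one quaternion.\<close>

definition quat_transpose :: "(quat \<times> quat) \<times> (quat \<times> quat) \<Rightarrow> (quat \<times> quat) \<times> (quat \<times> quat)" where
  "quat_transpose = (\<lambda>((p, q), (r, s)).
     (((Complex (Re (fst p)) (Re (fst q)), Complex (Re (fst r)) (Re (fst s))),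
       (Complex (Im (fst p)) (Im (fst q)), Complex (Im (fst r)) (Im (fst s)))),
      ((Complex (Re (snd p)) (Re (snd q)), Complex (Re (snd r)) (Re (snd s))),
       (Complex (Im (snd p)) (Im (snd q)), Complex (Im (snd r)) (Im (snd s))))))"

text \<open>The last real coordinate is taken along ji = -k rather than k; the sign by which g acts
  on that line is the same.\<close>

lemma conj_rep_coordinates:
  assumes "g \<in> Q8"
  shows "conj_rep g v = (Complex (comm_sign q1 g * Re (fst v)) (comm_sign qi g * Im (fst v)),
    Complex (comm_sign qj g * Re (snd v)) (comm_sign qk g * Im (snd v)))"
  using assms unfolding Q8_explicit
  by (cases v; elim insertE emptyE; simp add: comm_sign_def q1_def qi_def qj_def qk_def qmult_def qconj_def
      inner_complex_def conj_rep_def complex_eq_iff)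

text \<open>Grouped by coordinates, four copies of K contain each character four times, that is, a
  twist of the four-dimensional T.\<close>

lemma four_conj_rep:
  "(conj_rep \<boxplus> conj_rep) \<boxplus> (conj_rep \<boxplus> conj_rep) \<approx>\<^sub>Q
   (twist (comm_sign q1) (trivial_rep :: _ \<Rightarrow> quat \<Rightarrow> _) \<boxplus> twist (comm_sign qi) (trivial_rep :: _ \<Rightarrow> quat \<Rightarrow> _)) \<boxplus>
   (twist (comm_sign qj) (trivial_rep :: _ \<Rightarrow> quat \<Rightarrow> _) \<boxplus> twist (comm_sign qk) (trivial_rep :: _ \<Rightarrow> quat \<Rightarrow> _))"
proof (rule equivariant_iso_const[where f = quat_transpose and f' = quat_transpose])
  show "linear quat_transpose"
    by (rule linearI) (auto simp: quat_transpose_def complex_eq_iff)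
  then show "linear quat_transpose" .
  show "quat_transpose (quat_transpose v) = v" for v
    by (simp add: quat_transpose_def case_prod_unfold)
  then show "quat_transpose (quat_transpose v) = v" for v .
qed (auto simp: quat_transpose_def rep_sum_def conj_rep_coordinates twist_def trivial_rep_def complex_eq_iff)

type_synonym quat4 = "(quat \<times> quat) \<times> (quat \<times> quat)"

text \<open>As \<open>act\<close> is 2y, this concerns 8y. Each of the four twists of T was
  trivialised with its own summand H^2, hence the summand \<open>quat4 \<times> quat4\<close>; both
  sides have real dimension 32 + 32 = 64.\<close>

theorem four_act_stably_trivial:
  "((act \<boxplus> act) \<boxplus> (act \<boxplus> act)) \<boxplus> (trivial_rep :: _ \<Rightarrow> quat4 \<times> quat4 \<Rightarrow> _) \<approx>\<^sub>Q
   (trivial_rep :: _ \<Rightarrow> quat4 \<times> (quat4 \<times> (quat4 \<times> quat4)) \<Rightarrow> _)"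
proof -
  note trans = equivariant_iso_trans[OF equivariant_iso_sum equivariant_iso_sum_swap]
  have two: "act \<boxplus> act \<approx>\<^sub>Q (trivial_rep :: _ \<Rightarrow> quat \<times> quat \<Rightarrow> _) \<boxplus> (conj_rep \<boxplus> conj_rep)"
    using trans[OF act_iso_trivial_plus_conj act_iso_trivial_plus_conj] by (simp only: trivial_rep_sum)
  have four: "(act \<boxplus> act) \<boxplus> (act \<boxplus> act) \<approx>\<^sub>Q
      (trivial_rep :: _ \<Rightarrow> quat4 \<Rightarrow> _) \<boxplus> ((conj_rep \<boxplus> conj_rep) \<boxplus> (conj_rep \<boxplus> conj_rep))"
    using trans[OF two two] by (simp only: trivial_rep_sum)
  have conj4: "((conj_rep \<boxplus> conj_rep) \<boxplus> (conj_rep \<boxplus> conj_rep)) \<boxplus> (trivial_rep :: _ \<Rightarrow> quat4 \<times> quat4 \<Rightarrow> _)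
      \<approx>\<^sub>Q (trivial_rep :: _ \<Rightarrow> quat4 \<times> (quat4 \<times> quat4) \<Rightarrow> _)"
    by (rule equivariant_iso_trans[OF equivariant_iso_sum[OF four_conj_rep equivariant_iso_refl]])
      (intro stably_trivial_rep_sum stably_trivial_rep_twist; simp)
  have "((act \<boxplus> act) \<boxplus> (act \<boxplus> act)) \<boxplus> (trivial_rep :: _ \<Rightarrow> quat4 \<times> quat4 \<Rightarrow> _) \<approx>\<^sub>Q
      (trivial_rep :: _ \<Rightarrow> quat4 \<Rightarrow> _) \<boxplus> (((conj_rep \<boxplus> conj_rep) \<boxplus> (conj_rep \<boxplus> conj_rep))
        \<boxplus> (trivial_rep :: _ \<Rightarrow> quat4 \<times> quat4 \<Rightarrow> _))"
    by (rule equivariant_iso_trans[OF equivariant_iso_sum[OF four equivariant_iso_refl] equivariant_iso_sum_assoc])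
  also have "\<dots> \<approx>\<^sub>Q (trivial_rep :: _ \<Rightarrow> quat4 \<Rightarrow> _) \<boxplus> (trivial_rep :: _ \<Rightarrow> quat4 \<times> (quat4 \<times> quat4) \<Rightarrow> _)"
    by (intro equivariant_iso_sum equivariant_iso_refl conj4)
  finally show ?thesis
    by (simp only: trivial_rep_sum)
qed

lemma openin_Times_subset:
  assumes "openin (top_of_set S) W" "open B" "D \<subseteq> S \<times> UNIV"
  shows "openin (top_of_set D) (D \<inter> W \<times> B)"
proof -
  obtain W' where W': "open W'" "W = S \<inter> W'"
    using assms(1) by (auto simp: openin_open)
  then have "D \<inter> W \<times> B = D \<inter> W' \<times> B"
    using assms(3) by blast
  then show ?thesis
    using W'(1) assms(2) by (metis openin_open_Int open_Times)
qed

section \<open>Bundles as quotients of equivariant families of vector spaces\<close>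

text \<open>The bundle \<open>E\<close> is the quotient, by the action of \<open>Q\<^sub>8\<close>, of the family \<open>D\<close> of subspaces of a
  Euclidean representation \<open>\<rho>\<close> that is parametrised by the sphere; \<open>q\<close> is the quotient map.\<close>

locale bundle_model =
  fixes E :: "(real, (quat \<times> quat) set, 'e) vbundle"
    and \<rho> :: "quat \<Rightarrow> 'a::euclidean_space \<Rightarrow> 'a"
    and D :: "((quat \<times> quat) \<times> 'a) set"
    and q :: "(quat \<times> quat) \<times> 'a \<Rightarrow> 'e"
  assumes base: "bun_base E = S7Q8"
    and domain: "D \<subseteq> S7 \<times> UNIV"
    and add_closed: "(x, v) \<in> D \<Longrightarrow> (x, w) \<in> D \<Longrightarrow> (x, v + w) \<in> D"
    and scale_closed: "(x, v) \<in> D \<Longrightarrow> (x, r *\<^sub>R v) \<in> D"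
    and rep_closed: "g \<in> Q8 \<Longrightarrow> (x, v) \<in> D \<Longrightarrow> (act g x, \<rho> g v) \<in> D"
    and q_rep: "g \<in> Q8 \<Longrightarrow> (x, v) \<in> D \<Longrightarrow> q (act g x, \<rho> g v) = q (x, v)"
    and q_continuous: "continuous_map (top_of_set D) (bun_total E) q"
    and q_open: "open_map (top_of_set D) (bun_total E) q"
    and q_onto: "q ` D = topspace (bun_total E)"
    and proj_q: "(x, v) \<in> D \<Longrightarrow> bun_proj E (q (x, v)) = orbit x"
    and q_inj: "(x, v) \<in> D \<Longrightarrow> (x, w) \<in> D \<Longrightarrow> q (x, v) = q (x, w) \<Longrightarrow> v = w"
    and add_q: "(x, v) \<in> D \<Longrightarrow> (x, w) \<in> D \<Longrightarrow> bun_add E (q (x, v)) (q (x, w)) = q (x, v + w)"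
    and scale_q: "(x, v) \<in> D \<Longrightarrow> bun_scale E r (q (x, v)) = q (x, r *\<^sub>R v)"
begin

lemma in_S7: "(x, v) \<in> D \<Longrightarrow> x \<in> S7"
  using domain by blast

lemma q_in_total: "(x, v) \<in> D \<Longrightarrow> q (x, v) \<in> topspace (bun_total E)"
  using q_onto by blast

lemma total_cases:
  assumes "e \<in> topspace (bun_total E)"
  obtains x v where "(x, v) \<in> D" "e = q (x, v)"
proof -
  from assms obtain p where "p \<in> D" "e = q p"
    unfolding q_onto[symmetric] by (elim imageE)
  then show thesis
    using that[of "fst p" "snd p"] by simp
qed

lemma representative_over:
  assumes "(x', v') \<in> D" "orbit x = orbit x'"
  obtains v where "(x, v) \<in> D" "q (x', v') = q (x, v)"
proof -
  obtain g where g: "g \<in> Q8" "x = act g x'"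
    using assms(2)[symmetric] unfolding orbit_eq_iff by (elim bexE)
  show thesis
    using that[of "\<rho> g v'"] rep_closed[OF g(1) assms(1)] q_rep[OF g(1) assms(1)] g(2) by simp
qed

lemma total_cases_over:
  assumes "e \<in> topspace (bun_total E)" "bun_proj E e = orbit x"
  obtains v where "(x, v) \<in> D" "e = q (x, v)"
  using total_cases[OF assms(1)] representative_over proj_q assms(2) by metis

lemma q_eqD:
  assumes "(x, v) \<in> D" "(x', v') \<in> D" "q (x, v) = q (x', v')"
  obtains g where "g \<in> Q8" "x' = act g x" "v' = \<rho> g v"
proof -
  have "orbit x = orbit x'"
    using proj_q[OF assms(1)] proj_q[OF assms(2)] assms(3) by simp
  then obtain g where g: "g \<in> Q8" "x' = act g x"
    unfolding orbit_eq_iff by (elim bexE)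
  have "v' = \<rho> g v"
    using q_inj[of "act g x" v' "\<rho> g v"] assms g rep_closed[OF g(1) assms(1)] q_rep[OF g(1) assms(1)]
    by simp
  then show thesis
    using that g by blast
qed

lemma q_quotient: "quotient_map (top_of_set D) (bun_total E) q"
  using q_continuous q_open q_onto by (intro continuous_open_imp_quotient_map) auto

text \<open>The source of local trivialisations: W meets each orbit at most once and q is injective
  on fibres, so q is injective over W, and it is open.\<close>

lemma homeomorphic_map_q:
  assumes W: "openin (top_of_set S7) W" and inj: "inj_on orbit W"
  shows "homeomorphic_map (top_of_set (D \<inter> W \<times> UNIV))
    (subtopology (bun_total E) {e \<in> topspace (bun_total E). bun_proj E e \<in> orbit ` W}) q"
proof (rule bijective_open_imp_homeomorphic_map)
  let ?EU = "{e \<in> topspace (bun_total E). bun_proj E e \<in> orbit ` W}"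
  have sub: "q ` (D \<inter> W \<times> UNIV) \<subseteq> ?EU"
    using q_in_total proj_q by fastforce
  have onto: "?EU \<subseteq> q ` (D \<inter> W \<times> UNIV)"
  proof
    fix e assume "e \<in> ?EU"
    then obtain x where x: "x \<in> W" "bun_proj E e = orbit x" "e \<in> topspace (bun_total E)"
      by (elim CollectE conjE imageE)
    obtain v where "(x, v) \<in> D" "e = q (x, v)"
      using total_cases_over[OF x(3,2)] .
    then show "e \<in> q ` (D \<inter> W \<times> UNIV)"
      using x(1) by blast
  qed
  show "continuous_map (top_of_set (D \<inter> W \<times> UNIV)) (subtopology (bun_total E) ?EU) q"
    unfolding continuous_map_in_subtopology
    using continuous_map_from_subtopology[OF q_continuous, of "W \<times> UNIV"] sub
    by (simp add: subtopology_subtopology image_subset_iff_funcset)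
  have opD: "openin (top_of_set D) (D \<inter> W \<times> UNIV)"
    using openin_Times_subset[OF W open_UNIV domain] .
  show "open_map (top_of_set (D \<inter> W \<times> UNIV)) (subtopology (bun_total E) ?EU) q"
    unfolding open_map_def
  proof (intro allI impI)
    fix V assume V: "openin (top_of_set (D \<inter> W \<times> UNIV)) V"
    have "openin (bun_total E) (q ` V)"
      using q_open openin_trans[OF V opD] unfolding open_map_def by blast
    moreover have "q ` V \<subseteq> ?EU"
      using sub openin_imp_subset[OF V] by (meson image_mono order_trans)
    ultimately show "openin (subtopology (bun_total E) ?EU) (q ` V)"
      unfolding openin_subtopology by (intro exI[of _ "q ` V"]) (simp add: Int_absorb2)
  qed
  show "q ` topspace (top_of_set (D \<inter> W \<times> UNIV)) = topspace (subtopology (bun_total E) ?EU)"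
    using sub onto by auto
  show "inj_on q (topspace (top_of_set (D \<inter> W \<times> UNIV)))"
  proof (rule inj_onI)
    fix p p' assume "p \<in> topspace (top_of_set (D \<inter> W \<times> UNIV))"
      "p' \<in> topspace (top_of_set (D \<inter> W \<times> UNIV))" and eq: "q p = q p'"
    then have D: "(fst p, snd p) \<in> D" "(fst p', snd p') \<in> D" and "fst p \<in> W" "fst p' \<in> W"
      by (simp_all add: mem_Times_iff)
    moreover have "orbit (fst p) = orbit (fst p')"
      using proj_q[OF D(1)] proj_q[OF D(2)] eq by simp
    ultimately have "fst p = fst p'"
      using inj by (simp add: inj_on_def)
    then show "p = p'"
      using q_inj[of "fst p" "snd p" "snd p'"] D eq by (metis prod.collapse)
  qed
qed

end

text \<open>The map is defined through an arbitrary representative. Equivariance makes the choice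
  irrelevant, and continuity descends because q is a quotient map.\<close>

lemma bundle_model_lift:
  fixes \<Phi> :: "quat \<times> quat \<Rightarrow> 'a::euclidean_space \<Rightarrow> 'b::euclidean_space"
  assumes "bundle_model E \<rho> D q" "bundle_model F \<sigma> D' q'"
    and \<Phi>: "\<And>x v. (x, v) \<in> D \<Longrightarrow> (x, \<Phi> x v) \<in> D'"
    and cont: "continuous_on D (\<lambda>p. \<Phi> (fst p) (snd p))"
    and eq: "\<And>g x v. g \<in> Q8 \<Longrightarrow> (x, v) \<in> D \<Longrightarrow> \<Phi> (act g x) (\<rho> g v) = \<sigma> g (\<Phi> x v)"
  obtains h where "continuous_map (bun_total E) (bun_total F) h"
    "\<And>x v. (x, v) \<in> D \<Longrightarrow> h (q (x, v)) = q' (x, \<Phi> x v)"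
proof -
  interpret E: bundle_model E \<rho> D q by fact
  interpret F: bundle_model F \<sigma> D' q' by fact
  define k where "k p = q' (fst p, \<Phi> (fst p) (snd p))" for p
  define h where "h e = k (inv_into D q e)" for e
  have h: "h (q (x, v)) = q' (x, \<Phi> x v)" if xv: "(x, v) \<in> D" for x v
  proof -
    obtain x' v' where i: "inv_into D q (q (x, v)) = (x', v')"
      by (cases "inv_into D q (q (x, v))")
    have "(x', v') \<in> D" "q (x, v) = q (x', v')"
      using xv i inv_into_into[of "q (x, v)" q D] f_inv_into_f[of "q (x, v)" q D] by auto
    then obtain g where g: "g \<in> Q8" "x' = act g x" "v' = \<rho> g v"
      using E.q_eqD[OF xv] by blast
    have "q' (act g x, \<Phi> (act g x) (\<rho> g v)) = q' (x, \<Phi> x v)"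
      using F.q_rep[OF g(1) \<Phi>[OF xv]] eq[OF g(1) xv] by simp
    then show ?thesis
      by (simp add: h_def k_def i g)
  qed
  have "continuous_map (top_of_set D) (top_of_set D') (\<lambda>p. (fst p, \<Phi> (fst p) (snd p)))"
    using \<Phi> by (auto intro!: continuous_intros cont)
  from continuous_map_compose[OF this F.q_continuous]
  have "continuous_map (top_of_set D) (bun_total F) k"
    by (simp add: k_def[abs_def] o_def)
  moreover have "k p = (h \<circ> q) p" if "p \<in> topspace (top_of_set D)" for p
    using that h[of "fst p" "snd p"] by (simp add: k_def)
  ultimately have "continuous_map (top_of_set D) (bun_total F) (h \<circ> q)"
    by (rule continuous_map_eq)
  then have "continuous_map (bun_total E) (bun_total F) h"
    using continuous_compose_quotient_map[OF E.q_quotient] by blast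
  then show thesis
    using that h by blast
qed

text \<open>Equivariance is assumed for \<Phi> only and transferred to its inverse \<Psi>. Both then
  descend to the total spaces, and all remaining identities are checked on representatives, two
  vectors of one fibre being represented over the same point.\<close>

lemma bundle_iso_of_models:
  fixes \<Phi> :: "quat \<times> quat \<Rightarrow> 'a::euclidean_space \<Rightarrow> 'b::euclidean_space"
  assumes "bundle_model E \<rho> D q" "bundle_model F \<sigma> D' q'"
    and \<Phi>: "\<And>x v. (x, v) \<in> D \<Longrightarrow> (x, \<Phi> x v) \<in> D'"
    and \<Psi>: "\<And>x w. (x, w) \<in> D' \<Longrightarrow> (x, \<Psi> x w) \<in> D"
    and cont: "continuous_on D (\<lambda>p. \<Phi> (fst p) (snd p))" "continuous_on D' (\<lambda>p. \<Psi> (fst p) (snd p))"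
    and eq: "\<And>g x v. g \<in> Q8 \<Longrightarrow> (x, v) \<in> D \<Longrightarrow> \<Phi> (act g x) (\<rho> g v) = \<sigma> g (\<Phi> x v)"
    and \<Psi>\<Phi>: "\<And>x v. (x, v) \<in> D \<Longrightarrow> \<Psi> x (\<Phi> x v) = v"
    and \<Phi>\<Psi>: "\<And>x w. (x, w) \<in> D' \<Longrightarrow> \<Phi> x (\<Psi> x w) = w"
    and add: "\<And>x v w. (x, v) \<in> D \<Longrightarrow> (x, w) \<in> D \<Longrightarrow> \<Phi> x (v + w) = \<Phi> x v + \<Phi> x w"
    and scale: "\<And>x v r. (x, v) \<in> D \<Longrightarrow> \<Phi> x (r *\<^sub>R v) = r *\<^sub>R \<Phi> x v"
  shows "E \<cong>\<^sub>b F"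
proof -
  interpret E: bundle_model E \<rho> D q by fact
  interpret F: bundle_model F \<sigma> D' q' by fact
  have eq': "\<Psi> (act g x) (\<sigma> g w) = \<rho> g (\<Psi> x w)" if "g \<in> Q8" "(x, w) \<in> D'" for g x w
    using eq[OF that(1) \<Psi>[OF that(2)]] \<Psi>\<Phi>[OF E.rep_closed[OF that(1) \<Psi>[OF that(2)]]] \<Phi>\<Psi>[OF that(2)]
    by simp
  obtain h where h: "continuous_map (bun_total E) (bun_total F) h"
    and hq: "\<And>x v. (x, v) \<in> D \<Longrightarrow> h (q (x, v)) = q' (x, \<Phi> x v)"
    using bundle_model_lift[OF assms(1,2) \<Phi> cont(1) eq] by blast
  obtain k where k: "continuous_map (bun_total F) (bun_total E) k"
    and kq: "\<And>x w. (x, w) \<in> D' \<Longrightarrow> k (q' (x, w)) = q (x, \<Psi> x w)"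
    using bundle_model_lift[OF assms(2,1) \<Psi> cont(2) eq'] by blast
  have "homeomorphic_maps (bun_total E) (bun_total F) h k"
    unfolding homeomorphic_maps_def
  proof (intro conjI ballI h k)
    show "k (h e) = e" if "e \<in> topspace (bun_total E)" for e
      using that by (rule E.total_cases) (simp add: hq kq \<Phi> \<Psi>\<Phi>)
    show "h (k f) = f" if "f \<in> topspace (bun_total F)" for f
      using that by (rule F.total_cases) (simp add: hq kq \<Psi> \<Phi>\<Psi>)
  qed
  then have "homeomorphic_map (bun_total E) (bun_total F) h"
    using homeomorphic_map_maps by blast
  moreover have "bun_proj F (h e) = bun_proj E e" "h (bun_scale E c e) = bun_scale F c (h e)"
    if "e \<in> topspace (bun_total E)" for e c
    using that by (rule E.total_cases, simp add: hq \<Phi> E.proj_q F.proj_q E.scale_q F.scale_q E.scale_closed scale)+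
  moreover have "h (bun_add E e e') = bun_add F (h e) (h e')"
    if e: "e \<in> topspace (bun_total E)" and e': "e' \<in> topspace (bun_total E)"
      and same: "bun_proj E e = bun_proj E e'" for e e'
  proof -
    obtain x v where xv: "(x, v) \<in> D" "e = q (x, v)"
      using E.total_cases[OF e] .
    have "bun_proj E e' = orbit x"
      using same E.proj_q[OF xv(1)] xv(2) by simp
    then obtain w where "(x, w) \<in> D" "e' = q (x, w)"
      using E.total_cases_over[OF e'] by blast
    then show ?thesis
      using xv by (simp add: E.add_q F.add_q hq E.add_closed add \<Phi>)
  qed
  ultimately show ?thesis
    unfolding bundle_iso_def E.base F.base by blast
qed

section \<open>Models of pullbacks, sums, trivial bundles and multiples\<close>

text \<open>In a pair (p, e) of the pullback, p is determined by e. The image of an open V is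
  therefore the trace of an open product on the total space, which makes the quotient map
  open.\<close>

lemma bundle_model_pullback_id:
  assumes "bundle_model E \<rho> D q"
  shows "bundle_model (pullback_bundle S7Q8 id E) \<rho> D (\<lambda>p. (orbit (fst p), q p))"
proof -
  interpret E: bundle_model E \<rho> D q by fact
  let ?P = "pullback_bundle S7Q8 id E"
  have mem: "(orbit x, q (x, v)) \<in> topspace (bun_total ?P)" if "(x, v) \<in> D" for x v
    using that E.q_in_total E.proj_q E.in_S7 by (auto simp: pullback_bundle_def topspace_S7Q8)
  have "continuous_map (top_of_set D) (top_of_set S7) fst"
    using E.in_S7 by (auto intro: continuous_intros)
  from continuous_map_compose[OF this continuous_map_orbit]
  have orbit: "continuous_map (top_of_set D) S7Q8 (\<lambda>p. orbit (fst p))"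
    by (simp add: o_def)
  show ?thesis
  proof
    show "bun_base ?P = S7Q8"
      by (simp add: pullback_bundle_def)
    show "continuous_map (top_of_set D) (bun_total ?P) (\<lambda>p. (orbit (fst p), q p))"
      unfolding pullback_bundle_def
      using orbit E.q_continuous E.proj_q by (auto simp: continuous_map_in_subtopology continuous_map_pairedI)
    show "open_map (top_of_set D) (bun_total ?P) (\<lambda>p. (orbit (fst p), q p))"
      unfolding open_map_def
    proof (intro allI impI)
      fix V assume V: "openin (top_of_set D) V"
      have "(\<lambda>p. (orbit (fst p), q p)) ` V =
          topspace S7Q8 \<times> q ` V \<inter> {(x, e). id x = bun_proj E e}"
      proof (intro equalityI subsetI)
        fix z assume "z \<in> (\<lambda>p. (orbit (fst p), q p)) ` V"
        then obtain x v where z: "(x, v) \<in> V" "z = (orbit x, q (x, v))"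
          by force
        then have "(x, v) \<in> D"
          using openin_imp_subset[OF V] by blast
        then show "z \<in> topspace S7Q8 \<times> q ` V \<inter> {(x, e). id x = bun_proj E e}"
          using z E.proj_q E.in_S7 by (simp add: topspace_S7Q8)
      next
        fix z assume z: "z \<in> topspace S7Q8 \<times> q ` V \<inter> {(x, e). id x = bun_proj E e}"
        then obtain x v where xv: "(x, v) \<in> V" "snd z = q (x, v)"
          by force
        moreover have "(x, v) \<in> D"
          using xv(1) openin_imp_subset[OF V] by blast
        then have "fst z = orbit x"
          using z xv(2) E.proj_q[of x v] by (cases z) simp
        ultimately show "z \<in> (\<lambda>p. (orbit (fst p), q p)) ` V"
          by (intro image_eqI[of _ _ "(x, v)"] prod_eqI) simp_all
      qed
      moreover have "openin (prod_topology S7Q8 (bun_total E)) (topspace S7Q8 \<times> q ` V)"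
        using V E.q_open by (simp add: openin_prod_Times_iff open_map_def)
      ultimately show "openin (bun_total ?P) ((\<lambda>p. (orbit (fst p), q p)) ` V)"
        by (simp add: pullback_bundle_def openin_subtopology_Int)
    qed
    show "(\<lambda>p. (orbit (fst p), q p)) ` D = topspace (bun_total ?P)"
    proof (intro equalityI subsetI)
      fix z assume "z \<in> topspace (bun_total ?P)"
      then have z: "fst z = bun_proj E (snd z)" "snd z \<in> topspace (bun_total E)"
        by (auto simp: pullback_bundle_def)
      from z(2) obtain x v where "(x, v) \<in> D" "snd z = q (x, v)"
        by (rule E.total_cases)
      then show "z \<in> (\<lambda>p. (orbit (fst p), q p)) ` D"
        using z(1) E.proj_q by (intro image_eqI[of _ _ "(x, v)"] prod_eqI) simp_all
    qed (use mem in force)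
    show "D \<subseteq> S7 \<times> UNIV"
      by (rule E.domain)
  qed (auto simp: E.add_closed E.scale_closed E.rep_closed E.q_rep E.add_q E.scale_q
      pullback_bundle_def intro: E.q_inj)
qed

text \<open>The delicate point is openness. Nearby elements of the two summands may be represented
  over different points of one orbit, and only representatives over the same point combine to a
  point of the family. A neighbourhood W on which \<open>orbit\<close> is injective forces
  this.\<close>

lemma bundle_model_whitney_sum:
  fixes \<rho> :: "quat \<Rightarrow> 'a::euclidean_space \<Rightarrow> 'a" and \<sigma> :: "quat \<Rightarrow> 'b::euclidean_space \<Rightarrow> 'b"
  assumes "bundle_model E \<rho> D q" "bundle_model F \<sigma> D' q'"
  shows "bundle_model (E \<oplus>\<^sub>b F) (\<rho> \<boxplus> \<sigma>) {(x, (v, w)). (x, v) \<in> D \<and> (x, w) \<in> D'}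
    (\<lambda>(x, (v, w)). (q (x, v), q' (x, w)))"
proof -
  interpret E: bundle_model E \<rho> D q by fact
  interpret F: bundle_model F \<sigma> D' q' by fact
  let ?D = "{(x, (v, w)). (x, v) \<in> D \<and> (x, w) \<in> D'}"
  let ?q = "\<lambda>(x, (v, w)). (q (x, v), q' (x, w))"
  let ?S = "{(e, f). bun_proj E e = bun_proj F f}"
  have cont: "continuous_map (top_of_set ?D) (top_of_set D) (\<lambda>p. (fst p, fst (snd p)))"
    "continuous_map (top_of_set ?D) (top_of_set D') (\<lambda>p. (fst p, snd (snd p)))"
    by (auto intro!: continuous_intros)
  show ?thesis
  proof
    show "bun_base (E \<oplus>\<^sub>b F) = S7Q8"
      by (simp add: whitney_sum_def E.base)
    show "continuous_map (top_of_set ?D) (bun_total (E \<oplus>\<^sub>b F)) ?q"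
      unfolding whitney_sum_def
      using continuous_map_compose[OF cont(1) E.q_continuous] continuous_map_compose[OF cont(2) F.q_continuous]
      by (auto simp: continuous_map_in_subtopology case_prod_unfold o_def E.proj_q F.proj_q
          intro!: continuous_map_pairedI)
    show "open_map (top_of_set ?D) (bun_total (E \<oplus>\<^sub>b F)) ?q"
      unfolding open_map_def
    proof (intro allI impI)
      fix V assume V: "openin (top_of_set ?D) V"
      then obtain V' where V': "open V'" "V = ?D \<inter> V'"
        by (auto simp: openin_open)
      show "openin (bun_total (E \<oplus>\<^sub>b F)) (?q ` V)"
      proof (subst openin_subopen, intro ballI)
        fix z assume "z \<in> ?q ` V"
        then obtain x v w where xvw: "(x, (v, w)) \<in> V" "z = (q (x, v), q' (x, w))"
          by force
        then have D: "(x, v) \<in> D" "(x, w) \<in> D'" "x \<in> S7" and "(x, (v, w)) \<in> V'"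
          using V' E.in_S7[of x v] by simp_all
        then obtain A BC where A: "open A" "x \<in> A" "open BC" "(v, w) \<in> BC" "A \<times> BC \<subseteq> V'"
          using open_prod_elim[OF V'(1)] by (metis mem_Sigma_iff)
        then obtain B C where BC: "open B" "v \<in> B" "open C" "w \<in> C" "B \<times> C \<subseteq> BC"
          using open_prod_elim[OF A(3)] by (metis mem_Sigma_iff)
        obtain W where W: "openin (top_of_set S7) W" "x \<in> W" "W \<subseteq> S7 \<inter> A" "inj_on orbit W"
          using small_neighbourhood[OF D(3), of "S7 \<inter> A"] A(1,2) D(3) by (metis IntI openin_open_Int)
        define T where "T = (q ` (D \<inter> W \<times> B)) \<times> (q' ` (D' \<inter> W \<times> C)) \<inter> ?S"
        have "openin (prod_topology (bun_total E) (bun_total F)) ((q ` (D \<inter> W \<times> B)) \<times> (q' ` (D' \<inter> W \<times> C)))"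
          using openin_Times_subset[OF W(1) BC(1) E.domain] openin_Times_subset[OF W(1) BC(3) F.domain]
            E.q_open F.q_open by (simp add: openin_prod_Times_iff open_map_def)
        then have "openin (bun_total (E \<oplus>\<^sub>b F)) T"
          by (simp add: whitney_sum_def T_def openin_subtopology_Int)
        moreover have "z \<in> T"
          using xvw(2) D W(2) BC(2,4) by (simp add: T_def E.proj_q F.proj_q)
        moreover have "T \<subseteq> ?q ` V"
        proof
          fix t assume t: "t \<in> T"
          then obtain a b a' c where t_eq: "t = (q (a, b), q' (a', c))"
            and 1: "(a, b) \<in> D" "a \<in> W" "b \<in> B" "(a', c) \<in> D'" "a' \<in> W" "c \<in> C"
            unfolding T_def by blast
          have "orbit a = orbit a'"
            using t by (simp add: T_def t_eq E.proj_q[OF 1(1)] F.proj_q[OF 1(4)])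
          then have "a' = a"
            using W(4) 1 by (simp add: inj_on_def)
          then have "(a, (b, c)) \<in> V"
            using 1 W(3) BC(5) A(5) V'(2) by auto
          then show "t \<in> ?q ` V"
            using t_eq \<open>a' = a\<close> by (intro image_eqI[of _ _ "(a, (b, c))"]) simp_all
        qed
        ultimately show "\<exists>T. openin (bun_total (E \<oplus>\<^sub>b F)) T \<and> z \<in> T \<and> T \<subseteq> ?q ` V"
          by blast
      qed
    qed
    show "?q ` ?D = topspace (bun_total (E \<oplus>\<^sub>b F))"
    proof (intro equalityI subsetI)
      fix z assume "z \<in> ?q ` ?D"
      then obtain x v w where "(x, v) \<in> D" "(x, w) \<in> D'" "z = (q (x, v), q' (x, w))"
        by force
      then show "z \<in> topspace (bun_total (E \<oplus>\<^sub>b F))"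
        by (simp add: whitney_sum_def E.proj_q F.proj_q E.q_in_total F.q_in_total)
    next
      fix z assume "z \<in> topspace (bun_total (E \<oplus>\<^sub>b F))"
      then obtain e f where z: "z = (e, f)" "e \<in> topspace (bun_total E)" "f \<in> topspace (bun_total F)"
        "bun_proj E e = bun_proj F f"
        by (cases z) (simp add: whitney_sum_def)
      obtain x v where xv: "(x, v) \<in> D" "e = q (x, v)"
        using E.total_cases[OF z(2)] .
      have "bun_proj F f = orbit x"
        using z(4) E.proj_q[OF xv(1)] xv(2) by simp
      then obtain w where "(x, w) \<in> D'" "f = q' (x, w)"
        using F.total_cases_over[OF z(3)] by blast
      then show "z \<in> ?q ` ?D"
        using xv z(1) by (intro image_eqI[of _ _ "(x, (v, w))"]) simp_all
    qed
    show "?D \<subseteq> S7 \<times> UNIV"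
      using E.in_S7 by auto
    show "v = w" if "(x, v) \<in> ?D" "(x, w) \<in> ?D" "?q (x, v) = ?q (x, w)" for x v w
      using that E.q_inj[of x "fst v" "fst w"] F.q_inj[of x "snd v" "snd w"]
      by (simp add: case_prod_unfold prod.expand)
  qed (auto simp: whitney_sum_def E.add_closed F.add_closed E.scale_closed F.scale_closed E.rep_closed
      F.rep_closed E.q_rep F.q_rep E.proj_q E.add_q F.add_q E.scale_q F.scale_q)
qed

lemma ex_enumeration_of_Basis:
  "\<exists>b :: nat \<Rightarrow> 'a::euclidean_space. bij_betw b {..<DIM('a)} Basis"
  using ex_bij_betw_nat_finite[OF finite_Basis] by (simp add: atLeast0LessThan)

text \<open>The fibres of \<open>trivial_bundle\<close> consist of functions on an initial segment
  of the natural numbers; a fixed arbitrary enumeration of the basis translates.\<close>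

definition basis_enum :: "nat \<Rightarrow> 'a::euclidean_space" where
  "basis_enum = (SOME b. bij_betw b {..<DIM('a)} Basis)"

lemma basis_enum: "bij_betw (basis_enum :: nat \<Rightarrow> 'a::euclidean_space) {..<DIM('a)} Basis"
  unfolding basis_enum_def by (rule someI_ex[OF ex_enumeration_of_Basis])

text \<open>The restriction sets values beyond the dimension to \<open>undefined\<close>, as
  membership in \<open>coord_space\<close> demands.\<close>

definition coords :: "'a::euclidean_space \<Rightarrow> nat \<Rightarrow> real" where
  "coords v = (\<lambda>i\<in>{..<DIM('a)}. v \<bullet> basis_enum i)"

definition of_coords :: "(nat \<Rightarrow> real) \<Rightarrow> 'a::euclidean_space" where
  "of_coords f = (\<Sum>i<DIM('a). f i *\<^sub>R basis_enum i)"

lemma of_coords_coords: "of_coords (coords v) = (v :: 'a::euclidean_space)"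
proof -
  have "of_coords (coords v) = (\<Sum>i<DIM('a). (v \<bullet> basis_enum i) *\<^sub>R (basis_enum i :: 'a))"
    by (simp add: of_coords_def coords_def)
  also have "\<dots> = (\<Sum>b\<in>Basis. (v \<bullet> b) *\<^sub>R b)"
    by (rule sum.reindex_bij_betw[OF basis_enum])
  finally show ?thesis
    by (simp add: euclidean_representation)
qed

lemma coords_of_coords:
  assumes "f \<in> extensional {..<DIM('a::euclidean_space)}"
  shows "coords (of_coords f :: 'a) = f"
proof
  fix j
  show "coords (of_coords f :: 'a) j = f j"
  proof (cases "j < DIM('a)")
    case True
    have "(basis_enum i :: 'a) \<bullet> basis_enum j = (if i = j then 1 else 0)" if i: "i < DIM('a)" for i
    proof -
      have "(basis_enum i :: 'a) \<in> Basis" "(basis_enum j :: 'a) \<in> Basis"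
        using bij_betwE[OF basis_enum[where 'a = 'a]] True i by auto
      moreover have "(basis_enum i :: 'a) = basis_enum j \<longleftrightarrow> i = j"
        using bij_betw_imp_inj_on[OF basis_enum[where 'a = 'a]] True i by (auto dest: inj_onD)
      ultimately show ?thesis
        by (simp add: inner_Basis)
    qed
    then have "(\<Sum>i<DIM('a). f i * ((basis_enum i :: 'a) \<bullet> basis_enum j)) = (\<Sum>i<DIM('a). if i = j then f i else 0)"
      by (intro sum.cong) auto
    then show ?thesis
      using True by (simp add: coords_def of_coords_def inner_sum_left)
  next
    case False
    then show ?thesis
      using assms by (simp add: coords_def extensional_def)
  qed
qed

lemma topspace_coord_space: "topspace (coord_space n :: (nat \<Rightarrow> real) topology) = extensional {..<n}"
  by (simp add: coord_space_def PiE_def)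

lemma continuous_map_coords: "continuous_map euclidean (coord_space DIM('a)) (coords :: 'a::euclidean_space \<Rightarrow> _)"
  unfolding coord_space_def continuous_map_componentwise
  by (auto simp: coords_def intro!: continuous_intros)

lemma continuous_map_of_coords:
  "continuous_map (coord_space DIM('a)) euclidean (of_coords :: _ \<Rightarrow> 'a::euclidean_space)"
  unfolding of_coords_def
proof (rule continuous_map_sum)
  fix i assume i: "i \<in> {..<DIM('a)}"
  have "continuous_map (coord_space DIM('a)) euclideanreal (\<lambda>f. f i)"
    unfolding coord_space_def using i by (rule continuous_map_product_projection)
  moreover have "continuous_map euclideanreal euclidean (\<lambda>t. t *\<^sub>R (basis_enum i :: 'a))"
    by (simp add: continuous_intros)
  ultimately have "continuous_map (coord_space DIM('a)) euclidean ((\<lambda>t. t *\<^sub>R (basis_enum i :: 'a)) \<circ> (\<lambda>f. f i))"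
    by (rule continuous_map_compose)
  then show "continuous_map (coord_space DIM('a)) euclidean (\<lambda>f. f i *\<^sub>R (basis_enum i :: 'a))"
    by (simp add: o_def)
qed simp

lemma continuous_map_orbit_fst: "D \<subseteq> S7 \<times> UNIV \<Longrightarrow> continuous_map (top_of_set D) S7Q8 (\<lambda>p. orbit (fst p))"
proof -
  assume "D \<subseteq> S7 \<times> UNIV"
  then have "continuous_map (top_of_set D) (top_of_set S7) fst"
    by (auto intro: continuous_intros)
  from continuous_map_compose[OF this continuous_map_orbit] show ?thesis
    by (simp add: o_def)
qed

lemma bundle_model_trivial:
  "bundle_model (trivial_bundle S7Q8 DIM('a::euclidean_space)) (trivial_rep :: _ \<Rightarrow> 'a \<Rightarrow> 'a) (S7 \<times> UNIV)
     (\<lambda>p. (orbit (fst p), coords (snd p)))"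
proof -
  let ?T = "trivial_bundle S7Q8 DIM('a) :: (real, _, _) vbundle"
  let ?q = "\<lambda>p :: _ \<times> 'a. (orbit (fst p), coords (snd p))"
  have total: "bun_total ?T = prod_topology S7Q8 (coord_space DIM('a))"
    by (simp add: trivial_bundle_def)
  show ?thesis
  proof
    have "continuous_map (top_of_set (S7 \<times> UNIV)) euclidean (snd :: _ \<Rightarrow> 'a)"
      by (simp add: continuous_on_snd continuous_on_id)
    from continuous_map_compose[OF this continuous_map_coords]
    show "continuous_map (top_of_set (S7 \<times> UNIV)) (bun_total ?T) ?q"
      unfolding total by (intro continuous_map_pairedI continuous_map_orbit_fst) (simp_all add: o_def)
    show "open_map (top_of_set (S7 \<times> UNIV)) (bun_total ?T) ?q"
      unfolding open_map_def
    proof (intro allI impI)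
      fix V :: "((quat \<times> quat) \<times> 'a) set" assume V: "openin (top_of_set (S7 \<times> UNIV)) V"
      then obtain V' where V': "open V'" "V = S7 \<times> UNIV \<inter> V'"
        unfolding openin_open by (elim exE conjE)
      show "openin (bun_total ?T) (?q ` V)"
      proof (subst openin_subopen, intro ballI)
        fix z assume "z \<in> ?q ` V"
        then obtain p where p: "p \<in> V" "z = ?q p"
          by (elim imageE)
        then have "p \<in> V'" "fst p \<in> S7"
          using V'(2) by (simp_all add: mem_Times_iff)
        then obtain A B where A: "open A" "open B" "p \<in> A \<times> B" "A \<times> B \<subseteq> V'"
          using open_prod_elim[OF V'(1)] by metis
        define T where "T = orbit ` (S7 \<inter> A) \<times> {f \<in> topspace (coord_space DIM('a)). of_coords f \<in> B}"
        have "openin (coord_space DIM('a)) {f \<in> topspace (coord_space DIM('a)). of_coords f \<in> B}"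
          using openin_continuous_map_preimage[OF continuous_map_of_coords, of B] A(2) by simp
        then have "openin (bun_total ?T) T"
          using open_map_orbit openin_open_Int[OF A(1)] unfolding total T_def openin_prod_Times_iff open_map_def
          by blast
        moreover have "coords v \<in> topspace (coord_space DIM('a))" for v :: 'a
          by (simp add: topspace_coord_space coords_def)
        then have "z \<in> T"
          using p A(3) \<open>fst p \<in> S7\<close> by (simp add: T_def mem_Times_iff of_coords_coords)
        moreover have "T \<subseteq> ?q ` V"
        proof
          fix t assume "t \<in> T"
          then obtain a f where t: "t = (orbit a, f)" "a \<in> S7" "a \<in> A" "f \<in> extensional {..<DIM('a)}"
            "of_coords f \<in> B"
            unfolding T_def topspace_coord_space by blast
          then have "(a, of_coords f) \<in> V"
            using A(4) V'(2) by blast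
          then show "t \<in> ?q ` V"
            using t(1) coords_of_coords[OF t(4)] by (intro image_eqI[of _ _ "(a, of_coords f)"]) simp_all
        qed
        ultimately show "\<exists>T. openin (bun_total ?T) T \<and> z \<in> T \<and> T \<subseteq> ?q ` V"
          by blast
      qed
    qed
    show "?q ` (S7 \<times> UNIV) = topspace (bun_total ?T)"
    proof (intro equalityI subsetI)
      fix z assume "z \<in> ?q ` (S7 \<times> UNIV)"
      then show "z \<in> topspace (bun_total ?T)"
        unfolding total by (elim imageE) (simp add: topspace_S7Q8 topspace_coord_space coords_def mem_Times_iff)
    next
      fix z assume "z \<in> topspace (bun_total ?T)"
      then obtain x f where z: "z = (orbit x, f)" "x \<in> S7" "f \<in> extensional {..<DIM('a)}"
        unfolding total topspace_prod_topology topspace_S7Q8 topspace_coord_space by blast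
      then show "z \<in> ?q ` (S7 \<times> UNIV)"
        using coords_of_coords[OF z(3)] by (intro image_eqI[of _ _ "(x, of_coords f)"]) simp_all
    qed
    show "v = w" if "?q (x, v) = ?q (x, w)" for x v w
      using that of_coords_coords by (metis prod.inject snd_conv)
  qed (auto simp: trivial_bundle_def trivial_rep_def coords_def inner_add_left intro!: restrict_ext)
qed

text \<open>Over an evenly covered set both E and the trivial bundle of the same rank are
  homeomorphic to the product of W and the fibre. The trivialisation goes from E to this product and
  on to the trivial bundle.\<close>

lemma vector_bundle_of_model:
  fixes E :: "(real, (quat \<times> quat) set, 'e) vbundle" and \<rho> :: "quat \<Rightarrow> 'a::euclidean_space \<Rightarrow> 'a"
  assumes "bundle_model E \<rho> (S7 \<times> UNIV) q"
  shows "vector_bundle E"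
  unfolding vector_bundle_def
proof (intro conjI ballI)
  interpret E: bundle_model E \<rho> "S7 \<times> UNIV" q by fact
  let ?t = "\<lambda>p :: _ \<times> 'a. (orbit (fst p), coords (snd p))"
  interpret T: bundle_model "trivial_bundle S7Q8 DIM('a)" "trivial_rep :: _ \<Rightarrow> 'a \<Rightarrow> 'a" "S7 \<times> UNIV" ?t
    by (rule bundle_model_trivial)
  have "continuous_map (top_of_set (S7 \<times> UNIV)) S7Q8 (bun_proj E \<circ> q)"
    by (rule continuous_map_eq[OF continuous_map_orbit_fst[OF order_refl]])
      (use E.proj_q in \<open>simp add: mem_Times_iff\<close>, metis E.proj_q SigmaI UNIV_I prod.collapse)
  then show "continuous_map (bun_total E) (bun_base E) (bun_proj E)"
    using continuous_compose_quotient_map[OF E.q_quotient] unfolding E.base by blast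
  fix b assume "b \<in> topspace (bun_base E)"
  then obtain x where x: "x \<in> S7" "b = orbit x"
    unfolding E.base topspace_S7Q8 by (elim imageE)
  obtain W where W: "openin (top_of_set S7) W" "x \<in> W" "W \<subseteq> S7" "inj_on orbit W"
    using small_neighbourhood[OF x(1) openin_subtopology_self x(1)] by metis
  define U EU where "U = orbit ` W" and "EU = {e \<in> topspace (bun_total E). bun_proj E e \<in> U}"
  have WD: "S7 \<times> UNIV \<inter> W \<times> UNIV = (W \<times> UNIV :: (_ \<times> 'a) set)"
    using W(3) by blast
  obtain g where g: "homeomorphic_maps (top_of_set (W \<times> UNIV)) (subtopology (bun_total E) EU) q g"
    using E.homeomorphic_map_q[OF W(1,4)] unfolding homeomorphic_map_maps WD EU_def U_def by blast
  have "subtopology (bun_total (trivial_bundle S7Q8 DIM('a)))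
      {e \<in> topspace (bun_total (trivial_bundle S7Q8 DIM('a) :: (real, _, _) vbundle)).
        bun_proj (trivial_bundle S7Q8 DIM('a) :: (real, _, _) vbundle) e \<in> U} =
      subtopology (prod_topology S7Q8 (coord_space DIM('a))) (topspace (prod_topology S7Q8 (coord_space DIM('a))) \<inter> U \<times> topspace (coord_space DIM('a)))"
    by (rule arg_cong2[where f = subtopology]) (auto simp: trivial_bundle_def)
  also have "\<dots> = prod_topology (subtopology S7Q8 U) (coord_space DIM('a))"
    by (simp only: subtopology_restrict prod_topology_subtopology)
  finally have t: "homeomorphic_map (top_of_set (W \<times> UNIV)) (prod_topology (subtopology S7Q8 U) (coord_space DIM('a))) ?t"
    using T.homeomorphic_map_q[OF W(1,4)] unfolding WD U_def[symmetric] by simp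
  have "homeomorphic_map (subtopology (bun_total E) EU) (top_of_set (W \<times> UNIV)) g"
    using g homeomorphic_maps_map by blast
  from homeomorphic_map_compose[OF this t]
  have \<phi>: "homeomorphic_map (subtopology (bun_total E) EU) (prod_topology (subtopology S7Q8 U) (coord_space DIM('a))) (?t \<circ> g)" .
  have gq: "g (q (z, v)) = (z, v)" if "z \<in> W" for z v
    using g that unfolding homeomorphic_maps_def by simp
  have EU_cases: "\<exists>z v. z \<in> W \<and> e = q (z, v)" if "e \<in> EU" for e
  proof -
    from that obtain z where z: "z \<in> W" "bun_proj E e = orbit z" "e \<in> topspace (bun_total E)"
      unfolding EU_def U_def by (elim CollectE conjE imageE)
    from E.total_cases_over[OF z(3,2)] z(1) show ?thesis
      by metis
  qed
  have D: "(z, v) \<in> S7 \<times> UNIV" if "z \<in> W" for z and v :: 'a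
    using that W(3) by blast
  have qEU: "q (z, v) \<in> EU" if "z \<in> W" for z v
    using E.q_in_total[OF D[OF that]] E.proj_q[OF D[OF that]] that unfolding EU_def U_def by simp
  have proj: "fst ((?t \<circ> g) e) = bun_proj E e" if "e \<in> EU" for e
    using EU_cases[OF that] E.proj_q D gq by fastforce
  have add: "bun_add E e e' \<in> EU \<and> bun_proj E (bun_add E e e') = bun_proj E e \<and>
      (\<forall>i<DIM('a). snd ((?t \<circ> g) (bun_add E e e')) i = snd ((?t \<circ> g) e) i + snd ((?t \<circ> g) e') i)"
    if e: "e \<in> EU" and e': "e' \<in> EU" and same: "bun_proj E e = bun_proj E e'" for e e'
  proof -
    obtain z v z' v' where zv: "z \<in> W" "e = q (z, v)" "z' \<in> W" "e' = q (z', v')"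
      using EU_cases[OF e] EU_cases[OF e'] by metis
    have "orbit z = orbit z'"
      using same E.proj_q[OF D[OF zv(1)]] E.proj_q[OF D[OF zv(3)]] unfolding zv(2,4) by simp
    then have "z' = z"
      using W(4) zv(1,3) by (simp add: inj_on_def)
    then show ?thesis
      using zv(1) by (simp add: zv(2,4) E.add_q[OF D D] gq qEU E.proj_q[OF D] coords_def inner_add_left)
  qed
  have scale: "bun_scale E c e \<in> EU \<and> bun_proj E (bun_scale E c e) = bun_proj E e \<and>
      (\<forall>i<DIM('a). snd ((?t \<circ> g) (bun_scale E c e)) i = c * snd ((?t \<circ> g) e) i)"
    if e: "e \<in> EU" for e c
  proof -
    obtain z v where zv: "z \<in> W" "e = q (z, v)"
      using EU_cases[OF e] by metis
    then show ?thesis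
      by (simp add: E.scale_q[OF D] gq qEU E.proj_q[OF D] coords_def)
  qed
  have "b \<in> U"
    using x(2) W(2) by (simp add: U_def)
  have "openin S7Q8 U"
    using open_map_orbit W(1) unfolding U_def open_map_def by blast
  then show "\<exists>U n \<phi>. openin (bun_base E) U \<and> b \<in> U \<and>
        (let EU = {e \<in> topspace (bun_total E). bun_proj E e \<in> U} in
          homeomorphic_map (subtopology (bun_total E) EU)
            (prod_topology (subtopology (bun_base E) U) (coord_space n)) \<phi> \<and>
          (\<forall>e\<in>EU. fst (\<phi> e) = bun_proj E e) \<and>
          (\<forall>e\<in>EU. \<forall>e'\<in>EU. bun_proj E e = bun_proj E e' \<longrightarrow>
             bun_add E e e' \<in> EU \<and> bun_proj E (bun_add E e e') = bun_proj E e \<and>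
             (\<forall>i<n. snd (\<phi> (bun_add E e e')) i = snd (\<phi> e) i + snd (\<phi> e') i)) \<and>
          (\<forall>c. \<forall>e\<in>EU.
             bun_scale E c e \<in> EU \<and> bun_proj E (bun_scale E c e) = bun_proj E e \<and>
             (\<forall>i<n. snd (\<phi> (bun_scale E c e)) i = c * snd (\<phi> e) i)))"
    using \<phi> proj add scale \<open>b \<in> U\<close>
    by (intro exI[of _ U] exI[of _ "DIM('a)"] exI[of _ "?t \<circ> g"], unfold Let_def E.base, fold EU_def) blast
qed

text \<open>The enumeration \<open>idx\<close> passes between tuples indexed by numbers and vectors
  indexed by a finite type, which form a Euclidean space. Openness has the same obstacle as for sums
  of two bundles, now for m representatives at once.\<close>

lemma bundle_model_multiple:
  fixes \<rho> :: "quat \<Rightarrow> 'a::euclidean_space \<Rightarrow> 'a" and idx :: "nat \<Rightarrow> 'n::finite"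
  assumes "bundle_model E \<rho> (S7 \<times> UNIV) q" and idx: "bij_betw idx {..<m} UNIV"
  shows "bundle_model (multiple_bundle m E) (\<lambda>g v :: 'a ^ 'n. \<chi> i. \<rho> g (v $ i)) (S7 \<times> UNIV)
    (\<lambda>p. (orbit (fst p), \<lambda>i\<in>{..<m}. q (fst p, snd p $ idx i)))"
proof -
  interpret E: bundle_model E \<rho> "S7 \<times> UNIV" q by fact
  let ?M = "multiple_bundle m E"
  let ?q = "\<lambda>p :: _ \<times> ('a ^ 'n). (orbit (fst p), \<lambda>i\<in>{..<m}. q (fst p, snd p $ idx i))"
  let ?P = "prod_topology S7Q8 (product_topology (\<lambda>_. bun_total E) {..<m})"
  let ?S = "{(x, v). \<forall>i<m. bun_proj E (v i) = x}"
  have total: "bun_total ?M = subtopology ?P ?S"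
    by (simp add: multiple_bundle_def E.base)
  \<comment> \<open>The index type is nonempty, so index 0 exists; its base point will serve as the
    common base point of all components.\<close>
  have "m > 0"
    using idx by (cases m) (auto simp: bij_betw_def)
  obtain jnv where jnv: "\<And>j. jnv j < m" "\<And>j. idx (jnv j) = j" "\<And>i. i < m \<Longrightarrow> jnv (idx i) = i"
    using that[of "inv_into {..<m} idx"] bij_betw_inv_into_left[OF idx] bij_betw_inv_into_right[OF idx]
      bij_betwE[OF bij_betw_inv_into[OF idx]] by simp
  have tot_mem: "(p, f) \<in> topspace (bun_total ?M) \<longleftrightarrow> p \<in> topspace S7Q8 \<and> f \<in> extensional {..<m} \<and>
      (\<forall>i<m. f i \<in> topspace (bun_total E) \<and> bun_proj E (f i) = p)" for p f
    by (auto simp: total PiE_def Pi_def)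
  show ?thesis
  proof
    show "bun_base ?M = S7Q8"
      by (simp add: multiple_bundle_def E.base)
    have "continuous_map (top_of_set (S7 \<times> UNIV)) (bun_total E) (\<lambda>p :: _ \<times> ('a ^ 'n). q (fst p, snd p $ j))" for j
    proof -
      have "continuous_map (top_of_set (S7 \<times> UNIV)) (top_of_set (S7 \<times> UNIV)) (\<lambda>p :: _ \<times> ('a ^ 'n). (fst p, snd p $ j))"
        by (auto intro!: continuous_intros)
      from continuous_map_compose[OF this E.q_continuous] show ?thesis
        by (simp add: o_def)
    qed
    then show "continuous_map (top_of_set (S7 \<times> UNIV)) (bun_total ?M) ?q"
      unfolding total continuous_map_in_subtopology
      by (intro conjI continuous_map_pairedI continuous_map_orbit_fst order_refl)
        (auto simp: continuous_map_componentwise E.proj_q)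
    show "open_map (top_of_set (S7 \<times> UNIV)) (bun_total ?M) ?q"
      unfolding open_map_def
    proof (intro allI impI)
      fix V :: "((quat \<times> quat) \<times> ('a ^ 'n)) set" assume V: "openin (top_of_set (S7 \<times> UNIV)) V"
      then obtain V' where V': "open V'" "V = S7 \<times> UNIV \<inter> V'"
        unfolding openin_open by (elim exE conjE)
      show "openin (bun_total ?M) (?q ` V)"
      proof (subst openin_subopen, intro ballI)
        fix z assume "z \<in> ?q ` V"
        then obtain p where p: "p \<in> V" "z = ?q p"
          by (elim imageE)
        then have "p \<in> V'" and p1: "fst p \<in> S7"
          using V'(2) by (simp_all add: mem_Times_iff)
        then obtain A B where A: "open A" "open B" "fst p \<in> A" "snd p \<in> B" "A \<times> B \<subseteq> V'"
          using open_prod_elim[OF V'(1)] by (metis mem_Times_iff)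
        obtain C where C: "\<And>j. open (C j)" "\<And>j. snd p $ j \<in> C j" "\<And>y. (\<And>j. y $ j \<in> C j) \<Longrightarrow> y \<in> B"
          using A(2,4) unfolding open_vec_def by metis
        obtain W where W: "openin (top_of_set S7) W" "fst p \<in> W" "W \<subseteq> S7 \<inter> A" "inj_on orbit W"
          using small_neighbourhood[OF p1 openin_open_Int[OF A(1)]] A(3) p1 by (metis IntI)
        define T where "T = topspace S7Q8 \<times> PiE {..<m} (\<lambda>i. q ` (S7 \<times> UNIV \<inter> W \<times> C (idx i))) \<inter> ?S"
        have "openin (bun_total E) (q ` (S7 \<times> UNIV \<inter> W \<times> C j))" for j
          using openin_Times_subset[OF W(1) C(1) order_refl] E.q_open unfolding open_map_def by blast
        then have "openin (bun_total ?M) T"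
          unfolding total T_def
          by (intro openin_subtopology_Int) (simp add: openin_prod_Times_iff openin_PiE)
        moreover have "z \<in> T"
          using p(2) p1 W(2) C(2) by (simp add: T_def topspace_S7Q8 E.proj_q)
        moreover have "T \<subseteq> ?q ` V"
        proof
          fix t assume t: "t \<in> T"
          obtain a f where af: "t = (a, f)"
            by (cases t)
          have f: "f \<in> extensional {..<m}" "\<And>i. i < m \<Longrightarrow> f i \<in> q ` (S7 \<times> UNIV \<inter> W \<times> C (idx i))"
            "\<And>i. i < m \<Longrightarrow> bun_proj E (f i) = a"
            using t unfolding T_def af by (auto simp: PiE_def)
          have "\<exists>y v. y \<in> W \<and> v \<in> C (idx i) \<and> f i = q (y, v)" if "i < m" for i
            using f(2)[OF that] by blast
          then obtain y v where yv: "\<And>i. i < m \<Longrightarrow> y i \<in> W" "\<And>i. i < m \<Longrightarrow> v i \<in> C (idx i)"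
            "\<And>i. i < m \<Longrightarrow> f i = q (y i, v i)"
            by metis
          have orb: "orbit (y i) = a" if "i < m" for i
            using f(3)[OF that] yv(1)[OF that] W(3) E.proj_q[of "y i" "v i"] yv(3)[OF that] by auto
          have y0: "y i = y 0" if "i < m" for i
            using inj_onD[OF W(4), of "y i" "y 0"] orb that \<open>m > 0\<close> yv(1) by simp
          define w where "w = (\<chi> j. v (jnv j))"
          have "w \<in> B"
            using C(3)[of w] yv(2) jnv(1,2) by (metis w_def vec_lambda_beta)
          then have "(y 0, w) \<in> V"
            using yv(1)[OF \<open>m > 0\<close>] W(3) A(5) V'(2) by blast
          moreover have "t = ?q (y 0, w)"
            unfolding af
          proof (rule arg_cong2[where f = Pair])
            show "f = (\<lambda>i\<in>{..<m}. q (fst (y 0, w), snd (y 0, w) $ idx i))"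
            proof (rule extensionalityI[OF f(1) restrict_extensional])
              show "f i = (\<lambda>i\<in>{..<m}. q (fst (y 0, w), snd (y 0, w) $ idx i)) i" if "i \<in> {..<m}" for i
                using yv(3)[of i] y0[of i] jnv(3)[of i] that by (simp add: w_def)
            qed
          qed (use orb \<open>m > 0\<close> in simp)
          ultimately show "t \<in> ?q ` V"
            by (rule rev_image_eqI)
        qed
        ultimately show "\<exists>T. openin (bun_total ?M) T \<and> z \<in> T \<and> T \<subseteq> ?q ` V"
          by blast
      qed
    qed
    show "?q ` (S7 \<times> UNIV) = topspace (bun_total ?M)"
    proof (intro equalityI subsetI)
      fix z assume "z \<in> ?q ` (S7 \<times> UNIV)"
      then obtain p where "fst p \<in> S7" "z = ?q p"
        by (elim imageE) (simp add: mem_Times_iff)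
      then show "z \<in> topspace (bun_total ?M)"
        by (simp add: tot_mem topspace_S7Q8 E.proj_q E.q_in_total)
    next
      fix z assume z: "z \<in> topspace (bun_total ?M)"
      obtain a f where af: "z = (a, f)"
        by (cases z)
      have f: "a \<in> topspace S7Q8" "f \<in> extensional {..<m}" "\<And>i. i < m \<Longrightarrow> f i \<in> topspace (bun_total E)"
          "\<And>i. i < m \<Longrightarrow> bun_proj E (f i) = a"
        using z unfolding af tot_mem by simp_all
      obtain x where x: "x \<in> S7" "a = orbit x"
        using f(1) unfolding topspace_S7Q8 by (elim imageE)
      have "\<exists>v. f i = q (x, v)" if "i < m" for i
        using E.total_cases_over[OF f(3)[OF that], of x] f(4)[OF that] x(2) by metis
      then obtain v where v: "\<And>i. i < m \<Longrightarrow> f i = q (x, v i)"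
        by metis
      have "z = ?q (x, \<chi> j. v (jnv j))"
        unfolding af
      proof (rule arg_cong2[where f = Pair])
        show "f = (\<lambda>i\<in>{..<m}. q (fst (x, \<chi> j. v (jnv j)), snd (x, \<chi> j. v (jnv j)) $ idx i))"
          using v jnv(3) by (intro extensionalityI[OF f(2) restrict_extensional]) simp
      qed (simp add: x(2))
      then show "z \<in> ?q ` (S7 \<times> UNIV)"
        using x(1) by (intro image_eqI[of _ _ "(x, \<chi> j. v (jnv j))"]) simp_all
    qed
    show "v = w" if "(x, v) \<in> S7 \<times> UNIV" "(x, w) \<in> S7 \<times> UNIV" "?q (x, v) = ?q (x, w)" for x v w
    proof (rule vec_eq_iff[THEN iffD2], rule allI)
      fix j
      have "(\<lambda>i\<in>{..<m}. q (x, v $ idx i)) (jnv j) = (\<lambda>i\<in>{..<m}. q (x, w $ idx i)) (jnv j)"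
        using that(3) by simp
      then have "q (x, v $ j) = q (x, w $ j)"
        by (simp add: jnv)
      then show "v $ j = w $ j"
        using that(1) by (intro E.q_inj[of x]) simp_all
    qed
    show "?q (act g x, \<chi> i. \<rho> g (v $ i)) = ?q (x, v)" if "g \<in> Q8" "(x, v) \<in> S7 \<times> UNIV" for g x v
      using that by (simp add: E.q_rep)
  qed (simp_all add: multiple_bundle_def E.add_q E.scale_q cong: restrict_cong)
qed

section \<open>The bundle of the representation y\<close>

lemma rep_y_mult: "rep_y (qmult g h) *v v = rep_y g *v (rep_y h *v v)"
proof -
  have v: "v = vector [v $ 1, v $ 2]" for v :: "complex ^ 2"
    by (simp add: vec_eq_iff forall_2)
  show ?thesis
    by (subst v, subst (2) v) (simp only: rep_y_left_mult qmult_assoc prod.collapse)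
qed

lemma rep_y_q1: "rep_y q1 *v v = v"
  by (simp add: rep_y_def q1_def vec_eq_iff matrix_vector_mult_def forall_2 sum_2)

abbreviation y_rep :: "quat \<Rightarrow> complex ^ 2 \<Rightarrow> complex ^ 2" where
  "y_rep g v \<equiv> rep_y g *v v"

text \<open>The points of the total space are whole orbits, and their sums and multiples are formed
  as sets. Freeness of the action on the sphere guarantees that vectors of two orbits over the same
  y come from the same group element, so that the set operations are the linear ones on
  representatives.\<close>

lemma bundle_model_eta: "bundle_model eta_R y_rep (S7 \<times> UNIV) (assoc_orbit rep_y)"
proof -
  let ?q = "assoc_orbit rep_y"
  let ?a = "\<lambda>g (p :: (quat \<times> quat) \<times> (complex ^ 2)). (act g (fst p), y_rep g (snd p))"
  have q_image: "?q p = (\<lambda>g. ?a g p) ` Q8" for p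
    by (simp add: assoc_orbit_def case_prod_unfold)
  have mem: "(y, w) \<in> ?q (x, v) \<longleftrightarrow> (\<exists>g\<in>Q8. y = act g x \<and> w = y_rep g v)" for x y v w
    by (auto simp: assoc_orbit_def)
  have aa: "?a g (?a h p) = ?a (qmult g h) p" for g h p
    by (simp add: act_act rep_y_mult)
  have a_inv: "?a (qconj g) (?a g p) = p" "?a g (?a (qconj g) p) = p" if "g \<in> Q8" for g p
    using that unfolding aa by (simp_all add: rep_y_q1)
  have sub: "?q (?a g p) \<subseteq> ?q p" if "g \<in> Q8" for g p
    using that unfolding q_image aa by auto
  have inv: "?q (?a g p) = ?q p" if "g \<in> Q8" for g p
    using sub[OF that, of p] sub[of "qconj g" "?a g p"] that unfolding a_inv(1)[OF that] by simp
  have self: "p \<in> ?q p" for p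
    using image_eqI[of p "\<lambda>g. ?a g p" q1 Q8] unfolding q_image by (simp add: rep_y_q1)
  have top: "prod_topology (top_of_set S7) (euclidean :: (complex ^ 2) topology) = top_of_set (S7 \<times> UNIV)"
    using prod_topology_subtopology_eu[of S7 "UNIV :: (complex ^ 2) set"] by simp
  have total: "bun_total eta_R = quotient_topology (top_of_set (S7 \<times> UNIV)) ?q"
    by (simp add: eta_def underlying_real_def associated_bundle_def top)
  have a_cont: "continuous_on S (?a g)" for S g
    unfolding matrix_vector_mult_def by (intro continuous_intros act.continuous_on continuous_on_vec_lambda)
  have free: "g = h" if "g \<in> Q8" "h \<in> Q8" "act g x = act h x" "x \<in> S7" for g h x
  proof -
    have "act (qmult (qconj h) g) x = x"
      using that by (simp flip: act_act)
    then have "qmult (qconj h) g = q1"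
      using act_free[of "qmult (qconj h) g" x] that by simp
    then have "qmult h (qmult (qconj h) g) = h"
      by simp
    then show ?thesis
      using that by simp
  qed
  have uniq: "\<exists>!w. (act g x, w) \<in> ?q (x, v)" if "g \<in> Q8" "x \<in> S7" for g x v
    unfolding mem using that free by metis
  show ?thesis
  proof
    show "bun_base eta_R = S7Q8"
      by (simp add: eta_def underlying_real_def associated_bundle_def)
    show "continuous_map (top_of_set (S7 \<times> UNIV)) (bun_total eta_R) ?q"
      unfolding total by (rule continuous_map_quotient_topology)
    show "?q ` (S7 \<times> UNIV) = topspace (bun_total eta_R)"
      by (simp add: total topspace_quotient_topology)
    show "open_map (top_of_set (S7 \<times> UNIV)) (bun_total eta_R) ?q"
      unfolding open_map_def
    proof (intro allI impI)
      fix V :: "((quat \<times> quat) \<times> (complex ^ 2)) set"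
      assume V: "openin (top_of_set (S7 \<times> UNIV)) V"
      have VS: "V \<subseteq> S7 \<times> UNIV"
        using openin_imp_subset[OF V] .
      have "{p \<in> S7 \<times> UNIV. ?q p \<in> ?q ` V} = (\<Union>g\<in>Q8. {p \<in> S7 \<times> UNIV. ?a g p \<in> V})"
      proof (intro equalityI subsetI)
        fix p assume p: "p \<in> {p \<in> S7 \<times> UNIV. ?q p \<in> ?q ` V}"
        then obtain p' where p': "p' \<in> V" "?q p = ?q p'"
          by (elim CollectE conjE imageE)
        have "p' \<in> ?q p"
          using self[of p'] by (simp only: p'(2))
        then obtain g where "g \<in> Q8" "p' = ?a g p"
          unfolding q_image by (elim imageE)
        then show "p \<in> (\<Union>g\<in>Q8. {p \<in> S7 \<times> UNIV. ?a g p \<in> V})"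
          using p p'(1) by blast
      next
        fix p assume "p \<in> (\<Union>g\<in>Q8. {p \<in> S7 \<times> UNIV. ?a g p \<in> V})"
        then obtain g where "g \<in> Q8" "p \<in> S7 \<times> UNIV" "?a g p \<in> V"
          by (elim UN_E CollectE conjE)
        then show "p \<in> {p \<in> S7 \<times> UNIV. ?q p \<in> ?q ` V}"
          using inv by (metis (no_types, lifting) CollectI image_eqI)
      qed
      moreover have "openin (top_of_set (S7 \<times> UNIV)) {p \<in> S7 \<times> UNIV. ?a g p \<in> V}" if "g \<in> Q8" for g
      proof -
        have "continuous_map (top_of_set (S7 \<times> UNIV)) (top_of_set (S7 \<times> UNIV)) (?a g)"
          using that a_cont by (simp add: continuous_map_in_subtopology image_subset_iff mem_Times_iff Pi_iff)
        from openin_continuous_map_preimage[OF this V] show ?thesis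
          by simp
      qed
      ultimately show "openin (bun_total eta_R) (?q ` V)"
        unfolding total openin_quotient_topology using VS by (auto simp: image_mono intro!: openin_Union)
    qed
    fix x :: "quat \<times> quat" and v w :: "complex ^ 2"
    assume "(x, v) \<in> S7 \<times> (UNIV :: (complex ^ 2) set)"
    then have x: "x \<in> S7"
      by simp
    show "?q (act g x, y_rep g v) = ?q (x, v)" if "g \<in> Q8" for g
      using inv[OF that, of "(x, v)"] by simp
    show "bun_proj eta_R (?q (x, v)) = orbit x"
      by (simp add: eta_def underlying_real_def associated_bundle_def q_image orbit_def image_image)
    show "v = w" if "?q (x, v) = ?q (x, w)"
      using self[of "(x, v)"] self[of "(x, w)"] uniq[OF q1_in_Q8 x] that by (metis act_q1)
    have "{(y, a + b) |y a b. (y, a) \<in> ?q (x, v) \<and> (y, b) \<in> ?q (x, w)} = ?q (x, v + w)"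
    proof (intro equalityI subsetI)
      fix z assume "z \<in> {(y, a + b) |y a b. (y, a) \<in> ?q (x, v) \<and> (y, b) \<in> ?q (x, w)}"
      then obtain y a b where z: "z = (y, a + b)" "(y, a) \<in> ?q (x, v)" "(y, b) \<in> ?q (x, w)"
        by blast
      then obtain g h where gh: "g \<in> Q8" "y = act g x" "a = y_rep g v" "h \<in> Q8" "y = act h x" "b = y_rep h w"
        unfolding mem by blast
      then have "g = h"
        using free x by metis
      then show "z \<in> ?q (x, v + w)"
        using gh unfolding z(1) mem by (auto simp: matrix_vector_right_distrib)
    next
      fix z assume "z \<in> ?q (x, v + w)"
      then obtain g where "g \<in> Q8" "z = (act g x, y_rep g v + y_rep g w)"
        unfolding q_image by (elim imageE) (simp add: matrix_vector_right_distrib)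
      then show "z \<in> {(y, a + b) |y a b. (y, a) \<in> ?q (x, v) \<and> (y, b) \<in> ?q (x, w)}"
        using mem by blast
    qed
    then show "bun_add eta_R (?q (x, v)) (?q (x, w)) = ?q (x, v + w)"
      by (simp add: eta_def underlying_real_def associated_bundle_def)
    fix r :: real
    \<comment> \<open>The underlying real bundle scales by complex multiplication with a real
      number, whereas the model scales by \<open>scaleR\<close>.\<close>
    have "(r *\<^sub>R v) $ j = complex_of_real r * v $ j" for j
      by (simp add: scaleR_conv_of_real[of r "v $ j"])
    then have lin: "y_rep g (r *\<^sub>R v) = complex_of_real r *s y_rep g v" for g
      by (simp add: vec_eq_iff matrix_vector_mult_def sum_distrib_left mult_ac)
    have "{(y, complex_of_real r *s a) |y a. (y, a) \<in> ?q (x, v)} = ?q (x, r *\<^sub>R v)"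
    proof (intro equalityI subsetI)
      fix z assume "z \<in> {(y, complex_of_real r *s a) |y a. (y, a) \<in> ?q (x, v)}"
      then obtain y a where z: "z = (y, complex_of_real r *s a)" "(y, a) \<in> ?q (x, v)"
        by blast
      then obtain g where "g \<in> Q8" "y = act g x" "a = y_rep g v"
        unfolding mem by blast
      then show "z \<in> ?q (x, r *\<^sub>R v)"
        unfolding z(1) mem by (auto simp: lin)
    next
      fix z assume "z \<in> ?q (x, r *\<^sub>R v)"
      then obtain g where "g \<in> Q8" "z = (act g x, complex_of_real r *s y_rep g v)"
        unfolding q_image by (elim imageE) (simp add: lin)
      then show "z \<in> {(y, complex_of_real r *s a) |y a. (y, a) \<in> ?q (x, v)}"
        using mem by blast
    qed
    then show "bun_scale eta_R r (?q (x, v)) = ?q (x, r *\<^sub>R v)"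
      by (simp add: eta_def underlying_real_def associated_bundle_def)
  qed simp_all
qed

section \<open>Local homology and the degree of the identity\<close>

text \<open>The punctured space is homotopy equivalent to a sphere of one dimension less.\<close>

lemma reduced_homology_punctured_space:
  fixes a :: "'b::euclidean_space"
  shows "reduced_homology_group (int DIM('b) - 1) (top_of_set (UNIV - {a})) \<cong> integer_group"
proof -
  obtain f g where "homeomorphic_maps (nsphere (DIM('b) - 1)) (top_of_set (sphere 0 1 \<inter> span (Basis :: 'b set))) f g"
    using homeomorphic_maps_nsphere_euclidean_sphere[OF independent_Basis orthogonal_Basis refl _ norm_Basis]
    by (metis DIM_positive not_gr0)
  then have "nsphere (DIM('b) - 1) homeomorphic_space top_of_set (sphere 0 1 :: 'b set)"
    by (auto simp: homeomorphic_space_def)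
  then have "nsphere (DIM('b) - 1) homotopy_equivalent_space top_of_set (sphere 0 1 :: 'b set)"
    by (rule homeomorphic_imp_homotopy_equivalent_space)
  also have "top_of_set (sphere 0 1 :: 'b set) homotopy_equivalent_space top_of_set (sphere a 1)"
    by (intro homeomorphic_imp_homotopy_eqv homeomorphic_spheres) simp_all
  also have "sphere a 1 homotopy_eqv (UNIV - {a})"
    using homotopy_eqv_rel_frontier_punctured_convex[of "cball a 1" a UNIV]
    by (simp add: rel_interior_interior interior_cball affine_hull_nonempty_interior)
  finally have "nsphere (DIM('b) - 1) homotopy_equivalent_space top_of_set (UNIV - {a})" .
  then have "reduced_homology_group (int (DIM('b) - 1)) (nsphere (DIM('b) - 1)) \<cong>
      reduced_homology_group (int (DIM('b) - 1)) (top_of_set (UNIV - {a}))"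
    by (rule homotopy_equivalent_space_imp_isomorphic_reduced_homology_groups)
  moreover have "int (DIM('b) - 1) = int DIM('b) - 1"
    using DIM_positive[where 'a = 'b] by linarith
  ultimately show ?thesis
    using reduced_homology_group_nsphere(1)[of "DIM('b) - 1"]
    by (metis group.iso_sym group_reduced_homology_group iso_trans)
qed

text \<open>Since Euclidean space is contractible, relative homology of the pair is reduced homology
  of the punctured space one degree lower.\<close>

lemma local_homology_euclidean:
  fixes a :: "'b::euclidean_space"
  shows "relative_homology_group (int DIM('b)) euclidean (UNIV - {a}) \<cong> integer_group"
proof -
  have "\<exists>b :: 'b. b \<noteq> a"
    by (metis UNIV_I not_open_singleton open_UNIV singletonI subsetI subset_antisym UNIV_eq_I)
  then have "relative_homology_group (int DIM('b)) euclidean (UNIV - {a}) \<cong>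
      reduced_homology_group (int DIM('b) - 1) (subtopology euclidean (UNIV - {a}))"
    using contractible_space_top_of_set[of "UNIV :: 'b set"]
    by (intro isomorphic_group_relative_homology_of_contractible) (auto simp: convex_imp_contractible)
  then show ?thesis
    using reduced_homology_punctured_space iso_trans by blast
qed

text \<open>Excision of the complement of U, followed by transport along f. The neighbourhood is
  asked to fill all of Euclidean space so that the global computation applies.\<close>

lemma local_homology_group:
  fixes f :: "'a \<Rightarrow> 'b::euclidean_space"
  assumes "Hausdorff_space X" "openin X U" "x \<in> U"
    and f: "homeomorphic_map (subtopology X U) euclidean f"
  shows "relative_homology_group (int DIM('b)) X (topspace X - {x}) \<cong> integer_group"
proof -
  have U: "U \<subseteq> topspace X"
    using assms(2) openin_subset by blast
  have cl: "closedin X (topspace X - U)" "closedin X {x}"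
    using assms U by (auto simp: closedin_Hausdorff_singleton)
  have "X closure_of (topspace X - U) \<subseteq> X interior_of (topspace X - {x})"
    using cl assms(3) U by (auto simp: closure_of_closedin interior_of_openin openin_diff)
  note exc = this
  have sets: "topspace X - (topspace X - U) = U" "topspace X - {x} - (topspace X - U) = U - {x}"
    using U by blast+
  from is_isoI[OF homology_excision_axiom[OF exc, of "topspace X" "int DIM('b)"]]
  have "relative_homology_group (int DIM('b)) (subtopology X U) (U - {x}) \<cong>
      relative_homology_group (int DIM('b)) X (topspace X - {x})"
    using U sets by simp
  moreover have "f ` (U - {x}) = UNIV - {f x}"
    using U assms(3) homeomorphic_imp_injective_map[OF f] homeomorphic_imp_surjective_map[OF f]
    by (simp add: inf.absorb2 inj_on_image_set_diff[of f U])
  then have "relative_homology_group (int DIM('b)) (subtopology X U) (U - {x}) \<cong>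
      relative_homology_group (int DIM('b)) euclidean (UNIV - {f x})"
    using U by (intro is_isoI[OF homeomorphic_map_relative_homology_iso[OF f]]) auto
  ultimately show ?thesis
    using local_homology_euclidean by (meson group.iso_sym group_relative_homology_group iso_trans)
qed

lemma local_homology_group_manifold:
  fixes A :: "('a, 'b::euclidean_space) chart set"
  assumes "closed_smooth_manifold X A" "x \<in> topspace X"
  shows "relative_homology_group (int DIM('b)) X (topspace X - {x}) \<cong> integer_group"
proof -
  obtain U \<phi> where U: "(U, \<phi>) \<in> A" "x \<in> U"
    using assms unfolding closed_smooth_manifold_def by force
  have charts: "\<forall>(U, \<phi>)\<in>A. openin X U \<and> open (\<phi> ` U) \<and> homeomorphic_map (subtopology X U) (top_of_set (\<phi> ` U)) \<phi>"
    and "Hausdorff_space X"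
    using assms(1) unfolding closed_smooth_manifold_def by simp_all
  have \<phi>: "openin X U" "open (\<phi> ` U)" "homeomorphic_map (subtopology X U) (top_of_set (\<phi> ` U)) \<phi>"
    using bspec[OF charts U(1)] by simp_all
  obtain e where e: "e > 0" "ball (\<phi> x) e \<subseteq> \<phi> ` U"
    using \<phi>(2) U(2) open_contains_ball by blast
  \<comment> \<open>The image of a chart is an arbitrary open set; the part lying over a ball is
    homeomorphic to the whole space.\<close>
  define V where "V = {p \<in> U. \<phi> p \<in> ball (\<phi> x) e}"
  have topU: "topspace (subtopology X U) = U"
    using \<phi>(1) openin_subset by auto
  have "openin (subtopology X U) V"
    using openin_continuous_map_preimage[OF homeomorphic_imp_continuous_map[OF \<phi>(3)], of "ball (\<phi> x) e"] e(2)
    unfolding topU V_def by (simp add: open_subset)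
  then have V: "openin X V"
    using \<phi>(1) openin_trans_full by blast
  have "\<phi> ` V = ball (\<phi> x) e"
    using e(2) unfolding V_def by blast
  moreover have "V \<subseteq> U"
    by (auto simp: V_def)
  ultimately have "homeomorphic_map (subtopology X V) (top_of_set (ball (\<phi> x) e)) \<phi>"
    using homeomorphic_map_subtopologies[OF \<phi>(3), of V "ball (\<phi> x) e"] e(2)
    using openin_subset[OF \<phi>(1)] by (simp add: subtopology_subtopology Int_absorb1 Int_absorb2)
  moreover obtain h where "homeomorphic_map (top_of_set (ball (\<phi> x) e)) (euclidean :: 'b topology) h"
    using homeomorphic_ball_UNIV[OF e(1), of "\<phi> x"] 
    by (metis homeomorphic_space_iff_homeomorphic homeomorphic_space homeomorphic_map_maps subtopology_UNIV)
  ultimately have h: "homeomorphic_map (subtopology X V) euclidean (h \<circ> \<phi>)"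
    by (rule homeomorphic_map_compose)
  have "x \<in> V"
    using U(2) e(1) by (simp add: V_def)
  show ?thesis
    by (rule local_homology_group[OF \<open>Hausdorff_space X\<close> V \<open>x \<in> V\<close> h])
qed

text \<open>The integers have no torsion, so for nonzero d the generator would be trivial, and with
  it the whole group.\<close>

lemma iso_integer_group_pow_eq_one:
  assumes "group G" "G \<cong> integer_group" "i \<in> carrier G" "generate G {i} = carrier G" "i [^]\<^bsub>G\<^esub> (d::int) = \<one>\<^bsub>G\<^esub>"
  shows "d = 0"
proof (rule ccontr)
  assume "d \<noteq> 0"
  interpret G: group G by fact
  obtain f where f: "f \<in> iso G integer_group"
    using assms(2) by (auto simp: is_iso_def)
  interpret f: group_hom G integer_group f
    using f by (simp add: group_hom_def group_hom_axioms_def iso_def assms(1))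
  have "d * f i = 0"
    using f.hom_int_pow[OF assms(3), of d] assms(5) f.hom_one by simp
  then have "f i = f \<one>\<^bsub>G\<^esub>"
    using \<open>d \<noteq> 0\<close> f.hom_one by simp
  then have "i = \<one>\<^bsub>G\<^esub>"
    using f assms(3) by (auto simp: iso_def bij_betw_def inj_on_def)
  then have "carrier G = {\<one>\<^bsub>G\<^esub>}"
    using assms(4) G.generate_one by simp
  then have "f ` carrier G = {0}"
    using f.hom_one by simp
  moreover have "f ` carrier G = UNIV"
    using f by (auto simp: iso_def bij_betw_def)
  ultimately have "(1::int) \<in> {0}"
    by blast
  then show False
    by simp
qed

text \<open>The degree is a definite description, so the substance is uniqueness: \<mu> = \<mu>^d
  must force d = 1, which is decided after restriction to one point.\<close>

lemma mapping_degree_id: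
  fixes A :: "('a, 'b::euclidean_space) chart set"
  assumes "closed_smooth_manifold X A" "fundamental_class DIM('b) X \<mu>" "topspace X \<noteq> {}"
  shows "mapping_degree DIM('b) X \<mu> X \<mu> id = 1"
proof -
  let ?H = "homology_group (int DIM('b)) X"
  obtain x where x: "x \<in> topspace X"
    using assms(3) by blast
  let ?G = "relative_homology_group (int DIM('b)) X (topspace X - {x})"
  let ?r = "hom_induced (int DIM('b)) X {} X (topspace X - {x}) id"
  have \<mu>: "\<mu> \<in> carrier ?H" and gen: "generate ?G {?r \<mu>} = carrier ?G"
    using assms(2) x unfolding fundamental_class_def by blast+
  interpret H: group ?H
    by simp
  interpret r: group_hom ?H ?G ?r
    by (simp add: group_hom_def group_hom_axioms_def hom_induced_hom)
  have "d = 1" if d: "\<mu> = \<mu> [^]\<^bsub>?H\<^esub> d" for d :: int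
  proof -
    have "\<mu> [^]\<^bsub>?H\<^esub> (d - 1) = \<one>\<^bsub>?H\<^esub>"
      using d \<mu> by (metis H.int_pow_1 H.int_pow_diff H.r_inv)
    then have "?r \<mu> [^]\<^bsub>?G\<^esub> (d - 1) = \<one>\<^bsub>?G\<^esub>"
      using r.hom_int_pow[OF \<mu>, of "d - 1"] r.hom_one by simp
    then have "d - 1 = 0"
      by (intro iso_integer_group_pow_eq_one[OF _ local_homology_group_manifold[OF assms(1) x] r.hom_closed[OF \<mu>] gen])
        simp_all
    then show ?thesis
      by simp
  qed
  moreover have "hom_induced (int DIM('b)) X {} X {} id \<mu> = \<mu>"
    using \<mu> by (rule hom_induced_id)
  ultimately show ?thesis
    unfolding mapping_degree_def using \<mu> by (intro the_equality) (simp_all add: H.int_pow_1)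
qed

section \<open>Calculus of \<open>C\<^sup>k\<close> maps\<close>

text \<open>On an open set agreement of functions passes to their derivatives, hence to the next
  order.\<close>

lemma Ck_on_cong:
  assumes "open S" "\<And>x. x \<in> S \<Longrightarrow> f x = g x" "Ck_on k f S"
  shows "Ck_on k g S"
  using assms
proof (induction k arbitrary: f g)
  case 0
  then show ?case
    by (simp cong: continuous_on_cong)
next
  case (Suc k)
  have diff: "f differentiable (at x)" if "x \<in> S" for x
    using Suc.prems(3) that by simp
  have "g differentiable (at x)" if x: "x \<in> S" for x
  proof -
    obtain D where "(f has_derivative D) (at x)"
      using diff[OF x] unfolding differentiable_def by blast
    then have "(g has_derivative D) (at x)"
      by (rule has_derivative_transform_within_open[OF _ Suc.prems(1) x]) (rule Suc.prems(2))
    then show ?thesis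
      unfolding differentiable_def by blast
  qed
  moreover have "Ck_on k (\<lambda>x. frechet_derivative g (at x) v) S" for v
  proof (rule Suc.IH[OF Suc.prems(1)])
    show "Ck_on k (\<lambda>x. frechet_derivative f (at x) v) S"
      using Suc.prems(3) by simp
    show "frechet_derivative f (at x) v = frechet_derivative g (at x) v" if "x \<in> S" for x
      using frechet_derivative_transform_within_open[OF diff[OF that] Suc.prems(1) that Suc.prems(2)] by simp
  qed
  ultimately show ?case
    by simp
qed

text \<open>Transition maps have an explicit formula only near each point, because the group element
  relating two charts is only locally constant.\<close>

lemma Ck_on_local:
  assumes "\<And>x. x \<in> S \<Longrightarrow> \<exists>T. open T \<and> x \<in> T \<and> Ck_on k f T"
  shows "Ck_on k f S"
  using assms
proof (induction k arbitrary: f)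
  case 0
  have "isCont f x" if x: "x \<in> S" for x
  proof -
    from 0[OF x] obtain T where "open T" "x \<in> T" "continuous_on T f"
      by auto
    then show ?thesis
      using continuous_on_eq_continuous_at by blast
  qed
  then show ?case
    by (simp add: continuous_at_imp_continuous_on)
next
  case (Suc k)
  have "f differentiable (at x)" if "x \<in> S" for x
    using Suc.prems[OF that] by auto
  moreover have "Ck_on k (\<lambda>x. frechet_derivative f (at x) v) S" for v
  proof (rule Suc.IH)
    fix x assume "x \<in> S"
    from Suc.prems[OF this] show "\<exists>T. open T \<and> x \<in> T \<and> Ck_on k (\<lambda>x. frechet_derivative f (at x) v) T"
      by auto
  qed
  ultimately show ?case
    by simp
qed

lemma Ck_on_Suc_imp: "Ck_on (Suc k) f S \<Longrightarrow> Ck_on k f S"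
proof (induction k arbitrary: f)
  case 0
  then show ?case
    by (simp add: continuous_at_imp_continuous_on differentiable_imp_continuous_within)
next
  case (Suc k)
  then show ?case
    by (metis Ck_on.simps(2))
qed

lemma Ck_on_const: "Ck_on k (\<lambda>x. c) S"
  by (induction k arbitrary: c) simp_all

lemma Ck_on_affine:
  assumes "open S" "bounded_linear A"
  shows "Ck_on k (\<lambda>x. A x + c) S"
proof (cases k)
  case 0
  then show ?thesis
    using assms(2) by (simp add: continuous_on_add linear_continuous_on)
next
  case (Suc m)
  have der: "((\<lambda>x. A x + c) has_derivative A) (at x)" for x
    using bounded_linear_imp_has_derivative[OF assms(2)] by (auto intro: has_derivative_add_const)
  have "(\<lambda>x. A x + c) differentiable (at x)" for x
    using der differentiable_def by blast
  moreover have "frechet_derivative (\<lambda>x. A x + c) (at x) v = A v" for x v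
    using frechet_derivative_at[OF der] by simp
  ultimately show ?thesis
    by (simp add: Suc Ck_on_const)
qed

lemma Ck_on_add:
  assumes "open S" "Ck_on k f S" "Ck_on k g S"
  shows "Ck_on k (\<lambda>x. f x + g x) S"
  using assms(2,3)
proof (induction k arbitrary: f g)
  case 0
  then show ?case
    by (simp add: continuous_on_add)
next
  case (Suc k)
  have d: "(f has_derivative frechet_derivative f (at x)) (at x)" "(g has_derivative frechet_derivative g (at x)) (at x)"
    if "x \<in> S" for x
    using Suc.prems that by (simp_all add: frechet_derivative_works)
  note sum = has_derivative_add[OF d]
  have "Ck_on k (\<lambda>x. frechet_derivative (\<lambda>x. f x + g x) (at x) v) S" for v
  proof (rule Ck_on_cong[OF assms(1)])
    show "Ck_on k (\<lambda>x. frechet_derivative f (at x) v + frechet_derivative g (at x) v) S"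
      using Suc.prems by (intro Suc.IH) simp_all
    show "frechet_derivative f (at x) v + frechet_derivative g (at x) v = frechet_derivative (\<lambda>x. f x + g x) (at x) v"
      if "x \<in> S" for x
      using frechet_derivative_at[OF sum[OF that that]] by (metis (no_types))
  qed
  moreover have "(\<lambda>x. f x + g x) differentiable (at x)" if "x \<in> S" for x
    using sum[OF that that] differentiable_def by blast
  ultimately show ?case
    by simp
qed

lemma Ck_on_scaleR:
  fixes f :: "'a::euclidean_space \<Rightarrow> real" and g :: "'a \<Rightarrow> 'b::euclidean_space"
  assumes "open S" "Ck_on k f S" "Ck_on k g S"
  shows "Ck_on k (\<lambda>x. f x *\<^sub>R g x) S"
  using assms(2,3)
proof (induction k arbitrary: f g)
  case 0
  then show ?case
    by (simp add: continuous_on_scaleR)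
next
  case (Suc k)
  have d: "(f has_derivative frechet_derivative f (at x)) (at x)" "(g has_derivative frechet_derivative g (at x)) (at x)"
    if "x \<in> S" for x
    using Suc.prems that by (simp_all add: frechet_derivative_works)
  note prod = has_derivative_scaleR[OF d]
  have "Ck_on k (\<lambda>x. frechet_derivative (\<lambda>x. f x *\<^sub>R g x) (at x) v) S" for v
  proof (rule Ck_on_cong[OF assms(1)])
    show "Ck_on k (\<lambda>x. f x *\<^sub>R frechet_derivative g (at x) v + frechet_derivative f (at x) v *\<^sub>R g x) S"
      using Suc.prems Ck_on_Suc_imp[OF Suc.prems(1)] Ck_on_Suc_imp[OF Suc.prems(2)]
      by (intro Ck_on_add[OF assms(1)] Suc.IH) simp_all
    show "f x *\<^sub>R frechet_derivative g (at x) v + frechet_derivative f (at x) v *\<^sub>R g x =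
        frechet_derivative (\<lambda>x. f x *\<^sub>R g x) (at x) v" if "x \<in> S" for x
      using fun_cong[OF frechet_derivative_at[OF prod[OF that that]], of v] .
  qed
  moreover have "(\<lambda>x. f x *\<^sub>R g x) differentiable (at x)" if "x \<in> S" for x
    using prod[OF that that] differentiable_def by blast
  ultimately show ?case
    by simp
qed

text \<open>The derivative of 1/f again contains 1/f, so the induction keeps f fixed and uses its
  own hypothesis one order lower.\<close>

lemma Ck_on_inverse:
  fixes f :: "'a::euclidean_space \<Rightarrow> real"
  assumes "open S" "Ck_on k f S" "\<And>x. x \<in> S \<Longrightarrow> f x \<noteq> 0"
  shows "Ck_on k (\<lambda>x. inverse (f x)) S"
  using assms(2)
proof (induction k)
  case 0
  then show ?case
    using assms(3) by (simp add: continuous_on_inverse)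
next
  case (Suc k)
  have d: "((\<lambda>x. inverse (f x)) has_derivative (\<lambda>v. - (inverse (f x) * frechet_derivative f (at x) v * inverse (f x)))) (at x)"
    if "x \<in> S" for x
    using Suc.prems that assms(3)[OF that]
    by (intro Deriv.has_derivative_inverse) (simp_all add: frechet_derivative_works)
  have "Ck_on k (\<lambda>x. frechet_derivative (\<lambda>x. inverse (f x)) (at x) v) S" for v
  proof (rule Ck_on_cong[OF assms(1)])
    have inv: "Ck_on k (\<lambda>x. inverse (f x)) S"
      using Suc.IH Ck_on_Suc_imp[OF Suc.prems] by blast
    show "Ck_on k (\<lambda>x. (-1) *\<^sub>R (inverse (f x) *\<^sub>R (frechet_derivative f (at x) v *\<^sub>R inverse (f x)))) S"
      using Suc.prems by (intro Ck_on_scaleR[OF assms(1)] Ck_on_const inv) simp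
    show "(-1) *\<^sub>R (inverse (f x) *\<^sub>R (frechet_derivative f (at x) v *\<^sub>R inverse (f x))) =
        frechet_derivative (\<lambda>x. inverse (f x)) (at x) v" if "x \<in> S" for x
      using fun_cong[OF frechet_derivative_at[OF d[OF that]], of v] by simp
  qed
  moreover have "(\<lambda>x. inverse (f x)) differentiable (at x)" if "x \<in> S" for x
    using d[OF that] differentiable_def by blast
  ultimately show ?case
    by simp
qed

section \<open>The charts of \<open>S\<^sup>7 / Q\<^sub>8\<close>\<close>

lemma homeomorphic_map_orbit:
  assumes "openin (top_of_set S7) W" "inj_on orbit W"
  shows "homeomorphic_map (top_of_set W) (subtopology S7Q8 (orbit ` W)) orbit"
proof (rule bijective_open_imp_homeomorphic_map)
  have W: "W \<subseteq> S7"
    using openin_imp_subset[OF assms(1)] .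
  show "continuous_map (top_of_set W) (subtopology S7Q8 (orbit ` W)) orbit"
    using continuous_map_from_subtopology[OF continuous_map_orbit, of W] W
    by (simp add: continuous_map_in_subtopology subtopology_subtopology Int_absorb1)
  show "open_map (top_of_set W) (subtopology S7Q8 (orbit ` W)) orbit"
    unfolding open_map_def
  proof (intro allI impI)
    fix V assume V: "openin (top_of_set W) V"
    then have "openin S7Q8 (orbit ` V)"
      using open_map_orbit openin_trans[OF V assms(1)] by (simp add: open_map_def)
    then show "openin (subtopology S7Q8 (orbit ` W)) (orbit ` V)"
      unfolding openin_subtopology using openin_imp_subset[OF V]
      by (intro exI[of _ "orbit ` V"]) (simp add: image_mono Int_absorb2)
  qed
  show "orbit ` topspace (top_of_set W) = topspace (subtopology S7Q8 (orbit ` W))"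
    using W by (simp add: topspace_S7Q8 image_mono Int_absorb1)
qed (use assms(2) in simp)

definition projective_coord :: "(quat \<times> quat \<Rightarrow> real ^ 7) \<Rightarrow> quat \<times> quat \<Rightarrow> quat \<times> quat \<Rightarrow> real ^ 7" where
  "projective_coord L u x = L x /\<^sub>R (u \<bullet> x)"

text \<open>Homogeneity of degree 0 makes normalisation to the sphere irrelevant, which gives
  transition maps without square roots.\<close>

lemma projective_coord_scale:
  "linear L \<Longrightarrow> r \<noteq> 0 \<Longrightarrow> projective_coord L u (r *\<^sub>R x) = projective_coord L u x"
  by (simp add: projective_coord_def linear_cmul)

locale sphere_chart =
  fixes W :: "(quat \<times> quat) set" and L :: "quat \<times> quat \<Rightarrow> real ^ 7" and u :: "quat \<times> quat"
  assumes W_open: "openin (top_of_set S7) W"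
    and W_inj: "inj_on orbit W"
    and pos: "x \<in> W \<Longrightarrow> u \<bullet> x > 0"
    and lin: "linear L"
    and inj: "inj (\<lambda>x. (L x, u \<bullet> x))"
begin

definition chart_map :: "(quat \<times> quat) set \<Rightarrow> real ^ 7" where
  "chart_map = (\<lambda>p. let x = inv_into W orbit p in L x /\<^sub>R (u \<bullet> x))"

definition lift :: "(real ^ 7) \<times> real \<Rightarrow> quat \<times> quat" where
  "lift = inv_into UNIV (\<lambda>x. (L x, u \<bullet> x))"

text \<open>Inverse central projection: y is placed on the affine hyperplane u . x = 1 and then
  moved radially to the sphere.\<close>

definition chart_inverse :: "real ^ 7 \<Rightarrow> quat \<times> quat" where
  "chart_inverse y = lift (y, 1) /\<^sub>R norm (lift (y, 1))"

lemma W_S7: "W \<subseteq> S7"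
  using openin_imp_subset[OF W_open] .

lemma bounded_linear_L: "bounded_linear L"
  using lin linear_conv_bounded_linear by blast

text \<open>Both sides have dimension 8.\<close>

lemma surj: "surj (\<lambda>x. (L x, u \<bullet> x))"
proof (rule linear_injective_imp_surjective)
  show "linear (\<lambda>x. (L x, u \<bullet> x))"
    using lin by (simp add: linear_iff inner_add_right)
qed (use inj in simp_all)

lemma lift_apply [simp]: "lift (L x, u \<bullet> x) = x"
  unfolding lift_def using inv_f_f[OF inj, of x] by simp

lemma lift_coords: "L (lift (y, t)) = y" "u \<bullet> lift (y, t) = t"
  using surj_f_inv_f[OF surj, of "(y, t)"] unfolding lift_def by simp_all

lemma linear_lift: "linear lift"
proof (rule linearI)
  fix a b :: "(real ^ 7) \<times> real" and r :: real
  have eq: "x = y" if "L x = L y" "u \<bullet> x = u \<bullet> y" for x y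
    using inj_onD[OF inj, of x y] that by simp
  show "lift (a + b) = lift a + lift b"
    by (cases a; cases b) (rule eq; simp add: lift_coords linear_add[OF lin] inner_add_right)
  show "lift (r *\<^sub>R a) = r *\<^sub>R lift a"
    by (cases a) (rule eq; simp add: lift_coords linear_cmul[OF lin])
qed

lemma bounded_linear_lift: "bounded_linear lift"
  using linear_lift linear_conv_bounded_linear by blast

lemma lift_nonzero: "lift (y, 1) \<noteq> 0"
  using lift_coords(2)[of y 1] by auto

lemma chart_inverse_S7: "chart_inverse y \<in> S7"
  using lift_nonzero[of y] by (simp add: chart_inverse_def S7_def)

lemma inner_chart_inverse: "u \<bullet> chart_inverse y = 1 / norm (lift (y, 1))"
  by (simp add: chart_inverse_def lift_coords divide_inverse)

lemma projective_coord_chart_inverse: "projective_coord L u (chart_inverse y) = y"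
  using lift_nonzero[of y]
  by (simp add: chart_inverse_def projective_coord_scale[OF lin]) (simp add: projective_coord_def lift_coords)

lemma chart_inverse_projective_coord:
  assumes "x \<in> S7" "u \<bullet> x > 0"
  shows "chart_inverse (projective_coord L u x) = x"
proof -
  have "lift (projective_coord L u x, 1) = lift ((1 / (u \<bullet> x)) *\<^sub>R (L x, u \<bullet> x))"
    using assms(2) by (simp add: projective_coord_def divide_inverse)
  also have "\<dots> = (1 / (u \<bullet> x)) *\<^sub>R x"
    by (simp only: linear_cmul[OF linear_lift] lift_apply)
  finally show ?thesis
    using assms by (simp add: chart_inverse_def S7_def)
qed

lemma continuous_on_chart_inverse: "continuous_on S chart_inverse"
  unfolding chart_inverse_def
  using lift_nonzero by (intro continuous_intros bounded_linear.continuous_on[OF bounded_linear_lift]) simp_all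

lemma continuous_on_projective_coord: "(\<And>x. x \<in> S \<Longrightarrow> u \<bullet> x \<noteq> 0) \<Longrightarrow> continuous_on S (projective_coord L u)"
  unfolding projective_coord_def
  by (intro continuous_intros bounded_linear.continuous_on[OF bounded_linear_L]) simp_all

text \<open>The chart image becomes a preimage under a continuous map defined on all of the model
  space, whence its openness.\<close>

lemma projective_coord_image: "projective_coord L u ` W = {y. chart_inverse y \<in> W}"
proof (intro equalityI subsetI)
  fix y assume "y \<in> projective_coord L u ` W"
  then obtain x where x: "x \<in> W" "y = projective_coord L u x"
    by (elim imageE)
  then have "chart_inverse y = x"
    using chart_inverse_projective_coord[of x] W_S7 pos by blast
  then show "y \<in> {y. chart_inverse y \<in> W}"
    using x(1) by simp
next
  fix y assume "y \<in> {y. chart_inverse y \<in> W}"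
  then show "y \<in> projective_coord L u ` W"
    using projective_coord_chart_inverse[of y] by (metis image_eqI mem_Collect_eq)
qed

lemma open_preimage_chart_inverse:
  assumes "openin (top_of_set S7) N"
  shows "open {y. chart_inverse y \<in> N}"
proof -
  have "continuous_map euclidean (top_of_set S7) chart_inverse"
    using continuous_on_chart_inverse chart_inverse_S7 by (simp add: continuous_map_in_subtopology image_subset_iff)
  from openin_continuous_map_preimage[OF this assms] show ?thesis
    by simp
qed

lemma homeomorphic_map_projective_coord:
  "homeomorphic_map (top_of_set W) (top_of_set (projective_coord L u ` W)) (projective_coord L u)"
proof -
  have "u \<bullet> x \<noteq> 0" if "x \<in> W" for x
    using pos[OF that] by simp
  then have "homeomorphic_maps (top_of_set W) (top_of_set (projective_coord L u ` W)) (projective_coord L u) chart_inverse"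
    unfolding homeomorphic_maps_def
    using continuous_on_projective_coord continuous_on_chart_inverse
    by (simp add: continuous_map_in_subtopology projective_coord_image projective_coord_chart_inverse
        chart_inverse_projective_coord pos W_S7[THEN subsetD] image_subset_iff)
  then show ?thesis
    using homeomorphic_map_maps by blast
qed

lemma chart_map_orbit: "x \<in> W \<Longrightarrow> chart_map (orbit x) = projective_coord L u x"
  by (simp add: chart_map_def projective_coord_def inv_into_f_f[OF W_inj])

lemma chart_map_image: "chart_map ` (orbit ` W) = projective_coord L u ` W"
  unfolding image_image by (rule image_cong) (simp_all add: chart_map_orbit)

lemma homeomorphic_map_chart:
  "homeomorphic_map (subtopology S7Q8 (orbit ` W)) (top_of_set (chart_map ` orbit ` W)) chart_map"
proof -
  obtain g where g: "homeomorphic_maps (top_of_set W) (subtopology S7Q8 (orbit ` W)) orbit g"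
    using homeomorphic_map_orbit[OF W_open W_inj] unfolding homeomorphic_map_maps by blast
  then have "homeomorphic_map (subtopology S7Q8 (orbit ` W)) (top_of_set W) g"
    using homeomorphic_maps_map by blast
  from homeomorphic_map_compose[OF this homeomorphic_map_projective_coord]
  have "homeomorphic_map (subtopology S7Q8 (orbit ` W)) (top_of_set (chart_map ` orbit ` W)) (projective_coord L u \<circ> g)"
    by (simp only: chart_map_image)
  then show ?thesis
  proof (rule homeomorphic_map_eq)
    fix p assume "p \<in> topspace (subtopology S7Q8 (orbit ` W))"
    then obtain x where "x \<in> W" "p = orbit x"
      by (auto elim!: imageE)
    then show "(projective_coord L u \<circ> g) p = chart_map p"
      using g by (simp add: homeomorphic_maps_def chart_map_orbit)
  qed
qed

lemma openin_chart: "openin S7Q8 (orbit ` W)"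
  using open_map_orbit W_open by (simp add: open_map_def)

lemma open_chart_image: "open (chart_map ` orbit ` W)"
  unfolding chart_map_image projective_coord_image by (rule open_preimage_chart_inverse[OF W_open])

lemma chart_map_inj: "inj_on chart_map (orbit ` W)"
  using homeomorphic_imp_injective_map[OF homeomorphic_map_chart] openin_subset[OF openin_chart]
  by (simp add: Int_absorb1)

end

lemma S7Q8_atlas_cases:
  assumes "c \<in> S7Q8_atlas"
  obtains W L u where "sphere_chart W L u" "fst c = orbit ` W" "snd c = sphere_chart.chart_map W L u"
proof -
  obtain W L u where W: "c = (orbit ` W, \<lambda>p. let x = inv_into W orbit p in L x /\<^sub>R (u \<bullet> x))"
    "openin (top_of_set S7) W" "inj_on orbit W" "\<forall>x\<in>W. u \<bullet> x > 0" "linear L" "inj (\<lambda>x. (L x, u \<bullet> x))"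
    using assms unfolding S7Q8_atlas_def by (elim CollectE exE conjE)
  then have "sphere_chart W L u"
    by (intro sphere_chart.intro) simp_all
  then show thesis
    using that W(1) by (simp add: sphere_chart.chart_map_def)
qed

lemma (in sphere_chart) chart_in_atlas: "(orbit ` W, chart_map) \<in> S7Q8_atlas"
  unfolding S7Q8_atlas_def chart_map_def
  using W_open W_inj pos lin inj by blast

text \<open>The hemisphere is centred at x, so u = x, and L is the orthogonal projection along x
  followed by an isometry from the hyperplane onto R^7.\<close>

lemma chart_around:
  assumes x: "x \<in> S7"
  obtains W L u where "sphere_chart W L u" "x \<in> W"
proof -
  obtain W where W: "openin (top_of_set S7) W" "x \<in> W" "inj_on orbit W" "\<And>z. z \<in> W \<Longrightarrow> x \<bullet> z > 0"
    using small_neighbourhood[OF x openin_subtopology_self x] by metis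
  have "x \<noteq> 0" and xx: "x \<bullet> x = 1"
    using x by (auto simp: S7_def dot_square_norm)
  then have dim: "dim {z. x \<bullet> z = 0} = dim (UNIV :: (real ^ 7) set)"
    by (simp add: dim_hyperplane)
  obtain f g where f: "linear f" "\<And>z. z \<in> {z. x \<bullet> z = 0} \<Longrightarrow> norm (f z :: real ^ 7) = norm z"
    using isometries_subspaces[OF subspace_hyperplane subspace_UNIV dim] by metis
  define L where "L z = f (z - (x \<bullet> z) *\<^sub>R x)" for z
  have lin: "linear L"
    by (rule linearI) (simp_all add: L_def inner_add_right algebra_simps linear_add[OF f(1), symmetric]
        linear_cmul[OF f(1), symmetric])
  have linp: "linear (\<lambda>z. (L z, x \<bullet> z))"
    using lin by (simp add: linear_iff inner_add_right)
  have "inj (\<lambda>z. (L z, x \<bullet> z))"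
    unfolding linear_injective_0[OF linp]
  proof (intro allI impI)
    fix z assume "(L z, x \<bullet> z) = 0"
    then have "L z = 0" "x \<bullet> z = 0"
      by (metis fst_conv fst_zero, metis snd_conv snd_zero)
    then have "f z = 0"
      by (simp add: L_def)
    then show "z = 0"
      using f(2)[of z] \<open>x \<bullet> z = 0\<close> by simp
  qed
  then have "sphere_chart W L x"
    using W lin by (intro sphere_chart.intro) simp_all
  then show thesis
    using that W(2) by blast
qed

lemma transition_locally:
  assumes c: "sphere_chart W L u" and c': "sphere_chart W' L' u'"
    and g: "g \<in> Q8" and y: "sphere_chart.chart_inverse L u y \<in> W" "act g (sphere_chart.chart_inverse L u y) \<in> W'"
  shows "transition (orbit ` W, sphere_chart.chart_map W L u) (orbit ` W', sphere_chart.chart_map W' L' u') y =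
    projective_coord L' u' (act g (sphere_chart.lift L u (y, 1)))"
proof -
  interpret c: sphere_chart W L u by fact
  interpret c': sphere_chart W' L' u' by fact
  have "c.chart_map (orbit (c.chart_inverse y)) = y"
    using c.chart_map_orbit[OF y(1)] c.projective_coord_chart_inverse by simp
  then have "inv_into (orbit ` W) c.chart_map y = orbit (c.chart_inverse y)"
    using inv_into_f_f[OF c.chart_map_inj, of "orbit (c.chart_inverse y)"] y(1) by simp
  then have "transition (orbit ` W, c.chart_map) (orbit ` W', c'.chart_map) y = c'.chart_map (orbit (act g (c.chart_inverse y)))"
    using g by (simp add: transition_def)
  also have "\<dots> = projective_coord L' u' (act g (c.chart_inverse y))"
    using c'.chart_map_orbit[OF y(2)] .
  also have "\<dots> = projective_coord L' u' (act g (c.lift (y, 1)))"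
    using c.lift_nonzero[of y]
    by (simp add: c.chart_inverse_def act.scaleR_right projective_coord_scale[OF c'.lin])
  finally show ?thesis .
qed

text \<open>On a neighbourhood T where one fixed g carries the first sheet into the second, the
  transition is fractional linear: y goes to L'(Ay + b) / (u' . (Ay + b)). The denominator is
  nonzero because u' is positive on W'.\<close>

lemma smooth_transition:
  assumes c: "sphere_chart W L u" and c': "sphere_chart W' L' u'"
  shows "smooth_on (transition (orbit ` W, sphere_chart.chart_map W L u) (orbit ` W', sphere_chart.chart_map W' L' u'))
    (sphere_chart.chart_map W L u ` (orbit ` W \<inter> orbit ` W'))"
proof -
  interpret c: sphere_chart W L u by fact
  interpret c': sphere_chart W' L' u' by fact
  let ?t = "transition (orbit ` W, c.chart_map) (orbit ` W', c'.chart_map)"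
  have "Ck_on k ?t (c.chart_map ` (orbit ` W \<inter> orbit ` W'))" for k
  proof (rule Ck_on_local)
    fix y assume "y \<in> c.chart_map ` (orbit ` W \<inter> orbit ` W')"
    then obtain x x' where x: "x \<in> W" "y = c.chart_map (orbit x)" "x' \<in> W'" "orbit x = orbit x'"
      by (elim imageE IntE) metis
    then obtain g where g: "g \<in> Q8" "x' = act g x"
      unfolding orbit_eq_iff by (elim bexE)
    have inv: "c.chart_inverse y = x"
      using c.chart_inverse_projective_coord[of x] c.chart_map_orbit[OF x(1)] c.pos[OF x(1)] c.W_S7 x(1,2) by auto
    define T where "T = {y. c.chart_inverse y \<in> W} \<inter> {y. c.chart_inverse y \<in> act (qconj g) ` W'}"
    have "open T"
      unfolding T_def
      by (intro open_Int c.open_preimage_chart_inverse c.W_open openin_act_image c'.W_open) (use g in simp)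
    have T: "c.chart_inverse y \<in> W" "act g (c.chart_inverse y) \<in> W'" if "y \<in> T" for y
      using that g(1) unfolding T_def by auto
    have "x = act (qconj g) x'"
      using g by simp
    then have "y \<in> T"
      using inv x(1,3) unfolding T_def by (metis Int_iff image_eqI mem_Collect_eq)
    define A where "A = (\<lambda>y. act g (c.lift (y, 0)))"
    define b where "b = act g (c.lift (0, 1))"
    have Ab: "act g (c.lift (y, 1)) = A y + b" for y
      unfolding A_def b_def by (simp flip: act.add_right linear_add[OF c.linear_lift])
    have A: "bounded_linear A"
      unfolding A_def
      by (intro bounded_linear_compose[OF act.bounded_linear_right] bounded_linear_compose[OF c.bounded_linear_lift]
          bounded_linear_Pair bounded_linear_ident bounded_linear_zero)
    have nz: "u' \<bullet> (A y + b) \<noteq> 0" if "y \<in> T" for y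
      using c'.pos[OF T(2)[OF that]] unfolding Ab[symmetric]
      by (auto simp: c.chart_inverse_def act.scaleR_right)
    have "bounded_linear (\<lambda>y. u' \<bullet> A y)" "bounded_linear (\<lambda>y. L' (A y))"
      using A c'.bounded_linear_L
      by (auto intro: bounded_linear_compose[OF bounded_linear_inner_right] bounded_linear_compose)
    then have "Ck_on k (\<lambda>y. inverse (u' \<bullet> A y + u' \<bullet> b) *\<^sub>R (L' (A y) + L' b)) T"
      using nz by (intro Ck_on_scaleR Ck_on_inverse Ck_on_affine \<open>open T\<close>) (simp_all add: inner_add_right)
    then have "Ck_on k ?t T"
    proof (rule Ck_on_cong[OF \<open>open T\<close>, rotated])
      fix y assume "y \<in> T"
      from transition_locally[OF c c' g(1) T[OF this]]
      show "inverse (u' \<bullet> A y + u' \<bullet> b) *\<^sub>R (L' (A y) + L' b) = ?t y"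
        by (simp add: Ab projective_coord_def inner_add_right linear_add[OF c'.lin])
    qed
    then show "\<exists>T. open T \<and> y \<in> T \<and> Ck_on k ?t T"
      using \<open>open T\<close> \<open>y \<in> T\<close> by blast
  qed
  then show ?thesis
    by (simp add: smooth_on_def)
qed

theorem closed_smooth_manifold_S7Q8: "closed_smooth_manifold S7Q8 S7Q8_atlas"
  unfolding closed_smooth_manifold_def
proof (intro conjI ballI compact_space_S7Q8 Hausdorff_space_S7Q8)
  fix c assume "c \<in> S7Q8_atlas"
  then obtain W L u where c: "sphere_chart W L u" "fst c = orbit ` W" "snd c = sphere_chart.chart_map W L u"
    by (rule S7Q8_atlas_cases)
  interpret sphere_chart W L u by fact
  have "c = (orbit ` W, chart_map)"
    using c(2,3) by (simp add: prod.expand)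
  then show "case c of (U, \<phi>) \<Rightarrow> openin S7Q8 U \<and> open (\<phi> ` U) \<and> homeomorphic_map (subtopology S7Q8 U) (top_of_set (\<phi> ` U)) \<phi>"
    using openin_chart open_chart_image homeomorphic_map_chart by simp
  fix c' assume "c' \<in> S7Q8_atlas"
  then obtain W' L' u' where c': "sphere_chart W' L' u'" "fst c' = orbit ` W'" "snd c' = sphere_chart.chart_map W' L' u'"
    by (rule S7Q8_atlas_cases)
  have "transition c c' = transition (orbit ` W, chart_map) (orbit ` W', sphere_chart.chart_map W' L' u')"
    unfolding transition_def c(2,3) c'(2,3) by simp
  then show "smooth_on (transition c c') (snd c ` (fst c \<inter> fst c'))"
    using smooth_transition[OF c(1) c'(1)] unfolding c(2,3) c'(2) by simp
next
  show "(\<Union>c\<in>S7Q8_atlas. fst c) = topspace S7Q8"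
  proof (intro equalityI subsetI)
    fix p assume "p \<in> (\<Union>c\<in>S7Q8_atlas. fst c)"
    then obtain c where c: "c \<in> S7Q8_atlas" "p \<in> fst c"
      by (elim UN_E)
    from c(1) obtain W L u where W: "sphere_chart W L u" "fst c = orbit ` W"
      by (rule S7Q8_atlas_cases)
    show "p \<in> topspace S7Q8"
      by (rule subsetD[OF openin_subset[OF sphere_chart.openin_chart[OF W(1)]]]) (use c(2) W(2) in simp)
  next
    fix p assume "p \<in> topspace S7Q8"
    then obtain x where x: "x \<in> S7" "p = orbit x"
      unfolding topspace_S7Q8 by (elim imageE)
    obtain W L u where W: "sphere_chart W L u" "x \<in> W"
      using chart_around[OF x(1)] .
    show "p \<in> (\<Union>c\<in>S7Q8_atlas. fst c)"
      by (rule UN_I[OF sphere_chart.chart_in_atlas[OF W(1)]]) (simp add: x(2) W(2))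
  qed
qed

section \<open>The tangent bundle of \<open>S\<^sup>7 / Q\<^sub>8\<close>\<close>

definition dproj :: "(quat \<times> quat \<Rightarrow> real ^ 7) \<Rightarrow> quat \<times> quat \<Rightarrow> quat \<times> quat \<Rightarrow> quat \<times> quat \<Rightarrow> real ^ 7" where
  "dproj L u x w = L w /\<^sub>R (u \<bullet> x) - ((u \<bullet> w) / (u \<bullet> x)\<^sup>2) *\<^sub>R L x"

lemma has_derivative_projective_coord:
  assumes "linear L" "u \<bullet> x \<noteq> 0"
  shows "(projective_coord L u has_derivative dproj L u x) (at x)"
proof -
  have L: "(L has_derivative L) (at x)"
    using assms(1) by (simp add: linear_conv_bounded_linear bounded_linear_imp_has_derivative)
  have "((\<lambda>x. inverse (u \<bullet> x)) has_derivative (\<lambda>w. - (inverse (u \<bullet> x) * (u \<bullet> w) * inverse (u \<bullet> x)))) (at x)"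
    using assms(2) by (intro Deriv.has_derivative_inverse has_derivative_inner_right has_derivative_ident)
  from has_derivative_scaleR[OF this L]
  have "((\<lambda>x. inverse (u \<bullet> x) *\<^sub>R L x) has_derivative
      (\<lambda>w. inverse (u \<bullet> x) *\<^sub>R L w + - (inverse (u \<bullet> x) * (u \<bullet> w) * inverse (u \<bullet> x)) *\<^sub>R L x)) (at x)" .
  moreover have "inverse (u \<bullet> x) *\<^sub>R L w + - (inverse (u \<bullet> x) * (u \<bullet> w) * inverse (u \<bullet> x)) *\<^sub>R L x = dproj L u x w" for w
    by (simp add: dproj_def power2_eq_square divide_inverse mult_ac)
  ultimately show ?thesis
    by (simp add: projective_coord_def[abs_def])
qed

lemma dproj_linear:
  assumes "linear L"
  shows "dproj L u x (v + w) = dproj L u x v + dproj L u x w"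
    "dproj L u x (v - w) = dproj L u x v - dproj L u x w"
    "dproj L u x (r *\<^sub>R w) = r *\<^sub>R dproj L u x w"
  by (simp_all add: dproj_def linear_add[OF assms] linear_diff[OF assms] linear_cmul[OF assms]
      inner_add_right inner_diff_right add_divide_distrib diff_divide_distrib algebra_simps)

text \<open>Euler's relation in degree 0: radial components of vectors are invisible to the
  chart.\<close>

lemma dproj_self: "u \<bullet> x \<noteq> 0 \<Longrightarrow> dproj L u x x = 0"
  by (simp add: dproj_def power2_eq_square divide_inverse)

text \<open>The chart pulled back to an open cone of the ambient space, constant on rays. It has an
  ordinary Frechet derivative, so tangent coordinates can be defined for every representative x,
  without first moving x into the sheet of the chart.\<close>

definition cone_chart :: "((quat \<times> quat) set, real ^ 7) chart \<Rightarrow> quat \<times> quat \<Rightarrow> real ^ 7" where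
  "cone_chart c z = snd c (orbit (z /\<^sub>R norm z))"

definition tangent_coord :: "((quat \<times> quat) set, real ^ 7) chart \<Rightarrow> quat \<times> quat \<Rightarrow> quat \<times> quat \<Rightarrow> real ^ 7" where
  "tangent_coord c x w = frechet_derivative (cone_chart c) (at x) w"

lemma open_cone:
  assumes "openin (top_of_set S7) N"
  shows "open {z. z \<noteq> 0 \<and> z /\<^sub>R norm z \<in> N}"
proof -
  have "continuous_map (top_of_set (- {0})) (top_of_set S7) (\<lambda>z :: quat \<times> quat. z /\<^sub>R norm z)"
    by (auto simp: continuous_map_in_subtopology S7_def intro!: continuous_intros)
  from openin_continuous_map_preimage[OF this assms]
  have "openin (top_of_set (- {0})) {z \<in> - {0}. z /\<^sub>R norm z \<in> N}"
    by simp
  then have "open {z \<in> - {0}. z /\<^sub>R norm z \<in> N}"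
    by (rule openin_open_trans) (rule open_Compl, rule closed_singleton)
  then show ?thesis
    by simp
qed

lemma openin_act_preimage:
  assumes "h \<in> Q8" "openin (top_of_set S7) W"
  shows "openin (top_of_set S7) {z \<in> S7. act h z \<in> W}"
proof -
  have "continuous_map (top_of_set S7) (top_of_set S7) (act h)"
    using assms(1) by (auto intro: continuous_on_act)
  from openin_continuous_map_preimage[OF this assms(2)] show ?thesis
    by simp
qed

lemma norm_S7_element: "x \<in> S7 \<Longrightarrow> norm x = 1"
  by (simp add: S7_def)

lemma S7_nonzero: "x \<in> S7 \<Longrightarrow> x \<noteq> 0"
  using norm_S7_element norm_zero zero_neq_one by metis

context sphere_chart
begin

abbreviation "chart \<equiv> (orbit ` W, chart_map)"

lemma chart_member:
  assumes "orbit x \<in> orbit ` W"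
  obtains h where "h \<in> Q8" "act h x \<in> W"
proof -
  obtain z where "z \<in> W" "orbit x = orbit z"
    using assms by (elim imageE)
  then show thesis
    using that unfolding orbit_eq_iff by blast
qed

lemma cone_chart_apply:
  assumes "h \<in> Q8" "x \<in> S7" "act h x \<in> W"
  shows "cone_chart chart x = projective_coord L u (act h x)" "snd chart (orbit x) = projective_coord L u (act h x)"
  using assms chart_map_orbit[OF assms(3)] by (simp_all add: cone_chart_def norm_S7_element)

text \<open>Near x a fixed h moves the normalised points into W, and the normalisation disappears by
  homogeneity.\<close>

lemma cone_chart_derivative:
  assumes h: "h \<in> Q8" and x: "x \<in> S7" "act h x \<in> W"
  shows "(cone_chart chart has_derivative (\<lambda>w. dproj L u (act h x) (act h w))) (at x)"
proof -
  let ?N = "{z. z \<noteq> 0 \<and> z /\<^sub>R norm z \<in> {z \<in> S7. act h z \<in> W}}"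
  have "u \<bullet> act h x \<noteq> 0"
    using pos[OF x(2)] by simp
  have "(act h has_derivative act h) (at x)"
    by (intro bounded_linear_imp_has_derivative act.bounded_linear_right)
  from has_derivative_compose[OF this has_derivative_projective_coord[OF lin \<open>u \<bullet> act h x \<noteq> 0\<close>]]
  have "((\<lambda>z. projective_coord L u (act h z)) has_derivative (\<lambda>w. dproj L u (act h x) (act h w))) (at x)" .
  then show ?thesis
  proof (rule has_derivative_transform_within_open)
    show "open ?N"
      by (rule open_cone[OF openin_act_preimage[OF h W_open]])
    show "x \<in> ?N"
      using x S7_nonzero[OF x(1)] by (simp add: norm_S7_element)
    fix z assume "z \<in> ?N"
    then have z: "z \<noteq> 0" "act h (z /\<^sub>R norm z) \<in> W"
      by blast+
    then show "projective_coord L u (act h z) = cone_chart chart z"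
      using h chart_map_orbit[OF z(2)] orbit_act[OF h, of "z /\<^sub>R norm z"] projective_coord_scale[OF lin, of "inverse (norm z)" u "act h z"]
      by (simp add: cone_chart_def act.scaleR_right)
  qed
qed

lemma tangent_coord_apply:
  assumes "h \<in> Q8" "x \<in> S7" "act h x \<in> W"
  shows "tangent_coord chart x w = dproj L u (act h x) (act h w)"
  using fun_cong[OF frechet_derivative_at[OF cone_chart_derivative[OF assms]], of w]
  unfolding tangent_coord_def by simp

text \<open>The derivative of the chart takes \<open>lift (v, 0)\<close> to v divided by u . x.
  Multiplication by u . x repairs this, and the orthogonal projection makes the vector tangent
  without changing its image.\<close>

definition dchart_inverse :: "real ^ 7 \<Rightarrow> real ^ 7 \<Rightarrow> quat \<times> quat" where
  "dchart_inverse y v = (u \<bullet> chart_inverse y) *\<^sub>R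
     (lift (v, 0) - (chart_inverse y \<bullet> lift (v, 0)) *\<^sub>R chart_inverse y)"

lemma dchart_inverse_tangent: "chart_inverse y \<bullet> dchart_inverse y v = 0"
  using chart_inverse_S7[of y]
  by (simp add: dchart_inverse_def inner_diff_right dot_square_norm norm_S7_element)

lemma dproj_dchart_inverse: "dproj L u (chart_inverse y) (dchart_inverse y v) = v"
proof -
  have nz: "u \<bullet> chart_inverse y \<noteq> 0"
    using lift_nonzero[of y] by (simp add: inner_chart_inverse)
  have "dproj L u (chart_inverse y) (lift (v, 0)) = v /\<^sub>R (u \<bullet> chart_inverse y)"
    by (simp add: dproj_def lift_coords)
  then show ?thesis
    using nz by (simp add: dchart_inverse_def dproj_linear[OF lin] dproj_self)
qed

lemma dchart_inverse_dproj:
  assumes "x \<in> S7" "u \<bullet> x > 0" "x \<bullet> w = 0"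
  shows "dchart_inverse (projective_coord L u x) (dproj L u x w) = w"
proof -
  \<comment> \<open>The height coordinate of this combination of w and x vanishes, so the
    combination is the lift of its image with last coordinate 0.\<close>
  have "(1 / (u \<bullet> x)) * (u \<bullet> w) - ((u \<bullet> w) / (u \<bullet> x)\<^sup>2) * (u \<bullet> x) = 0"
    using assms(2) by (simp add: power2_eq_square)
  then have "lift (dproj L u x w, 0) = lift ((1 / (u \<bullet> x)) *\<^sub>R (L w, u \<bullet> w) - ((u \<bullet> w) / (u \<bullet> x)\<^sup>2) *\<^sub>R (L x, u \<bullet> x))"
    by (simp add: dproj_def inverse_eq_divide)
  also have "\<dots> = (1 / (u \<bullet> x)) *\<^sub>R w - ((u \<bullet> w) / (u \<bullet> x)\<^sup>2) *\<^sub>R x"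
    by (simp only: linear_cmul[OF linear_lift] linear_diff[OF linear_lift] lift_apply)
  finally have l: "lift (dproj L u x w, 0) = (1 / (u \<bullet> x)) *\<^sub>R w - ((u \<bullet> w) / (u \<bullet> x)\<^sup>2) *\<^sub>R x" .
  have "x \<bullet> lift (dproj L u x w, 0) = - ((u \<bullet> w) / (u \<bullet> x)\<^sup>2)"
    using assms(1,3) by (simp add: l inner_diff_right dot_square_norm norm_S7_element)
  then show ?thesis
    using assms(2) by (simp add: dchart_inverse_def chart_inverse_projective_coord[OF assms(1,2)] l)
qed

lemma continuous_on_dchart_inverse: "continuous_on S (\<lambda>p. dchart_inverse (fst p) (snd p))"
proof -
  have ci: "continuous_on S (\<lambda>p. chart_inverse (fst p))"
    by (rule continuous_on_compose2[OF continuous_on_chart_inverse[of UNIV] continuous_on_fst[OF continuous_on_id]]) simp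
  have "continuous_on S (\<lambda>p. lift (snd p, 0))"
    by (intro bounded_linear.continuous_on[OF bounded_linear_lift] continuous_intros)
  then show ?thesis
    unfolding dchart_inverse_def by (intro continuous_intros ci)
qed

lemma continuous_on_dproj_act:
  assumes "\<And>p. p \<in> S \<Longrightarrow> act h (fst p) \<in> W"
  shows "continuous_on S (\<lambda>p. (projective_coord L u (act h (fst p)), dproj L u (act h (fst p)) (act h (snd p))))"
proof -
  have "u \<bullet> act h (fst p) \<noteq> 0" if "p \<in> S" for p
    using pos[OF assms[OF that]] by simp
  then show ?thesis
    unfolding dproj_def projective_coord_def
    by (intro continuous_intros bounded_linear.continuous_on[OF bounded_linear_L] act.continuous_on) simp_all
qed

end

lemma S7Q8_atlas_chart:
  assumes "c \<in> S7Q8_atlas"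
  obtains W L u where "sphere_chart W L u" "c = (orbit ` W, sphere_chart.chart_map W L u)"
  using S7Q8_atlas_cases[OF assms] by (metis prod.collapse)

definition tangent_vector :: "(quat \<times> quat) \<times> (quat \<times> quat) \<Rightarrow>
    (quat \<times> quat) set \<times> (((quat \<times> quat) set, real ^ 7) chart \<Rightarrow> real ^ 7)" where
  "tangent_vector = (\<lambda>(x, w). (orbit x, \<lambda>c. if c \<in> S7Q8_atlas \<and> orbit x \<in> fst c then tangent_coord c x w else 0))"

definition sphere_tangent :: "((quat \<times> quat) \<times> (quat \<times> quat)) set" where
  "sphere_tangent = {(x, w). x \<in> S7 \<and> x \<bullet> w = 0}"

text \<open>If h moves x into the sheet, then h conj(g) moves gx to the same point, and likewise for
  the vectors.\<close>

lemma tangent_coord_act: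
  assumes "c \<in> S7Q8_atlas" "x \<in> S7" "orbit x \<in> fst c" "g \<in> Q8"
  shows "tangent_coord c (act g x) (act g w) = tangent_coord c x w"
proof -
  obtain W L u where W: "sphere_chart W L u" "c = (orbit ` W, sphere_chart.chart_map W L u)"
    using S7Q8_atlas_chart[OF assms(1)] .
  interpret sphere_chart W L u by fact
  obtain h where h: "h \<in> Q8" "act h x \<in> W"
    using chart_member[of x] assms(3) W(2) by auto
  have *: "act (qmult h (qconj g)) (act g z) = act h z" for z
    using assms(4) by (simp add: act_act qmult_assoc)
  show ?thesis
    unfolding W(2)
    using tangent_coord_apply[OF h(1) assms(2) h(2)]
      tangent_coord_apply[of "qmult h (qconj g)" "act g x" "act g w"] h assms(2,4) by (simp add: *)
qed

text \<open>The chain rule, applied to the identity that near x the cone chart of c' is the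
  transition map after the cone chart of c.\<close>

lemma tangent_coord_transition:
  assumes c: "c \<in> S7Q8_atlas" and c': "c' \<in> S7Q8_atlas" and x: "x \<in> S7" "orbit x \<in> fst c" "orbit x \<in> fst c'"
  shows "tangent_coord c' x w = frechet_derivative (transition c c') (at (snd c (orbit x))) (tangent_coord c x w)"
proof -
  obtain W L u where W: "sphere_chart W L u" "c = (orbit ` W, sphere_chart.chart_map W L u)"
    using S7Q8_atlas_chart[OF c] .
  interpret c: sphere_chart W L u by fact
  obtain h where h: "h \<in> Q8" "act h x \<in> W"
    using c.chart_member[of x] x(2) W(2) by auto
  obtain W' L' u' where W': "sphere_chart W' L' u'" "c' = (orbit ` W', sphere_chart.chart_map W' L' u')"
    using S7Q8_atlas_chart[OF c'] .
  interpret c': sphere_chart W' L' u' by fact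
  obtain h' where h': "h' \<in> Q8" "act h' x \<in> W'"
    using c'.chart_member[of x] x(3) W'(2) by auto
  have base: "cone_chart c x = snd c (orbit x)"
    using x(1) by (simp add: cone_chart_def norm_S7_element)
  have "smooth_on (transition c c') (snd c ` (fst c \<inter> fst c'))"
    using smooth_transition[OF W(1) W'(1)] by (simp add: W(2) W'(2))
  then have "Ck_on (Suc 0) (transition c c') (snd c ` (fst c \<inter> fst c'))"
    by (simp add: smooth_on_def)
  then have "transition c c' differentiable (at (cone_chart c x))"
    using x by (simp add: base)
  then have T: "(transition c c' has_derivative frechet_derivative (transition c c') (at (cone_chart c x))) (at (cone_chart c x))"
    by (simp add: frechet_derivative_works)
  have d: "(cone_chart c has_derivative tangent_coord c x) (at x)"
  proof -
    have "tangent_coord c x = (\<lambda>w. dproj L u (act h x) (act h w))"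
      unfolding W(2) by (rule ext) (rule c.tangent_coord_apply[OF h(1) x(1) h(2)])
    then show ?thesis
      using c.cone_chart_derivative[OF h(1) x(1) h(2)] by (simp add: W(2))
  qed
  have "((\<lambda>z. transition c c' (cone_chart c z)) has_derivative
      (\<lambda>w. frechet_derivative (transition c c') (at (cone_chart c x)) (tangent_coord c x w))) (at x)"
    by (rule has_derivative_compose[OF d T])
  then have "(cone_chart c' has_derivative
      (\<lambda>w. frechet_derivative (transition c c') (at (cone_chart c x)) (tangent_coord c x w))) (at x)"
  proof (rule has_derivative_transform_within_open)
    let ?N = "{z. z \<noteq> 0 \<and> z /\<^sub>R norm z \<in> {z \<in> S7. act h z \<in> W} \<inter> {z \<in> S7. act h' z \<in> W'}}"
    show "open ?N"
      by (intro open_cone openin_Int openin_act_preimage h(1) h'(1) c.W_open c'.W_open)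
    show "x \<in> ?N"
      using x(1) S7_nonzero[OF x(1)] h(2) h'(2) by (simp add: norm_S7_element)
    fix z assume "z \<in> ?N"
    then have z: "act h (z /\<^sub>R norm z) \<in> W" "act h' (z /\<^sub>R norm z) \<in> W'"
      by blast+
    have "orbit (z /\<^sub>R norm z) \<in> fst c"
      using orbit_act[OF h(1), of "z /\<^sub>R norm z"] z(1) unfolding W(2) by (metis fst_conv image_eqI)
    then have "inv_into (fst c) (snd c) (snd c (orbit (z /\<^sub>R norm z))) = orbit (z /\<^sub>R norm z)"
      using c.chart_map_inj unfolding W(2) by (intro inv_into_f_f) simp_all
    then show "transition c c' (cone_chart c z) = cone_chart c' z"
      by (simp add: transition_def cone_chart_def)
  qed
  from fun_cong[OF frechet_derivative_at[OF this], of w] show ?thesis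
    by (simp add: tangent_coord_def[of c'] base)
qed

text \<open>One coordinate vector determines all others through the transition derivatives.\<close>

lemma tangent_vectors_eqI:
  assumes "(p, s) \<in> tangent_vectors S7Q8 S7Q8_atlas" "(p, t) \<in> tangent_vectors S7Q8 S7Q8_atlas"
    and c: "c \<in> S7Q8_atlas" "p \<in> fst c" "s c = t c"
  shows "s = t"
proof
  fix c'
  have zero: "s c' = 0 \<and> t c' = 0" if "c' \<notin> S7Q8_atlas \<or> p \<notin> fst c'"
    using assms(1,2) that unfolding tangent_vectors_def by blast
  have "s c' = frechet_derivative (transition c c') (at (snd c p)) (s c)"
    "t c' = frechet_derivative (transition c c') (at (snd c p)) (t c)" if "c' \<in> S7Q8_atlas" "p \<in> fst c'"
    using assms(1,2) that c unfolding tangent_vectors_def by blast+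
  then show "s c' = t c'"
    using zero c(3) by metis
qed

lemma tangent_vector_in:
  assumes "(x, w) \<in> sphere_tangent"
  shows "tangent_vector (x, w) \<in> tangent_vectors S7Q8 S7Q8_atlas"
proof -
  have "x \<in> S7"
    using assms by (simp add: sphere_tangent_def)
  define t where "t c = (if c \<in> S7Q8_atlas \<and> orbit x \<in> fst c then tangent_coord c x w else 0)" for c
  have t: "tangent_vector (x, w) = (orbit x, t)"
    by (simp add: tangent_vector_def t_def[abs_def])
  have "orbit x \<in> topspace S7Q8"
    using \<open>x \<in> S7\<close> by (simp add: topspace_S7Q8)
  moreover have "t c = 0" if "c \<notin> S7Q8_atlas \<or> orbit x \<notin> fst c" for c
    using that by (auto simp: t_def)
  moreover have "t c' = frechet_derivative (transition c c') (at (snd c (orbit x))) (t c)"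
    if "c \<in> S7Q8_atlas" "c' \<in> S7Q8_atlas" "orbit x \<in> fst c \<inter> fst c'" for c c'
    using tangent_coord_transition[OF that(1,2) \<open>x \<in> S7\<close>] that by (simp add: t_def)
  ultimately show ?thesis
    unfolding t tangent_vectors_def mem_Collect_eq prod.case by (intro conjI allI ballI impI)
qed

definition tangent_basis_set :: "((quat \<times> quat) set, real ^ 7) chart \<Rightarrow> ((real ^ 7) \<times> (real ^ 7)) set \<Rightarrow>
    ((quat \<times> quat) set \<times> (((quat \<times> quat) set, real ^ 7) chart \<Rightarrow> real ^ 7)) set" where
  "tangent_basis_set c Z = {(x, v). (x, v) \<in> tangent_vectors S7Q8 S7Q8_atlas \<and> x \<in> fst c \<and> (snd c x, v c) \<in> Z}"

lemma bun_total_tangent_bundle: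
  "bun_total (tangent_bundle S7Q8 S7Q8_atlas) =
     topology_generated_by {tangent_basis_set c Z | c Z. c \<in> S7Q8_atlas \<and> open Z}"
  by (simp add: tangent_bundle_def tangent_basis_set_def)

lemma topspace_tangent_bundle:
  "topspace (bun_total (tangent_bundle S7Q8 S7Q8_atlas)) = tangent_vectors S7Q8 S7Q8_atlas"
proof (intro equalityI subsetI)
  fix z assume "z \<in> topspace (bun_total (tangent_bundle S7Q8 S7Q8_atlas))"
  then show "z \<in> tangent_vectors S7Q8 S7Q8_atlas"
    unfolding bun_total_tangent_bundle topology_generated_by_topspace tangent_basis_set_def by blast
next
  fix z assume z: "z \<in> tangent_vectors S7Q8 S7Q8_atlas"
  then have "fst z \<in> topspace S7Q8"
    unfolding tangent_vectors_def by auto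
  then obtain x where x: "x \<in> S7" "fst z = orbit x"
    unfolding topspace_S7Q8 by (elim imageE)
  obtain W L u where W: "sphere_chart W L u" "x \<in> W"
    using chart_around[OF x(1)] .
  have "z \<in> tangent_basis_set (orbit ` W, sphere_chart.chart_map W L u) UNIV"
    using z x(2) W(2) by (cases z) (simp add: tangent_basis_set_def)
  then show "z \<in> topspace (bun_total (tangent_bundle S7Q8 S7Q8_atlas))"
    unfolding bun_total_tangent_bundle topology_generated_by_topspace
    using sphere_chart.chart_in_atlas[OF W(1)] open_UNIV by blast
qed

text \<open>Both the openness of the quotient map and its surjectivity come from this local inverse.\<close>

lemma (in sphere_chart) tangent_vector_dchart_inverse:
  assumes "(p, t) \<in> tangent_vectors S7Q8 S7Q8_atlas" "p \<in> orbit ` W"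
  shows "(chart_inverse (chart_map p), dchart_inverse (chart_map p) (t chart)) \<in> sphere_tangent"
    and "tangent_vector (chart_inverse (chart_map p), dchart_inverse (chart_map p) (t chart)) = (p, t)"
proof -
  let ?y = "chart_map p"
  let ?x = "chart_inverse ?y" and ?w = "dchart_inverse ?y (t chart)"
  obtain x where x: "x \<in> W" "p = orbit x"
    using assms(2) by (elim imageE)
  have y: "?y = projective_coord L u x"
    using chart_map_orbit[OF x(1)] x(2) by simp
  have xx: "?x = x"
    unfolding y using x(1) W_S7 pos by (intro chart_inverse_projective_coord) blast+
  show D: "(?x, ?w) \<in> sphere_tangent"
    by (simp add: sphere_tangent_def chart_inverse_S7 dchart_inverse_tangent)
  obtain s where s: "tangent_vector (?x, ?w) = (p, s)"
    using xx x(2) by (simp add: tangent_vector_def)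
  have "s chart = tangent_coord chart ?x ?w"
    using s chart_in_atlas x xx by (auto simp: tangent_vector_def)
  also have "\<dots> = t chart"
    using tangent_coord_apply[OF q1_in_Q8 chart_inverse_S7, of ?y ?w] xx x(1) dproj_dchart_inverse[of ?y "t chart"]
    by simp
  finally have "s = t"
    using tangent_vectors_eqI[OF _ assms(1) chart_in_atlas] tangent_vector_in[OF D] s assms(2) by simp
  then show "tangent_vector (?x, ?w) = (p, t)"
    using s by simp
qed

lemma bundle_model_tangent:
  "bundle_model (tangent_bundle S7Q8 S7Q8_atlas) act sphere_tangent tangent_vector"
proof
  let ?T = "tangent_bundle S7Q8 S7Q8_atlas"
  show "bun_base ?T = S7Q8"
    by (simp add: tangent_bundle_def)
  show "sphere_tangent \<subseteq> S7 \<times> UNIV"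
    unfolding sphere_tangent_def by blast
  show "continuous_map (top_of_set sphere_tangent) (bun_total ?T) tangent_vector"
    unfolding bun_total_tangent_bundle
  proof (rule continuous_on_generated_topo)
    show "tangent_vector ` topspace (top_of_set sphere_tangent) \<subseteq>
        \<Union> {tangent_basis_set c Z |c Z. c \<in> S7Q8_atlas \<and> open Z}"
      using tangent_vector_in topspace_tangent_bundle
      unfolding bun_total_tangent_bundle topology_generated_by_topspace by fastforce
    fix U assume "U \<in> {tangent_basis_set c Z |c Z. c \<in> S7Q8_atlas \<and> open Z}"
    then obtain c Z where U: "U = tangent_basis_set c Z" "c \<in> S7Q8_atlas" "open Z"
      by blast
    obtain W L u where W: "sphere_chart W L u" "c = (orbit ` W, sphere_chart.chart_map W L u)"
      using S7Q8_atlas_chart[OF U(2)] .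
    interpret sphere_chart W L u by fact
    show "openin (top_of_set sphere_tangent) (tangent_vector -` U \<inter> topspace (top_of_set sphere_tangent))"
    proof (subst openin_subopen, intro ballI)
      fix z assume z: "z \<in> tangent_vector -` U \<inter> topspace (top_of_set sphere_tangent)"
      obtain x w where xw: "z = (x, w)"
        by (cases z)
      have x: "x \<in> S7" "orbit x \<in> orbit ` W"
        using z by (simp_all add: xw sphere_tangent_def U(1) tangent_basis_set_def tangent_vector_def W(2))
      obtain h where h: "h \<in> Q8" "act h x \<in> W"
        using chart_member[OF x(2)] .
      define N where "N = sphere_tangent \<inter> {z \<in> S7. act h z \<in> W} \<times> UNIV"
      \<comment> \<open>Position and tangent vector in the chart: on N the preimage of a basic open
        set is the preimage of Z under this continuous map.\<close>
      define \<theta> where "\<theta> p = (projective_coord L u (act h (fst p)), dproj L u (act h (fst p)) (act h (snd p)))" for p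
      have N: "openin (top_of_set sphere_tangent) N"
        unfolding N_def using openin_act_preimage[OF h(1) W_open] open_UNIV \<open>sphere_tangent \<subseteq> S7 \<times> UNIV\<close>
        by (rule openin_Times_subset)
      have "continuous_on N \<theta>"
        unfolding \<theta>_def[abs_def] by (rule continuous_on_dproj_act) (auto simp: N_def)
      then have "openin (top_of_set N) (N \<inter> \<theta> -` Z)"
        using U(3) by (rule continuous_openin_preimage_gen)
      then have "openin (top_of_set sphere_tangent) (N \<inter> \<theta> -` Z)"
        using N by (rule openin_trans)
      moreover have eq: "p \<in> tangent_vector -` U \<longleftrightarrow> \<theta> p \<in> Z" if "p \<in> N" for p
      proof -
        have p: "fst p \<in> S7" "act h (fst p) \<in> W" "(fst p, snd p) \<in> sphere_tangent"
          using that by (simp_all add: N_def mem_Times_iff)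
        have "orbit (fst p) \<in> orbit ` W"
          using p(2) orbit_act[OF h(1), of "fst p"] by (metis image_eqI)
        moreover have "tangent_vector (fst p, snd p) = (orbit (fst p), snd (tangent_vector (fst p, snd p)))"
          by (cases p) (simp add: tangent_vector_def)
        ultimately have "p \<in> tangent_vector -` U \<longleftrightarrow> (chart_map (orbit (fst p)), tangent_coord c (fst p) (snd p)) \<in> Z"
          using tangent_vector_in[OF p(3)] U(2) unfolding U(1)
          by (simp add: tangent_basis_set_def tangent_vector_def W(2) case_prod_unfold)
        then show ?thesis
          using cone_chart_apply(2)[OF h(1) p(1,2)] tangent_coord_apply[OF h(1) p(1,2)]
          by (simp add: \<theta>_def W(2))
      qed
      moreover have "z \<in> N"
        using z x h by (simp add: N_def xw)
      ultimately show "\<exists>T. openin (top_of_set sphere_tangent) T \<and> z \<in> T \<and>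
          T \<subseteq> tangent_vector -` U \<inter> topspace (top_of_set sphere_tangent)"
        using z openin_imp_subset[OF N] by (intro exI[of _ "N \<inter> \<theta> -` Z"]) auto
    qed
  qed
  show "tangent_vector ` sphere_tangent = topspace (bun_total ?T)"
    unfolding topspace_tangent_bundle
  proof (intro equalityI subsetI)
    fix z assume "z \<in> tangent_vector ` sphere_tangent"
    then obtain p where "p \<in> sphere_tangent" "z = tangent_vector p"
      by (elim imageE)
    then show "z \<in> tangent_vectors S7Q8 S7Q8_atlas"
      using tangent_vector_in[of "fst p" "snd p"] by simp
  next
    fix z assume z: "z \<in> tangent_vectors S7Q8 S7Q8_atlas"
    obtain p t where pt: "z = (p, t)"
      by (cases z)
    then have "p \<in> topspace S7Q8"
      using z by (simp add: tangent_vectors_def)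
    then obtain x where x: "x \<in> S7" "p = orbit x"
      unfolding topspace_S7Q8 by (elim imageE)
    obtain W L u where W: "sphere_chart W L u" "x \<in> W"
      using chart_around[OF x(1)] .
    interpret sphere_chart W L u by fact
    have "p \<in> orbit ` W"
      using W(2) x(2) by simp
    from tangent_vector_dchart_inverse[OF z[unfolded pt] this] show "z \<in> tangent_vector ` sphere_tangent"
      unfolding pt by (metis image_eqI)
  qed
  show "open_map (top_of_set sphere_tangent) (bun_total ?T) tangent_vector"
    unfolding open_map_def
  proof (intro allI impI)
    fix V assume V: "openin (top_of_set sphere_tangent) V"
    show "openin (bun_total ?T) (tangent_vector ` V)"
    proof (subst openin_subopen, intro ballI)
      fix z assume "z \<in> tangent_vector ` V"
      then obtain p where p: "p \<in> V" "z = tangent_vector p"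
        by (elim imageE)
      obtain x w where xw: "p = (x, w)"
        by (cases p)
      have D: "(x, w) \<in> sphere_tangent"
        using p(1) xw openin_imp_subset[OF V] by blast
      then have x: "x \<in> S7" "x \<bullet> w = 0"
        by (simp_all add: sphere_tangent_def)
      obtain W L u where W: "sphere_chart W L u" "x \<in> W"
        using chart_around[OF x(1)] .
      interpret sphere_chart W L u by fact
      \<comment> \<open>A continuous inverse of the chart description, defined on all coordinates.
        The preimage of V under it gives a basic open set contained in the image of V.\<close>
      define \<psi> where "\<psi> a = (chart_inverse (fst a), dchart_inverse (fst a) (snd a))" for a
      have "continuous_on UNIV (\<lambda>a :: (real ^ 7) \<times> (real ^ 7). chart_inverse (fst a))"
        by (rule continuous_on_compose2[OF continuous_on_chart_inverse[of UNIV] continuous_on_fst[OF continuous_on_id]]) simp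
      then have "continuous_map euclidean (top_of_set sphere_tangent) \<psi>"
        unfolding \<psi>_def[abs_def]
        using continuous_on_dchart_inverse[of UNIV]
        by (simp add: continuous_map_in_subtopology sphere_tangent_def chart_inverse_S7 dchart_inverse_tangent
            image_subset_iff continuous_on_Pair)
      from openin_continuous_map_preimage[OF this V] have "open {a. \<psi> a \<in> V}"
        by simp
      define T where "T = tangent_basis_set chart {a. \<psi> a \<in> V}"
      have "openin (bun_total ?T) T"
        unfolding bun_total_tangent_bundle T_def
        by (rule topology_generated_by_Basis) (use chart_in_atlas \<open>open {a. \<psi> a \<in> V}\<close> in blast)
      moreover have "z \<in> T"
      proof -
        have "act q1 x \<in> W"
          using W(2) by simp
        note app = cone_chart_apply(2)[OF q1_in_Q8 x(1) this] tangent_coord_apply[OF q1_in_Q8 x(1) this]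
        have "\<psi> (projective_coord L u x, dproj L u x w) = (x, w)"
          using chart_inverse_projective_coord[OF x(1) pos[OF W(2)]] dchart_inverse_dproj[OF x(1) pos[OF W(2)] x(2)]
          by (simp add: \<psi>_def)
        moreover have "fst z = orbit x" "snd z chart = dproj L u x w" "chart_map (orbit x) = projective_coord L u x"
          using app chart_in_atlas W(2) by (simp_all add: p(2) xw tangent_vector_def)
        ultimately show ?thesis
          using tangent_vector_in[OF D] p W(2) unfolding T_def tangent_basis_set_def xw by (simp add: case_prod_unfold)
      qed
      moreover have "T \<subseteq> tangent_vector ` V"
      proof
        fix t assume t: "t \<in> T"
        obtain b s where bs: "t = (b, s)"
          by (cases t)
        have "(b, s) \<in> tangent_vectors S7Q8 S7Q8_atlas" "b \<in> orbit ` W" "\<psi> (chart_map b, s chart) \<in> V"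
          using t by (simp_all add: T_def bs tangent_basis_set_def)
        from tangent_vector_dchart_inverse(2)[OF this(1,2)] this(3) show "t \<in> tangent_vector ` V"
          unfolding bs \<psi>_def by (metis fst_conv snd_conv image_eqI)
      qed
      ultimately show "\<exists>T. openin (bun_total ?T) T \<and> z \<in> T \<and> T \<subseteq> tangent_vector ` V"
        by blast
    qed
  qed
  fix x v w :: "quat \<times> quat"
  assume xv: "(x, v) \<in> sphere_tangent"
  then have x: "x \<in> S7" "x \<bullet> v = 0"
    by (simp_all add: sphere_tangent_def)
  show "(x, r *\<^sub>R v) \<in> sphere_tangent" for r
    using x by (simp add: sphere_tangent_def)
  show "(act g x, act g v) \<in> sphere_tangent" if "g \<in> Q8" for g
    using x that by (simp add: sphere_tangent_def inner_act_act)
  show "tangent_vector (act g x, act g v) = tangent_vector (x, v)" if "g \<in> Q8" for g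
    using x that tangent_coord_act[of _ x g v] by (simp add: tangent_vector_def fun_eq_iff)
  show "bun_proj ?T (tangent_vector (x, v)) = orbit x"
    by (simp add: tangent_bundle_def tangent_vector_def)
  have lin: "tangent_coord c x (a + b) = tangent_coord c x a + tangent_coord c x b"
    "tangent_coord c x (r *\<^sub>R a) = r *\<^sub>R tangent_coord c x a"
    if c: "c \<in> S7Q8_atlas" "orbit x \<in> fst c" for c a b r
  proof -
    obtain W L u where W: "sphere_chart W L u" "c = (orbit ` W, sphere_chart.chart_map W L u)"
      using S7Q8_atlas_chart[OF c(1)] .
    interpret sphere_chart W L u by fact
    obtain h where h: "h \<in> Q8" "act h x \<in> W"
      using chart_member[of x] c(2) W(2) by auto
    show "tangent_coord c x (a + b) = tangent_coord c x a + tangent_coord c x b"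
      "tangent_coord c x (r *\<^sub>R a) = r *\<^sub>R tangent_coord c x a"
      unfolding W(2) tangent_coord_apply[OF h(1) x(1) h(2)]
      by (simp_all add: act.add_right act.scaleR_right dproj_linear[OF lin])
  qed
  show "bun_scale ?T r (tangent_vector (x, v)) = tangent_vector (x, r *\<^sub>R v)" for r
    using lin by (simp add: tangent_bundle_def tangent_vector_def fun_eq_iff)
  assume xw: "(x, w) \<in> sphere_tangent"
  then have w: "x \<bullet> w = 0"
    by (simp add: sphere_tangent_def)
  show "(x, v + w) \<in> sphere_tangent"
    using x w by (simp add: sphere_tangent_def inner_add_right)
  show "bun_add ?T (tangent_vector (x, v)) (tangent_vector (x, w)) = tangent_vector (x, v + w)"
    using lin by (simp add: tangent_bundle_def tangent_vector_def fun_eq_iff)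
  assume eq: "tangent_vector (x, v) = tangent_vector (x, w)"
  obtain W L u where W: "sphere_chart W L u" "x \<in> W"
    using chart_around[OF x(1)] .
  interpret sphere_chart W L u by fact
  have a: "act q1 x \<in> W"
    using W(2) by simp
  have "snd (tangent_vector (x, v)) chart = snd (tangent_vector (x, w)) chart"
    using eq by simp
  then have "tangent_coord chart x v = tangent_coord chart x w"
    using chart_in_atlas W(2) by (simp add: tangent_vector_def)
  then have "dproj L u x v = dproj L u x w"
    unfolding tangent_coord_apply[OF q1_in_Q8 x(1) a] act_q1 .
  from arg_cong[OF this, of "dchart_inverse (projective_coord L u x)"] show "v = w"
    unfolding dchart_inverse_dproj[OF x(1) pos[OF W(2)] x(2)] dchart_inverse_dproj[OF x(1) pos[OF W(2)] w] .
qed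

section \<open>The stable normal bundle\<close>

definition y_multiple :: "quat \<Rightarrow> (complex ^ 2) ^ 'n \<Rightarrow> (complex ^ 2) ^ 'n" where
  "y_multiple g v = (\<chi> i. y_rep g (v $ i))"

definition quat_of_vec :: "complex ^ 2 \<Rightarrow> quat" where
  "quat_of_vec v = (v $ 1, v $ 2)"

definition vec_of_quat :: "quat \<Rightarrow> complex ^ 2" where
  "vec_of_quat q = vector [fst q, snd q]"

lemma quat_of_vec_inverse [simp]: "vec_of_quat (quat_of_vec v) = v" "quat_of_vec (vec_of_quat q) = q"
  by (simp_all add: quat_of_vec_def vec_of_quat_def vec_eq_iff forall_2)

lemma quat_of_vec_linear:
  "quat_of_vec (v + w) = quat_of_vec v + quat_of_vec w" "quat_of_vec (r *\<^sub>R v) = r *\<^sub>R quat_of_vec v"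
  "vec_of_quat (p + q) = vec_of_quat p + vec_of_quat q" "vec_of_quat (r *\<^sub>R q) = r *\<^sub>R vec_of_quat q"
  by (simp_all add: quat_of_vec_def vec_of_quat_def vec_eq_iff forall_2)

lemma quat_of_vec_y_rep: "quat_of_vec (y_rep g v) = qmult g (quat_of_vec v)"
proof -
  have "y_rep g v = vec_of_quat (qmult g (quat_of_vec v))"
    using rep_y_left_mult[of g "v $ 1" "v $ 2"] quat_of_vec_inverse(1)[of v]
    by (simp add: vec_of_quat_def quat_of_vec_def)
  then show ?thesis
    by simp
qed

text \<open>Two copies of y in \<open>act\<close> and six more are regrouped in pairs as four copies
  of \<open>act\<close>. The inverse k of an arbitrary enumeration of the index type selects entries
  of a list of length 6.\<close>

lemma act_plus_six_y_iso:
  "act \<boxplus> (y_multiple :: _ \<Rightarrow> (complex ^ 2) ^ 6 \<Rightarrow> _) \<approx>\<^sub>Q (act \<boxplus> act) \<boxplus> (act \<boxplus> act)"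
proof -
  obtain idx :: "nat \<Rightarrow> 6" where idx: "bij_betw idx {..<6} UNIV"
    using ex_bij_betw_nat_finite[of "UNIV :: 6 set"] by (auto simp: atLeast0LessThan)
  define k where "k = inv_into {..<6} idx"
  have k: "idx (k j) = j" "k j < 6" for j
    using bij_betw_inv_into_right[OF idx] bij_betwE[OF bij_betw_inv_into[OF idx]] by (simp_all add: k_def)
  have k': "k (idx i) = i" if "i < 6" for i
    using bij_betw_inv_into_left[OF idx] that by (simp add: k_def)
  let ?h = "\<lambda>v i. quat_of_vec (v $ idx i)"
  define f :: "(quat \<times> quat) \<times> ((complex ^ 2) ^ 6) \<Rightarrow> quat4 \<times> quat4" where
    "f = (\<lambda>(w, v). ((w, (?h v 0, ?h v 1)), ((?h v 2, ?h v 3), (?h v 4, ?h v 5))))"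
  define f' :: "quat4 \<times> quat4 \<Rightarrow> (quat \<times> quat) \<times> ((complex ^ 2) ^ 6)" where
    "f' = (\<lambda>((w, (a, b)), ((c, d), (e, s))). (w, \<chi> j. vec_of_quat ([a, b, c, d, e, s] ! k j)))"
  show ?thesis
  proof (rule equivariant_iso_const[where f = f and f' = f'])
    show "linear f"
      by (rule linearI) (simp_all add: f_def case_prod_unfold quat_of_vec_linear)
    have nth: "([a, b, c, d, e, s] ! k j :: quat) + [a', b', c', d', e', s'] ! k j =
        [a + a', b + b', c + c', d + d', e + e', s + s'] ! k j"
      "r *\<^sub>R ([a, b, c, d, e, s] ! k j) = [r *\<^sub>R a, r *\<^sub>R b, r *\<^sub>R c, r *\<^sub>R d, r *\<^sub>R e, r *\<^sub>R s] ! k j"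
      for a b c d e s a' b' c' d' e' s' r j
      using k(2)[of j] by (auto simp: less_Suc_eq numeral_eq_Suc)
    show "linear f'"
      by (rule linearI) (simp_all add: f'_def case_prod_unfold vec_eq_iff nth flip: quat_of_vec_linear)
    show "f' (f v) = v" for v
    proof -
      have "vec_of_quat ([?h v 0, ?h v 1, ?h v 2, ?h v 3, ?h v 4, ?h v 5] ! k j) = v $ j" for v j
      proof -
        have "[?h v 0, ?h v 1, ?h v 2, ?h v 3, ?h v 4, ?h v 5] ! k j = ?h v (k j)"
          using k(2)[of j] by (auto simp: less_Suc_eq numeral_eq_Suc)
        then show ?thesis
          by (simp add: k(1))
      qed
      then show ?thesis
        by (simp add: f_def f'_def case_prod_unfold vec_lambda_eta)
    qed
    show "f (f' w) = w" for w
      by (simp add: f_def f'_def case_prod_unfold k')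
    show "f ((act \<boxplus> y_multiple) g v) = ((act \<boxplus> act) \<boxplus> (act \<boxplus> act)) g (f v)" if "g \<in> Q8" for g v
      by (simp add: f_def rep_sum_def case_prod_unfold map_prod_def y_multiple_def quat_of_vec_y_rep act_def)
  qed
qed

text \<open>Adding the radial direction to the tangent bundle of the sphere gives the trivial bundle
  whose fibre is the space of pairs of quaternions, on which \<open>Q\<^sub>8\<close> acts as on two copies of the representation \<open>y\<close>.\<close>

theorem is_stable_normal_bundle_of_model:
  assumes N: "bundle_model E (y_multiple :: _ \<Rightarrow> (complex ^ 2) ^ 6 \<Rightarrow> _) (S7 \<times> UNIV) q"
  shows "is_stable_normal_bundle S7Q8 S7Q8_atlas E"
proof -
  let ?\<rho> = "(act \<boxplus> (y_multiple :: _ \<Rightarrow> (complex ^ 2) ^ 6 \<Rightarrow> _)) \<boxplus> (trivial_rep :: _ \<Rightarrow> quat4 \<times> quat4 \<Rightarrow> _)"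
  let ?\<tau> = "trivial_rep :: _ \<Rightarrow> quat4 \<times> (quat4 \<times> (quat4 \<times> quat4)) \<Rightarrow> _"
  have "?\<rho> \<approx>\<^sub>Q ?\<tau>"
    by (rule equivariant_iso_trans[OF equivariant_iso_sum[OF act_plus_six_y_iso equivariant_iso_refl]
          four_act_stably_trivial])
  then obtain M N where fam: "equivariant_family ?\<rho> ?\<tau> M N"
    unfolding equivariant_iso_def by blast
  note M = equivariant_familyD[OF fam]
  note model = bundle_model_whitney_sum[OF bundle_model_whitney_sum[OF bundle_model_tangent N]
      bundle_model_trivial[where 'a = "real \<times> (quat4 \<times> quat4)"]]
  let ?D = "{(x, v, w). (x, v) \<in> {(x, v, w). (x, v) \<in> sphere_tangent \<and> (x, w) \<in> S7 \<times> (UNIV :: ((complex ^ 2) ^ 6) set)} \<and>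
    (x, w) \<in> S7 \<times> (UNIV :: (real \<times> (quat4 \<times> quat4)) set)}"
  \<comment> \<open>The real coordinate is the coefficient of the radial vector x. As x is itself
    moved by the action, this is equivariant for the trivial action on that coordinate; \<Psi>
    recovers it as an inner product with the unit vector x.\<close>
  define \<Phi> where "\<Phi> x v = M x ((fst (fst v) + fst (snd v) *\<^sub>R x, snd (fst v)), snd (snd v))"
    for x and v :: "((quat \<times> quat) \<times> ((complex ^ 2) ^ 6)) \<times> (real \<times> (quat4 \<times> quat4))"
  define \<Psi> :: "quat \<times> quat \<Rightarrow> _ \<Rightarrow> ((quat \<times> quat) \<times> ((complex ^ 2) ^ 6)) \<times> (real \<times> (quat4 \<times> quat4))" where
    "\<Psi> x z = ((fst (fst (N x z)) - (x \<bullet> fst (fst (N x z))) *\<^sub>R x, snd (fst (N x z))),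
       (x \<bullet> fst (fst (N x z)), snd (N x z)))" for x z
  have D: "(x, v) \<in> ?D \<longleftrightarrow> x \<in> S7 \<and> x \<bullet> fst (fst v) = 0" for x v
    by (auto simp: sphere_tangent_def)
  have xx: "x \<bullet> x = 1" if "x \<in> S7" for x
    using that by (simp add: dot_square_norm norm_S7_element)
  \<comment> \<open>The ranks are 7 + 24 + 33 = 64.\<close>
  have "(tangent_bundle S7Q8 S7Q8_atlas \<oplus>\<^sub>b E) \<oplus>\<^sub>b trivial_bundle S7Q8 DIM(real \<times> (quat4 \<times> quat4)) \<cong>\<^sub>b
      trivial_bundle S7Q8 DIM(quat4 \<times> (quat4 \<times> (quat4 \<times> quat4)))"
  proof (rule bundle_iso_of_models[OF model bundle_model_trivial, where \<Phi> = \<Phi> and \<Psi> = \<Psi>])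
    show "continuous_on ?D (\<lambda>p. \<Phi> (fst p) (snd p))"
      unfolding \<Phi>_def by (rule continuous_on_family_compose[OF M(1)]) (auto intro!: continuous_intros)
    have "continuous_on (S7 \<times> UNIV) (\<lambda>p. N (fst p) (snd p))"
      by (rule M(2))
    then show "continuous_on (S7 \<times> UNIV) (\<lambda>p. \<Psi> (fst p) (snd p))"
      unfolding \<Psi>_def by (intro continuous_intros)
    fix x :: "quat \<times> quat" and v :: "((quat \<times> quat) \<times> ((complex ^ 2) ^ 6)) \<times> (real \<times> (quat4 \<times> quat4))"
    assume "(x, v) \<in> ?D"
    then have x: "x \<in> S7" "x \<bullet> fst (fst v) = 0"
      unfolding D by simp_all
    show "(x, \<Phi> x v) \<in> S7 \<times> UNIV"
      using x by simp
    show "\<Psi> x (\<Phi> x v) = v"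
      using x by (simp add: \<Psi>_def \<Phi>_def M(4) inner_add_right xx)
    show "\<Phi> x (r *\<^sub>R v) = r *\<^sub>R \<Phi> x v" for r
      using linear_cmul[OF M(3)[OF x(1)], of r "((fst (fst v) + fst (snd v) *\<^sub>R x, snd (fst v)), snd (snd v))"]
      by (simp add: \<Phi>_def algebra_simps)
    show "\<Phi> (act g x) (((act \<boxplus> y_multiple) \<boxplus> trivial_rep) g v) = trivial_rep g (\<Phi> x v)" if "g \<in> Q8" for g
      using M(6)[OF x(1) that, of "((fst (fst v) + fst (snd v) *\<^sub>R x, snd (fst v)), snd (snd v))"]
      by (simp add: \<Phi>_def rep_sum_def case_prod_unfold map_prod_def trivial_rep_def act.add_right act.scaleR_right)
    fix w assume "(x, w) \<in> ?D"
    show "\<Phi> x (v + w) = \<Phi> x v + \<Phi> x w"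
      using linear_add[OF M(3)[OF x(1)], of "((fst (fst v) + fst (snd v) *\<^sub>R x, snd (fst v)), snd (snd v))"
          "((fst (fst w) + fst (snd w) *\<^sub>R x, snd (fst w)), snd (snd w))"]
      by (simp add: \<Phi>_def algebra_simps)
  next
    fix x and z :: "quat4 \<times> (quat4 \<times> (quat4 \<times> quat4))" assume "(x, z) \<in> S7 \<times> UNIV"
    then have x: "x \<in> S7"
      by simp
    show "(x, \<Psi> x z) \<in> ?D"
      unfolding D using x by (simp add: \<Psi>_def inner_diff_right xx)
    show "\<Phi> x (\<Psi> x z) = z"
      using x by (simp add: \<Psi>_def \<Phi>_def M(5))
  qed
  moreover have "bun_base (tangent_bundle S7Q8 S7Q8_atlas \<oplus>\<^sub>b E) = S7Q8"
    by (simp add: whitney_sum_def tangent_bundle_def)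
  ultimately have "stably_trivial (tangent_bundle S7Q8 S7Q8_atlas \<oplus>\<^sub>b E)"
    unfolding stably_trivial_def by auto
  then show ?thesis
    using vector_bundle_of_model[OF N] bundle_model.base[OF N] by (simp add: is_stable_normal_bundle_def)
qed

lemma bundle_model_six_eta:
  obtains q where "bundle_model (multiple_bundle 6 eta_R) (y_multiple :: _ \<Rightarrow> (complex ^ 2) ^ 6 \<Rightarrow> _) (S7 \<times> UNIV) q"
proof -
  obtain idx :: "nat \<Rightarrow> 6" where "bij_betw idx {..<6} UNIV"
    using ex_bij_betw_nat_finite[of "UNIV :: 6 set"] by (auto simp: atLeast0LessThan)
  from bundle_model_multiple[OF bundle_model_eta this] show thesis
    by (rule that[unfolded y_multiple_def[abs_def]])
qed

theorem mainTheorem3: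
  shows
    "closed_smooth_manifold S7Q8 S7Q8_atlas \<and>
     is_stable_normal_bundle S7Q8 S7Q8_atlas (multiple_bundle 6 eta_R) \<and>
     \<comment> \<open>for either orientation of the manifold:\<close>
     (\<forall>\<mu>. fundamental_class 7 S7Q8 \<mu> \<longrightarrow>
        \<comment> \<open>the identity map satisfies the hypotheses of the assertion, with \<open>k = 3\<close> \<close>
        continuous_map S7Q8 S7Q8 id \<and>
        odd (3::nat) \<and>
        is_stable_normal_bundle S7Q8 S7Q8_atlas
          (pullback_bundle S7Q8 id (multiple_bundle (2 * 3) eta_R)) \<and>
        \<comment> \<open>it has degree 1\<close>
        mapping_degree 7 S7Q8 \<mu> S7Q8 \<mu> id = 1 \<and>
        \<comment> \<open>so the assertion is false\<close>
        \<not> (\<forall>(K :: (quat \<times> quat) set topology) (A :: ((quat \<times> quat) set, real ^ 7) chart set)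
              \<kappa> f k.
             closed_smooth_manifold K A \<and> fundamental_class 7 K \<kappa> \<and>
             continuous_map K S7Q8 f \<and> odd k \<and>
             is_stable_normal_bundle K A (pullback_bundle K f (multiple_bundle (2 * k) eta_R))
             \<longrightarrow> even (mapping_degree 7 K \<kappa> S7Q8 \<mu> f)))"
proof -
  obtain q where q: "bundle_model (multiple_bundle 6 eta_R) (y_multiple :: _ \<Rightarrow> (complex ^ 2) ^ 6 \<Rightarrow> _) (S7 \<times> UNIV) q"
    by (rule bundle_model_six_eta)
  \<comment> \<open>The pullback along the identity is modelled by the same family over the sphere,
    so one theorem covers both bundles.\<close>
  note normal = is_stable_normal_bundle_of_model[OF q]
    is_stable_normal_bundle_of_model[OF bundle_model_pullback_id[OF q]]
  have degree: "mapping_degree 7 S7Q8 \<mu> S7Q8 \<mu> id = 1" if "fundamental_class 7 S7Q8 \<mu>" for \<mu>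
  proof -
    have "topspace S7Q8 \<noteq> {}"
      by (simp add: topspace_S7Q8 S7_def)
    then show ?thesis
      using mapping_degree_id[OF closed_smooth_manifold_S7Q8, of \<mu>] that by simp
  qed
  show ?thesis
  proof (intro conjI allI impI closed_smooth_manifold_S7Q8 normal)
    fix \<mu> assume \<mu>: "fundamental_class 7 S7Q8 \<mu>"
    show "continuous_map S7Q8 S7Q8 id" "odd (3 :: nat)"
      by simp_all
    show deg: "mapping_degree 7 S7Q8 \<mu> S7Q8 \<mu> id = 1"
      by (rule degree[OF \<mu>])
    show pull: "is_stable_normal_bundle S7Q8 S7Q8_atlas (pullback_bundle S7Q8 id (multiple_bundle (2 * 3) eta_R))"
      using normal(2) by simp
    show "\<not> (\<forall>(K :: (quat \<times> quat) set topology) (A :: ((quat \<times> quat) set, real ^ 7) chart set) \<kappa> f k.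
        closed_smooth_manifold K A \<and> fundamental_class 7 K \<kappa> \<and> continuous_map K S7Q8 f \<and> odd k \<and>
        is_stable_normal_bundle K A (pullback_bundle K f (multiple_bundle (2 * k) eta_R)) \<longrightarrow>
        even (mapping_degree 7 K \<kappa> S7Q8 \<mu> f))" (is "\<not> ?assertion")
    proof
      assume ?assertion
      \<comment> \<open>The quantifier over manifolds ranges over a carrier type that contains the
        orbit space itself, so the identity is an instance, and its degree 1 is odd.\<close>
      from this[rule_format, of S7Q8 S7Q8_atlas \<mu> id 3] show False
        using closed_smooth_manifold_S7Q8 \<mu> pull deg by simp
    qed
  qed
qed

end
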